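(* Let $X=\{X_p\}_{p\in P}$ be a product system over a lattice ordered abelian group $(G,P)$. Let $\psi:X\to B(\mathcal{H})$ be a faithful Nica-covariant representation that satisfies the following property: for any $p,q\in P$ and $x\in X_p$, $y\in X_q$, $$\psi_p(x)^*\psi_q(y)\in\overline{\operatorname{span}}\{\psi(z)\psi(w)^*\mid z\in X_{p^{-1}(p\vee q)},\ w\in X_{q^{-1}(p\vee q)}\}.$$ Then $X$ is compactly aligned. Conversely, if $X$ is compactly aligned, then any Nica-covariant isometric representation $\psi$ of $X$ satisfies, for any $p,q\in P$ and $x\in X_p$, $y\in X_q$, $$\psi_p(x)^*\psi_q(y)\in\overline{\operatorname{span}}\{\psi(z)\psi(w)^*\mid z\in X_{p^{-1}(p\vee q)},\ w\in X_{q^{-1}(p\vee q)}\}.$$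
   Context: For a $C^*$-algebra $A$, an $A$-correspondence is a right Hilbert $A$-module $X$ with a non-degenerate $*$-homomorphism $\phi:A\to\mathcal{L}(X)$ (closed linear span of $\phi(A)X$ is $X$). $\mathcal{K}(X)$ is the closed span of the operators $\theta_{x,y}(z)=x\langle y,z\rangle$. Tensor products of correspondences are interior tensor products. A lattice ordered abelian group $(G,P)$: $G$ is a discrete abelian group, $P\subseteq G$ a submonoid with $P\cap P^{-1}=\{e\}$, such that for the order $s\le t\iff s^{-1}t\in P$ any two elements have a least upper bound $s\vee t$. A product system $X=\{X_p\}_{p\in P}$ is a family of correspondences over the $C^*$-algebra $X_e$ ($X_e$ being the trivial correspondence over itself) with unitary bimodule isomorphisms $U_{p,q}:X_p\otimes X_q\to X_{pq}$, written $x\otimes y\mapsto xy$, such that $U_{e,p},U_{p,e}$ are the left and right multiplications and the multiplication is associative. For $S\in\mathcal{L}(X_p)$, $S\otimes I\in\mathcal{L}(X_{pq})$ is given by $(S\otimes I)(xy)=(Sx)y$. $X$ is compactly aligned if $(S\otimes I)(T\otimes I)\in\mathcal{K}(X_{p\vee q})$ for all $p,q\in P$, $S\in\mathcal{K}(X_p)$, $T\in\mathcal{K}(X_q)$. An isometric representation $\psi$ of $X$ in a $C^*$-algebra $B$ consists of linear maps $\psi_p:X_p\to B$ with $\psi_e$ a $*$-homomorphism, $\psi_p(x)\psi_q(y)=\psi_{pq}(xy)$ and $\psi_p(x)^*\psi_p(y)=\psi_e(\langle x,y\rangle)$. The subscript on $\psi$ is omitted when clear. It is faithful if $\psi_e$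 is injective (then every $\psi_p$ is isometric). It induces $*$-homomorphisms $\psi_p:\mathcal{K}(X_p)\to B$, $\theta_{x,y}\mapsto\psi_p(x)\psi_p(y)^*$. Nica-covariance. For a representation $\psi$ of an arbitrary product system on a Hilbert space $\mathcal{H}$ with $\psi_e$ non-degenerate, let $\rho_p:\mathcal{L}(X_p)\to B(\mathcal{H})$ be the strict-to-strong continuous extension of $\psi_p:\mathcal{K}(X_p)\to B(\mathcal{H})$, so that $\rho_p(I)$ is the projection onto the closed span of $\psi_p(X_p)\mathcal{H}$; $\psi$ is Nica-covariant if $\rho_p(I)\rho_q(I)=\rho_{p\vee q}(I)$ for all $p,q\in P$. When $X$ is compactly aligned, an isometric representation in a $C^*$-algebra is Nica-covariant if $\psi_p(S)\psi_q(T)=\psi_{p\vee q}((S\otimes I)(T\otimes I))$ for all $S\in\mathcal{K}(X_p)$, $T\in\mathcal{K}(X_q)$; the two conditions agree when both apply. *)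

theory Defs
  imports "HOL-Analysis.Analysis" "HOL-Library.Lattice_Algebras"
begin

section \<open>Complex vector spaces, C*-algebras and Hilbert spaces\<close>

class complex_vector = real_vector +
  fixes scaleC :: "complex \<Rightarrow> 'a \<Rightarrow> 'a" (infixr \<open>*\<^sub>C\<close> 75)
  assumes scaleC_add_right: "c *\<^sub>C (x + y) = c *\<^sub>C x + c *\<^sub>C y"
    and scaleC_add_left: "(c + d) *\<^sub>C x = c *\<^sub>C x + d *\<^sub>C x"
    and scaleC_scaleC: "c *\<^sub>C d *\<^sub>C x = (c * d) *\<^sub>C x"
    and scaleC_one: "1 *\<^sub>C x = x"
    and scaleR_scaleC: "r *\<^sub>R x = complex_of_real r *\<^sub>C x"

global_interpretation complex_vector: vector_space "scaleC :: complex \<Rightarrow> 'a \<Rightarrow> 'a::complex_vector"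
  defines cspan = complex_vector.span
    and csubspace = complex_vector.subspace
  by standard (simp_all add: scaleC_add_right scaleC_add_left scaleC_scaleC scaleC_one)

text \<open>C*-algebras are not assumed to be unital.\<close>

class cstar_algebra = complex_vector + real_normed_algebra + banach +
  fixes star :: "'a \<Rightarrow> 'a"
  assumes norm_scaleC: "norm (c *\<^sub>C a) = cmod c * norm a"
    and mult_scaleC_left: "(c *\<^sub>C a) * b = c *\<^sub>C (a * b)"
    and mult_scaleC_right: "a * (c *\<^sub>C b) = c *\<^sub>C (a * b)"
    and star_star: "star (star a) = a"
    and star_add: "star (a + b) = star a + star b"
    and star_scaleC: "star (c *\<^sub>C a) = cnj c *\<^sub>C star a"
    and star_mult: "star (a * b) = star b * star a"
    and cstar_identity: "norm (star a * a) = (norm a)\<^sup>2"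

definition cstar_pos :: "'a::cstar_algebra \<Rightarrow> bool" where
  "cstar_pos a \<longleftrightarrow> (\<exists>b. a = star b * b)"

text \<open>Inner products are linear in the second variable.\<close>

class complex_hilbert = complex_vector + banach +
  fixes cinner :: "'a \<Rightarrow> 'a \<Rightarrow> complex"
  assumes cinner_add_right: "cinner x (y + z) = cinner x y + cinner x z"
    and cinner_scaleC_right: "cinner x (c *\<^sub>C y) = c * cinner x y"
    and cinner_commute: "cinner x y = cnj (cinner y x)"
    and cinner_norm: "cinner x x = complex_of_real ((norm x)\<^sup>2)"


section \<open>The C*-algebra of bounded operators on a Hilbert space\<close>

lemma cinner_add_left: "cinner (x + y) z = cinner x z + cinner y (z::'a::complex_hilbert)"
  by (metis cinner_add_right cinner_commute complex_cnj_add)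

lemma cinner_scaleC_left: "cinner (c *\<^sub>C x) y = cnj c * cinner x (y::'a::complex_hilbert)"
  by (metis cinner_commute cinner_scaleC_right complex_cnj_mult)

lemma cinner_zero_right: "cinner x (0::'a::complex_hilbert) = 0"
  using cinner_scaleC_right[of x 0 0] by simp

lemma cinner_zero_left: "cinner (0::'a::complex_hilbert) x = 0"
  by (metis cinner_commute cinner_zero_right complex_cnj_zero)

lemma cinner_minus_right: "cinner x (- y) = - cinner x (y::'a::complex_hilbert)"
  by (metis add.right_inverse add_eq_0_iff cinner_add_right cinner_zero_right)

lemma cinner_diff_right: "cinner x (y - z) = cinner x y - cinner x (z::'a::complex_hilbert)"
  using cinner_add_right[of x y "- z"] by (simp add: cinner_minus_right)

lemma cinner_minus_left: "cinner (- x) y = - cinner x (y::'a::complex_hilbert)"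
  by (metis cinner_commute cinner_minus_right complex_cnj_minus)

lemma cinner_diff_left: "cinner (x - y) z = cinner x z - cinner y (z::'a::complex_hilbert)"
  using cinner_add_left[of x "- y" z] by (simp add: cinner_minus_left)

lemma norm_add_sq: "(norm (x + y))\<^sup>2 = (norm x)\<^sup>2 + (norm y)\<^sup>2 + 2 * Re (cinner x (y::'a::complex_hilbert))"
proof -
  have "complex_of_real ((norm (x + y))\<^sup>2) = cinner (x + y) (x + y)"
    by (simp only: cinner_norm)
  also have "\<dots> = cinner x x + cinner y y + (cinner x y + cnj (cinner x y))"
    using cinner_commute[of y x] by (simp add: cinner_add_left cinner_add_right)
  also have "\<dots> = complex_of_real ((norm x)\<^sup>2 + (norm y)\<^sup>2 + 2 * Re (cinner x y))"
    by (simp only: cinner_norm complex_add_cnj of_real_add)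
  finally show ?thesis using of_real_eq_iff by blast
qed

lemma norm_scaleC_hilbert: "norm (c *\<^sub>C x) = cmod c * norm (x::'a::complex_hilbert)"
proof -
  have "complex_of_real ((norm (c *\<^sub>C x))\<^sup>2) = c * cnj c * cinner x x"
    by (simp only: cinner_norm[symmetric]) (simp add: cinner_scaleC_left cinner_scaleC_right mult_ac)
  also have "\<dots> = complex_of_real ((cmod c * norm x)\<^sup>2)"
    by (simp add: cinner_norm complex_norm_square[symmetric] power_mult_distrib)
  finally have "(norm (c *\<^sub>C x))\<^sup>2 = (cmod c * norm x)\<^sup>2"
    using of_real_eq_iff by blast
  then show ?thesis by (simp add: power2_eq_iff_nonneg)
qed

lemma bounded_linear_scaleC: "bounded_linear (\<lambda>x::'a::complex_hilbert. c *\<^sub>C x)"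
  by (rule bounded_linear_intro[where K = "cmod c"])
    (simp_all add: scaleC_add_right norm_scaleC_hilbert scaleR_scaleC scaleC_scaleC mult.commute)

lemma parallelogram:
  "(norm (x - y))\<^sup>2 = 2 * (norm x)\<^sup>2 + 2 * (norm y)\<^sup>2 - (norm (x + (y::'a::complex_hilbert)))\<^sup>2"
  using norm_add_sq[of x y] norm_add_sq[of x "- y"] by (simp add: cinner_minus_right)

lemma orthogonal_if_minimal:
  fixes u y :: "'a::complex_hilbert"
  assumes min: "\<And>c. norm u \<le> norm (u + c *\<^sub>C y)"
  shows "cinner u y = 0"
proof (cases "y = 0")
  case True
  then show ?thesis by (simp add: cinner_zero_right)
next
  case False
  define t where "t = cinner u y"
  define n where "n = (norm y)\<^sup>2"
  have n: "n > 0" using False by (simp add: n_def)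
  define c where "c = - cnj t / complex_of_real n"
  have ct: "c * t = complex_of_real (- (cmod t)\<^sup>2 / n)"
    using complex_norm_square[of t] by (simp add: c_def mult.commute)
  have cm: "(cmod c)\<^sup>2 * n = (cmod t)\<^sup>2 / n"
    using n by (simp add: c_def norm_divide power_divide power2_eq_square)
  have "(norm u)\<^sup>2 \<le> (norm (u + c *\<^sub>C y))\<^sup>2"
    using min by (simp add: power_mono)
  also have "\<dots> = (norm u)\<^sup>2 + (cmod c)\<^sup>2 * n + 2 * Re (c * t)"
    by (simp add: norm_add_sq norm_scaleC_hilbert power_mult_distrib cinner_scaleC_right n_def t_def)
  also have "\<dots> = (norm u)\<^sup>2 - (cmod t)\<^sup>2 / n"
    unfolding ct cm by simp
  finally have "(cmod t)\<^sup>2 / n \<le> 0" by simp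
  then have "(cmod t)\<^sup>2 \<le> 0" using n by (simp add: divide_le_0_iff)
  then show ?thesis by (simp add: t_def)
qed

lemma cauchy_schwarz: "cmod (cinner x y) \<le> norm x * norm (y::'a::complex_hilbert)"
proof (cases "y = 0")
  case True
  then show ?thesis by (simp add: cinner_zero_right)
next
  case False
  define t where "t = cinner x y"
  define n where "n = (norm y)\<^sup>2"
  have n: "n > 0" using False by (simp add: n_def)
  define c where "c = - cnj t / complex_of_real n"
  have ct: "c * t = complex_of_real (- (cmod t)\<^sup>2 / n)"
    using complex_norm_square[of t] by (simp add: c_def mult.commute)
  have cm: "(cmod c)\<^sup>2 * n = (cmod t)\<^sup>2 / n"
    using n by (simp add: c_def norm_divide power_divide power2_eq_square)
  have "0 \<le> (norm (x + c *\<^sub>C y))\<^sup>2" by simp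
  also have "\<dots> = (norm x)\<^sup>2 + (cmod c)\<^sup>2 * n + 2 * Re (c * t)"
    by (simp add: norm_add_sq norm_scaleC_hilbert power_mult_distrib cinner_scaleC_right n_def t_def)
  also have "\<dots> = (norm x)\<^sup>2 - (cmod t)\<^sup>2 / n"
    unfolding ct cm by simp
  finally have "(cmod t)\<^sup>2 \<le> (norm x)\<^sup>2 * n" using n by (simp add: field_simps)
  then have "(cmod t)\<^sup>2 \<le> (norm x * norm y)\<^sup>2" by (simp add: n_def power_mult_distrib)
  then show ?thesis unfolding t_def by (rule power2_le_imp_le) simp
qed

lemma riesz_representation:
  fixes f :: "'a::complex_hilbert \<Rightarrow> complex"
  assumes bl: "bounded_linear f" and sc: "\<And>c x. f (c *\<^sub>C x) = c * f x"
  shows "\<exists>v. \<forall>x. f x = cinner v x"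
proof (cases "\<forall>x. f x = 0")
  case True
  then show ?thesis by (intro exI[of _ 0]) (simp add: cinner_zero_left)
next
  case False
  interpret bounded_linear f by fact
  define S where "S = {x. f x = 1}"
  obtain x0 where x0: "f x0 \<noteq> 0" using False by blast
  have "inverse (f x0) *\<^sub>C x0 \<in> S" using x0 by (simp add: S_def sc)
  then have Sne: "S \<noteq> {}" by blast
  define d where "d = (INF x\<in>S. norm x)"
  have bdd: "bdd_below (norm ` S)" by (rule bdd_belowI[of _ 0]) auto
  have d_le: "d \<le> norm x" if "x \<in> S" for x
    unfolding d_def using that by (intro cINF_lower bdd)
  have d0: "0 \<le> d" unfolding d_def using Sne by (intro cINF_greatest) auto
  have "\<exists>x\<in>S. norm x < d + inverse (real (Suc n))" for n
  proof -
    have "d < d + inverse (real (Suc n))" by simp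
    then show ?thesis unfolding d_def using cINF_less_iff[OF Sne bdd] by blast
  qed
  then obtain s where sS: "\<And>n. s n \<in> S" and sn: "\<And>n. norm (s n) < d + inverse (real (Suc n))"
    by metis
  have lim: "(\<lambda>n. norm (s n)) \<longlonglongrightarrow> d"
  proof (rule tendsto_sandwich)
    show "(\<lambda>n. d) \<longlonglongrightarrow> d" by simp
    show "(\<lambda>n. d + inverse (real (Suc n))) \<longlonglongrightarrow> d"
      using tendsto_add[OF tendsto_const LIMSEQ_inverse_real_of_nat] by force
    show "\<forall>\<^sub>F n in sequentially. d \<le> norm (s n)" by (simp add: d_le sS)
    show "\<forall>\<^sub>F n in sequentially. norm (s n) \<le> d + inverse (real (Suc n))"
      by (intro always_eventually allI less_imp_le sn)
  qed
  have half: "4 * d\<^sup>2 \<le> (norm (x + y))\<^sup>2" if "x \<in> S" "y \<in> S" for x y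
  proof -
    have "(1/2) *\<^sub>R (x + y) \<in> S" using that by (simp add: S_def add scaleR scaleR_conv_of_real)
    then have "d \<le> norm ((1/2) *\<^sub>R (x + y))" by (rule d_le)
    then have "2 * d \<le> norm (x + y)" by simp
    then have "(2 * d)\<^sup>2 \<le> (norm (x + y))\<^sup>2" using d0 by (intro power_mono) auto
    then show ?thesis by (simp add: power_mult_distrib)
  qed
  have sdiff: "(norm (s m - s n))\<^sup>2 \<le> 2 * ((norm (s m))\<^sup>2 - d\<^sup>2) + 2 * ((norm (s n))\<^sup>2 - d\<^sup>2)" for m n
    using parallelogram[of "s m" "s n"] half[OF sS[of m] sS[of n]] by simp
  have sq: "(\<lambda>n. (norm (s n))\<^sup>2 - d\<^sup>2) \<longlonglongrightarrow> 0"
    using tendsto_diff[OF tendsto_power[OF lim, of 2] tendsto_const[of "d\<^sup>2"]] by simp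
  have "Cauchy s"
  proof (rule CauchyI)
    fix e :: real assume e: "0 < e"
    then have "0 < e\<^sup>2 / 4" by simp
    from order_tendstoD(2)[OF sq this] obtain N
      where N: "\<And>n. n \<ge> N \<Longrightarrow> (norm (s n))\<^sup>2 - d\<^sup>2 < e\<^sup>2 / 4"
      by (auto simp: eventually_sequentially)
    have "norm (s m - s n) < e" if "m \<ge> N" "n \<ge> N" for m n
    proof -
      have "(norm (s m - s n))\<^sup>2 < e\<^sup>2" using sdiff[of m n] N[OF that(1)] N[OF that(2)] by simp
      then show ?thesis using e by (simp add: power_less_imp_less_base)
    qed
    then show "\<exists>M. \<forall>m\<ge>M. \<forall>n\<ge>M. norm (s m - s n) < e" by blast
  qed
  then obtain u where u: "s \<longlonglongrightarrow> u" using Cauchy_convergent convergent_def by blast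
  have "(\<lambda>n. f (s n)) \<longlonglongrightarrow> f u" using u by (rule tendsto)
  then have fu: "f u = 1" using sS by (simp add: S_def LIMSEQ_const_iff)
  have nu: "norm u = d" using LIMSEQ_unique[OF tendsto_norm[OF u] lim] .
  have u0: "u \<noteq> 0" using fu zero by auto
  have orth: "cinner u y = 0" if "f y = 0" for y
  proof (rule orthogonal_if_minimal)
    fix c show "norm u \<le> norm (u + c *\<^sub>C y)"
      unfolding nu by (rule d_le) (simp add: S_def add sc that fu)
  qed
  define v where "v = complex_of_real (1 / (norm u)\<^sup>2) *\<^sub>C u"
  have "f x = cinner v x" for x
  proof -
    have "f (x - f x *\<^sub>C u) = 0" by (simp add: diff sc fu)
    then have "cinner u (x - f x *\<^sub>C u) = 0" by (rule orth)
    then have "cinner u x = f x * complex_of_real ((norm u)\<^sup>2)"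
      by (simp add: cinner_diff_right cinner_scaleC_right cinner_norm)
    then show ?thesis using u0 by (simp add: v_def cinner_scaleC_left)
  qed
  then show ?thesis by blast
qed

typedef (overloaded) ('h::complex_hilbert) bop =
  "{T :: 'h \<Rightarrow>\<^sub>L 'h. \<forall>c x. blinfun_apply T (c *\<^sub>C x) = c *\<^sub>C blinfun_apply T x}"
  morphisms blinfun_of_bop Abs_bop
  by (rule exI[of _ 0]) (simp add: complex_vector.scale_zero_right)

definition bop_apply :: "'h::complex_hilbert bop \<Rightarrow> 'h \<Rightarrow> 'h" where
  "bop_apply T = blinfun_apply (blinfun_of_bop T)"

lemma bop_apply_scaleC: "bop_apply T (c *\<^sub>C x) = c *\<^sub>C bop_apply T x"
  using blinfun_of_bop[of T] by (simp add: bop_apply_def)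

lemma bop_eqI: "(\<And>x. bop_apply S x = bop_apply T x) \<Longrightarrow> S = T"
  by (metis blinfun_eqI blinfun_of_bop_inject bop_apply_def)

lemma bop_norm_bound: "norm (bop_apply T x) \<le> norm (blinfun_of_bop T) * norm x"
  by (simp add: bop_apply_def norm_blinfun)

lemma Abs_bop_apply:
  assumes "bounded_linear f" "\<And>c x. f (c *\<^sub>C x) = c *\<^sub>C f x"
  shows "bop_apply (Abs_bop (Blinfun f)) = f"
  by (simp add: bop_apply_def Abs_bop_inverse assms bounded_linear_Blinfun_apply)

lemma ex_adjoint:
  "\<exists>S. \<forall>x y. cinner (bop_apply S x) y = cinner x (bop_apply T (y::'h::complex_hilbert))"
proof -
  have bT: "bounded_linear (bop_apply T)" unfolding bop_apply_def by (rule blinfun.bounded_linear_right)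
  interpret T: bounded_linear "bop_apply T" by (rule bT)
  have bl: "bounded_linear (\<lambda>y. cinner x (bop_apply T y))" for x
  proof (rule bounded_linear_intro[where K = "norm x * norm (blinfun_of_bop T)"])
    fix y z :: 'h and r :: real
    show "cinner x (bop_apply T (y + z)) = cinner x (bop_apply T y) + cinner x (bop_apply T z)"
      by (simp add: T.add cinner_add_right)
    show "cinner x (bop_apply T (r *\<^sub>R y)) = r *\<^sub>R cinner x (bop_apply T y)"
      by (simp add: T.scaleR scaleR_scaleC[of r "bop_apply T y"] cinner_scaleC_right scaleR_conv_of_real)
    have "cmod (cinner x (bop_apply T y)) \<le> norm x * norm (bop_apply T y)" by (rule cauchy_schwarz)
    also have "\<dots> \<le> norm x * (norm (blinfun_of_bop T) * norm y)"
      by (intro mult_left_mono bop_norm_bound) simp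
    finally show "cmod (cinner x (bop_apply T y)) \<le> norm y * (norm x * norm (blinfun_of_bop T))"
      by (simp add: mult_ac)
  qed
  have "\<forall>x. \<exists>v. \<forall>y. cinner x (bop_apply T y) = cinner v y"
    by (intro allI riesz_representation bl) (simp add: bop_apply_scaleC cinner_scaleC_right)
  then obtain A where A: "\<And>x y. cinner x (bop_apply T y) = cinner (A x) y" by metis
  have eqI: "v = w" if "\<And>y. cinner v y = cinner w y" for v w :: 'h
  proof -
    have "cinner (v - w) (v - w) = 0" using that by (simp add: cinner_diff_left)
    then show ?thesis by (simp add: cinner_norm)
  qed
  have Aadd: "A (x + y) = A x + A y" for x y
    by (rule eqI) (simp add: A[symmetric] cinner_add_left)
  have Asc: "A (c *\<^sub>C x) = c *\<^sub>C A x" for c x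
    by (rule eqI) (simp add: A[symmetric] cinner_scaleC_left)
  have Abd: "norm (A x) \<le> norm x * norm (blinfun_of_bop T)" for x
  proof -
    have "(norm (A x))\<^sup>2 = cmod (cinner (A x) (A x))" by (simp add: cinner_norm norm_power)
    also have "\<dots> = cmod (cinner x (bop_apply T (A x)))" by (simp add: A)
    also have "\<dots> \<le> norm x * norm (bop_apply T (A x))" by (rule cauchy_schwarz)
    also have "\<dots> \<le> norm x * (norm (blinfun_of_bop T) * norm (A x))"
      by (intro mult_left_mono bop_norm_bound) simp
    finally have "norm (A x) * norm (A x) \<le> (norm x * norm (blinfun_of_bop T)) * norm (A x)"
      by (simp add: power2_eq_square mult_ac)
    then show ?thesis by (cases "A x = 0") auto
  qed
  have "bounded_linear A"
    by (rule bounded_linear_intro[OF Aadd _ Abd]) (simp add: scaleR_scaleC Asc)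
  then have "bop_apply (Abs_bop (Blinfun A)) = A" by (rule Abs_bop_apply) (rule Asc)
  then show ?thesis by (intro exI[of _ "Abs_bop (Blinfun A)"]) (simp add: A)
qed

instantiation bop :: (complex_hilbert) real_normed_algebra
begin

definition zero_bop :: "'a bop" where "zero_bop = Abs_bop 0"
definition plus_bop :: "'a bop \<Rightarrow> 'a bop \<Rightarrow> 'a bop" where
  "S + T = Abs_bop (blinfun_of_bop S + blinfun_of_bop T)"
definition minus_bop :: "'a bop \<Rightarrow> 'a bop \<Rightarrow> 'a bop" where
  "S - T = Abs_bop (blinfun_of_bop S - blinfun_of_bop T)"
definition uminus_bop :: "'a bop \<Rightarrow> 'a bop" where
  "- T = Abs_bop (- blinfun_of_bop T)"
definition times_bop :: "'a bop \<Rightarrow> 'a bop \<Rightarrow> 'a bop" where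
  "S * T = Abs_bop (blinfun_of_bop S o\<^sub>L blinfun_of_bop T)"
definition scaleR_bop :: "real \<Rightarrow> 'a bop \<Rightarrow> 'a bop" where
  "r *\<^sub>R T = Abs_bop (r *\<^sub>R blinfun_of_bop T)"
definition norm_bop :: "'a bop \<Rightarrow> real" where "norm T = norm (blinfun_of_bop T)"
definition dist_bop :: "'a bop \<Rightarrow> 'a bop \<Rightarrow> real" where "dist S T = norm (S - T :: 'a bop)"
definition sgn_bop :: "'a bop \<Rightarrow> 'a bop" where "sgn T = inverse (norm T) *\<^sub>R (T :: 'a bop)"
definition uniformity_bop :: "('a bop \<times> 'a bop) filter" where
  "uniformity_bop = (INF e\<in>{0<..}. principal {(S, T). dist S T < e})"
definition open_bop :: "'a bop set \<Rightarrow> bool" where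
  "open_bop U \<longleftrightarrow> (\<forall>S\<in>U. \<forall>\<^sub>F (S', T) in uniformity. S' = S \<longrightarrow> T \<in> U)"

lemma blinfun_of_bop_simps:
  fixes S T :: "'a bop"
  shows "blinfun_of_bop (0 :: 'a bop) = 0"
    and "blinfun_of_bop (S + T) = blinfun_of_bop S + blinfun_of_bop T"
    and "blinfun_of_bop (S - T) = blinfun_of_bop S - blinfun_of_bop T"
    and "blinfun_of_bop (- T) = - blinfun_of_bop T"
    and "blinfun_of_bop (S * T) = blinfun_of_bop S o\<^sub>L blinfun_of_bop T"
    and "blinfun_of_bop (r *\<^sub>R T) = r *\<^sub>R blinfun_of_bop T"
  using blinfun_of_bop[of S] blinfun_of_bop[of T]
  unfolding zero_bop_def plus_bop_def minus_bop_def uminus_bop_def times_bop_def scaleR_bop_def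
  by (auto intro!: Abs_bop_inverse simp: blinfun.add_left blinfun.diff_left blinfun.minus_left
      blinfun.scaleR_left complex_vector.scale_zero_right scaleC_add_right scaleR_scaleC scaleC_scaleC
      mult.commute complex_vector.scale_right_diff_distrib complex_vector.scale_minus_right)

instance
proof
  fix R S T :: "'a bop" and r s :: real and U :: "'a bop set"
  note sm = blinfun_of_bop_inject[symmetric] blinfun_of_bop_simps
  show "R + S + T = R + (S + T)" "R + S = S + R" "0 + R = R" "- R + R = 0" "R - S = R + - S"
    by (simp_all add: sm)
  show "r *\<^sub>R (S + T) = r *\<^sub>R S + r *\<^sub>R T" "(r + s) *\<^sub>R T = r *\<^sub>R T + s *\<^sub>R T"
    "r *\<^sub>R s *\<^sub>R T = (r * s) *\<^sub>R T" "1 *\<^sub>R T = T"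
    by (simp_all add: sm algebra_simps)
  show "R * S * T = R * (S * T)" "(R + S) * T = R * T + S * T" "R * (S + T) = R * S + R * T"
    "r *\<^sub>R S * T = r *\<^sub>R (S * T)" "S * r *\<^sub>R T = r *\<^sub>R (S * T)"
    unfolding sm by (rule blinfun_eqI, simp add: blinfun.bilinear_simps)+
  show "dist S T = norm (S - T)" by (rule dist_bop_def)
  show "sgn T = inverse (norm T) *\<^sub>R T" by (rule sgn_bop_def)
  show "uniformity = (INF e\<in>{0<..}. principal {(S, T::'a bop). dist S T < e})"
    by (rule uniformity_bop_def)
  show "open U \<longleftrightarrow> (\<forall>S\<in>U. \<forall>\<^sub>F (S', T) in uniformity. S' = S \<longrightarrow> T \<in> U)"
    by (rule open_bop_def)
  show "norm T = 0 \<longleftrightarrow> T = 0" by (simp add: norm_bop_def sm)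
  show "norm (S + T) \<le> norm S + norm T"
    unfolding norm_bop_def blinfun_of_bop_simps by (rule norm_triangle_ineq)
  show "norm (r *\<^sub>R T) = \<bar>r\<bar> * norm T" by (simp add: norm_bop_def sm)
  show "norm (S * T) \<le> norm S * norm T"
    unfolding norm_bop_def blinfun_of_bop_simps by (rule norm_blinfun_compose)
qed

end

instance bop :: (complex_hilbert) banach
proof
  fix s :: "nat \<Rightarrow> 'a bop"
  assume "Cauchy s"
  then have "Cauchy (\<lambda>n. blinfun_of_bop (s n))"
    by (simp add: Cauchy_iff norm_bop_def blinfun_of_bop_simps)
  then obtain L where L: "(\<lambda>n. blinfun_of_bop (s n)) \<longlonglongrightarrow> L"
    using Cauchy_convergent convergent_def by blast
  have "blinfun_apply L (c *\<^sub>C x) = c *\<^sub>C blinfun_apply L x" for c x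
  proof (rule LIMSEQ_unique)
    have ap: "(\<lambda>n. blinfun_apply (blinfun_of_bop (s n)) y) \<longlonglongrightarrow> blinfun_apply L y" for y
      by (rule bounded_linear.tendsto[OF blinfun.bounded_linear_left L])
    show "(\<lambda>n. blinfun_apply (blinfun_of_bop (s n)) (c *\<^sub>C x)) \<longlonglongrightarrow> blinfun_apply L (c *\<^sub>C x)"
      by (rule ap)
    have "bounded_linear (\<lambda>x::'a. c *\<^sub>C x)"
      by (rule bounded_linear_scaleC)
    from bounded_linear.tendsto[OF this ap[of x]]
    show "(\<lambda>n. blinfun_apply (blinfun_of_bop (s n)) (c *\<^sub>C x)) \<longlonglongrightarrow> c *\<^sub>C blinfun_apply L x"
      by (simp add: bop_apply_scaleC[unfolded bop_apply_def])
  qed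
  then have "blinfun_of_bop (Abs_bop L) = L" by (simp add: Abs_bop_inverse)
  then have "s \<longlonglongrightarrow> Abs_bop L"
    using L by (simp add: LIMSEQ_iff norm_bop_def blinfun_of_bop_simps)
  then show "convergent s" by (rule convergentI)
qed

instantiation bop :: (complex_hilbert) cstar_algebra
begin

definition scaleC_bop :: "complex \<Rightarrow> 'a bop \<Rightarrow> 'a bop" where
  "c *\<^sub>C T = Abs_bop (Blinfun (\<lambda>x. c *\<^sub>C bop_apply T x))"
definition star_bop :: "'a bop \<Rightarrow> 'a bop" where
  "star T = (THE S. \<forall>x y. cinner (bop_apply S x) y = cinner x (bop_apply T y))"

lemma bop_apply_simps:
  fixes S T :: "'a bop"
  shows "bop_apply (0 :: 'a bop) x = 0"
    and "bop_apply (S + T) x = bop_apply S x + bop_apply T x"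
    and "bop_apply (r *\<^sub>R T) x = r *\<^sub>R bop_apply T x"
    and "bop_apply (S * T) x = bop_apply S (bop_apply T x)"
    and "bop_apply (c *\<^sub>C T) x = c *\<^sub>C bop_apply T x"
proof -
  have "bounded_linear (\<lambda>x. c *\<^sub>C bop_apply T x)"
    unfolding bop_apply_def
    by (rule bounded_linear_compose[OF bounded_linear_scaleC blinfun.bounded_linear_right])
  then show "bop_apply (c *\<^sub>C T) x = c *\<^sub>C bop_apply T x"
    unfolding scaleC_bop_def
    by (subst Abs_bop_apply) (simp_all add: bop_apply_scaleC scaleC_scaleC mult.commute)
qed (simp_all add: bop_apply_def blinfun_of_bop_simps blinfun.bilinear_simps)

lemma bop_adjoint: "cinner (bop_apply (star T) x) y = cinner x (bop_apply T y)" for T :: "'a bop"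
proof -
  obtain S where S: "\<forall>x y. cinner (bop_apply S x) y = cinner x (bop_apply T y)"
    using ex_adjoint by blast
  have "\<forall>x y. cinner (bop_apply (star T) x) y = cinner x (bop_apply T y)"
    unfolding star_bop_def
  proof (rule theI[of _ S])
    fix R assume R: "\<forall>x y. cinner (bop_apply R x) y = cinner x (bop_apply T y)"
    show "R = S"
    proof (rule bop_eqI)
      fix x
      let ?d = "bop_apply R x - bop_apply S x"
      have "cinner ?d ?d = 0" unfolding cinner_diff_left[of _ _ ?d] by (simp add: R S)
      then show "bop_apply R x = bop_apply S x" by (simp add: cinner_norm)
    qed
  qed (rule S)
  then show ?thesis by blast
qed

lemma bop_adjoint': "cinner x (bop_apply (star T) y) = cinner (bop_apply T x) y" for T :: "'a bop"
  by (metis bop_adjoint cinner_commute)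

lemma bop_cinner_eqI:
  assumes "\<And>x y. cinner x (bop_apply S y) = cinner x (bop_apply T y)"
  shows "S = (T :: 'a bop)"
proof (rule bop_eqI)
  fix x
  let ?d = "bop_apply S x - bop_apply T x"
  have "cinner ?d ?d = 0" unfolding cinner_diff_right[of ?d] by (simp add: assms)
  then show "bop_apply S x = bop_apply T x" by (simp add: cinner_norm)
qed

lemma bop_star_star: "star (star T) = T" for T :: "'a bop"
  by (rule bop_cinner_eqI) (simp add: bop_adjoint bop_adjoint')

lemma bop_star_norm: "(norm T)\<^sup>2 \<le> norm (star T * T)" for T :: "'a bop"
proof -
  have *: "norm (bop_apply T x) \<le> sqrt (norm (star T * T)) * norm x" for x
  proof -
    have "(norm (bop_apply T x))\<^sup>2 = cmod (cinner (bop_apply T x) (bop_apply T x))"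
      by (simp add: cinner_norm norm_power)
    also have "\<dots> = cmod (cinner x (bop_apply (star T * T) x))"
      by (simp add: bop_apply_simps bop_adjoint')
    also have "\<dots> \<le> norm x * norm (bop_apply (star T * T) x)" by (rule cauchy_schwarz)
    also have "\<dots> \<le> norm x * (norm (star T * T) * norm x)"
      unfolding norm_bop_def by (intro mult_left_mono bop_norm_bound) simp
    also have "\<dots> = (sqrt (norm (star T * T)) * norm x)\<^sup>2"
      by (simp add: power_mult_distrib power2_eq_square)
    finally show ?thesis by (rule power2_le_imp_le) simp
  qed
  have "norm T \<le> sqrt (norm (star T * T))"
    unfolding norm_bop_def[of T]
    by (rule norm_blinfun_bound) (use * in \<open>simp_all add: bop_apply_def\<close>)
  then have "(norm T)\<^sup>2 \<le> (sqrt (norm (star T * T)))\<^sup>2" by (intro power_mono) simp_all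
  then show ?thesis by simp
qed

lemma bop_norm_le_star: "norm T \<le> norm (star T)" for T :: "'a bop"
proof (cases "T = 0")
  case False
  then have "norm T > 0" by simp
  moreover have "norm T * norm T \<le> norm (star T) * norm T"
    using bop_star_norm[of T] norm_mult_ineq[of "star T" T] by (simp add: power2_eq_square)
  ultimately show ?thesis by simp
qed simp

instance
proof
  fix S T :: "'a bop" and c d :: complex and r :: real
  note ext = bop_eqI and sm = bop_apply_simps
  show "c *\<^sub>C (S + T) = c *\<^sub>C S + c *\<^sub>C T" "(c + d) *\<^sub>C T = c *\<^sub>C T + d *\<^sub>C T"
    "c *\<^sub>C d *\<^sub>C T = (c * d) *\<^sub>C T" "1 *\<^sub>C T = T"
    by (rule ext, simp add: sm scaleC_add_right scaleC_add_left scaleC_scaleC scaleC_one)+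
  show "r *\<^sub>R T = complex_of_real r *\<^sub>C T" by (rule ext) (simp add: sm scaleR_scaleC)
  show "(c *\<^sub>C S) * T = c *\<^sub>C (S * T)" "S * (c *\<^sub>C T) = c *\<^sub>C (S * T)"
    by (rule ext, simp add: sm bop_apply_scaleC)+
  have le: "norm (c *\<^sub>C T) \<le> cmod c * norm T" for c and T :: "'a bop"
    unfolding norm_bop_def[of "c *\<^sub>C T"]
  proof (rule norm_blinfun_bound)
    fix x
    have "norm (bop_apply T x) \<le> norm T * norm x" unfolding norm_bop_def by (rule bop_norm_bound)
    then have "cmod c * norm (bop_apply T x) \<le> cmod c * (norm T * norm x)"
      by (intro mult_left_mono) simp_all
    then show "norm (blinfun_apply (blinfun_of_bop (c *\<^sub>C T)) x) \<le> cmod c * norm T * norm x"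
      by (simp add: bop_apply_def[symmetric] sm norm_scaleC_hilbert mult.assoc)
  qed simp
  show "norm (c *\<^sub>C T) = cmod c * norm T"
  proof (cases "c = 0")
    case True
    then show ?thesis using le[of 0 T] by simp
  next
    case False
    have "inverse c *\<^sub>C c *\<^sub>C T = T"
      using False by (intro ext) (simp add: sm scaleC_scaleC scaleC_one)
    then have "norm T \<le> inverse (cmod c) * norm (c *\<^sub>C T)"
      using le[of "inverse c" "c *\<^sub>C T"] by (simp add: norm_inverse)
    then have "cmod c * norm T \<le> norm (c *\<^sub>C T)" using False by (simp add: field_simps)
    then show ?thesis using le[of c T] by simp
  qed
  show "star (star T) = T" by (rule bop_star_star)
  show "star (S + T) = star S + star T" "star (c *\<^sub>C T) = cnj c *\<^sub>C star T"
    "star (S * T) = star T * star S"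
    by (rule bop_cinner_eqI, simp add: bop_adjoint' sm cinner_add_left cinner_add_right
        cinner_scaleC_left cinner_scaleC_right)+
  have "norm (star T) = norm T"
    using bop_norm_le_star[of T] bop_norm_le_star[of "star T"] bop_star_star[of T] by simp
  then show "norm (star T * T) = (norm T)\<^sup>2"
    using bop_star_norm[of T] norm_mult_ineq[of "star T" T] by (simp add: power2_eq_square)
qed

end

text \<open>The strong operator topology.\<close>

definition sot :: "'h::complex_hilbert bop topology" where
  "sot = pullback_topology UNIV bop_apply euclidean"


section \<open>Hilbert modules and correspondences\<close>

text \<open>
  The underlying vector space of a module is a linear subspace, the carrier, of an ambient complex
  vector space, so that a family of modules of different sizes lives on a single type. (Any
  family of vector spaces arises in this way inside its direct sum.)
  The operations are only meaningful on the carrier.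
\<close>

record ('a, 'x) corr =
  carrier :: "'x set"
  ract :: "'x \<Rightarrow> 'a \<Rightarrow> 'x"
  lact :: "'a \<Rightarrow> 'x \<Rightarrow> 'x"
  inn :: "'x \<Rightarrow> 'x \<Rightarrow> 'a"

definition mnorm :: "('a::cstar_algebra, 'x) corr \<Rightarrow> 'x \<Rightarrow> real" where
  "mnorm X x = sqrt (norm (inn X x x))"

definition mclosure :: "('a::cstar_algebra, 'x::complex_vector) corr \<Rightarrow> 'x set \<Rightarrow> 'x set" where
  "mclosure X S = {x \<in> carrier X. \<forall>e>0. \<exists>s\<in>S. mnorm X (x - s) < e}"

locale hilbert_module =
  fixes X :: "('a::cstar_algebra, 'x::complex_vector) corr"
  assumes subspace: "csubspace (carrier X)"
    and ract_closed: "x \<in> carrier X \<Longrightarrow> ract X x a \<in> carrier X"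
    and ract_add_left: "\<lbrakk>x \<in> carrier X; y \<in> carrier X\<rbrakk> \<Longrightarrow> ract X (x + y) a = ract X x a + ract X y a"
    and ract_add_right: "x \<in> carrier X \<Longrightarrow> ract X x (a + b) = ract X x a + ract X x b"
    and ract_scaleC_left: "x \<in> carrier X \<Longrightarrow> ract X (c *\<^sub>C x) a = c *\<^sub>C ract X x a"
    and ract_scaleC_right: "x \<in> carrier X \<Longrightarrow> ract X x (c *\<^sub>C a) = c *\<^sub>C ract X x a"
    and ract_mult: "x \<in> carrier X \<Longrightarrow> ract X x (a * b) = ract X (ract X x a) b"
    and inn_add_right: "\<lbrakk>x \<in> carrier X; y \<in> carrier X; z \<in> carrier X\<rbrakk>
          \<Longrightarrow> inn X x (y + z) = inn X x y + inn X x z"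
    and inn_scaleC_right: "\<lbrakk>x \<in> carrier X; y \<in> carrier X\<rbrakk> \<Longrightarrow> inn X x (c *\<^sub>C y) = c *\<^sub>C inn X x y"
    and inn_ract_right: "\<lbrakk>x \<in> carrier X; y \<in> carrier X\<rbrakk> \<Longrightarrow> inn X x (ract X y a) = inn X x y * a"
    and inn_star: "\<lbrakk>x \<in> carrier X; y \<in> carrier X\<rbrakk> \<Longrightarrow> star (inn X x y) = inn X y x"
    and inn_pos: "x \<in> carrier X \<Longrightarrow> cstar_pos (inn X x x)"
    and inn_definite: "\<lbrakk>x \<in> carrier X; inn X x x = 0\<rbrakk> \<Longrightarrow> x = 0"
    and complete: "\<lbrakk>\<And>n. s n \<in> carrier X;
            \<And>e. e > 0 \<Longrightarrow> \<exists>N. \<forall>m\<ge>N. \<forall>n\<ge>N. mnorm X (s m - s n) < e\<rbrakk>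
          \<Longrightarrow> \<exists>l\<in>carrier X. (\<lambda>n. mnorm X (s n - l)) \<longlonglongrightarrow> 0"

text \<open>
  The assumptions on the left action say that \<open>lact X\<close> is a non-degenerate
  *-homomorphism into the adjointable operators.
\<close>

locale correspondence = hilbert_module +
  assumes lact_closed: "x \<in> carrier X \<Longrightarrow> lact X a x \<in> carrier X"
    and lact_add: "x \<in> carrier X \<Longrightarrow> lact X (a + b) x = lact X a x + lact X b x"
    and lact_scaleC: "x \<in> carrier X \<Longrightarrow> lact X (c *\<^sub>C a) x = c *\<^sub>C lact X a x"
    and lact_mult: "x \<in> carrier X \<Longrightarrow> lact X (a * b) x = lact X a (lact X b x)"
    and lact_star: "\<lbrakk>x \<in> carrier X; y \<in> carrier X\<rbrakk>
          \<Longrightarrow> inn X (lact X a x) y = inn X x (lact X (star a) y)"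
    and lact_nondegenerate: "mclosure X (cspan {lact X a x | a x. x \<in> carrier X}) = carrier X"


section \<open>Adjointable and compact operators\<close>

text \<open>
  Operators on a module are functions vanishing outside the carrier, so that equal operators are
  equal functions. Adjointable maps are automatically bounded and module linear.
\<close>

definition adjoint_pair :: "('a::cstar_algebra, 'x) corr \<Rightarrow> ('x \<Rightarrow> 'x) \<Rightarrow> ('x \<Rightarrow> 'x) \<Rightarrow> bool" where
  "adjoint_pair X T T' \<longleftrightarrow> (\<forall>x\<in>carrier X. \<forall>y\<in>carrier X. inn X (T x) y = inn X x (T' y))"

definition module_maps :: "('a::cstar_algebra, 'x::complex_vector) corr \<Rightarrow> ('x \<Rightarrow> 'x) set" where
  "module_maps X = {T. (\<forall>x\<in>carrier X. T x \<in> carrier X) \<and> (\<forall>x. x \<notin> carrier X \<longrightarrow> T x = 0)}"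

definition adjointable :: "('a::cstar_algebra, 'x::complex_vector) corr \<Rightarrow> ('x \<Rightarrow> 'x) set" where
  "adjointable X = {T \<in> module_maps X. \<exists>T'\<in>module_maps X. adjoint_pair X T T'}"

definition id_op :: "('a::cstar_algebra, 'x::complex_vector) corr \<Rightarrow> 'x \<Rightarrow> 'x" where
  "id_op X = (\<lambda>x. if x \<in> carrier X then x else 0)"

text \<open>\<open>op_le X T c\<close> says that the operator norm of \<open>T\<close> is at most \<open>c\<close>.\<close>

definition op_le :: "('a::cstar_algebra, 'x) corr \<Rightarrow> ('x \<Rightarrow> 'x) \<Rightarrow> real \<Rightarrow> bool" where
  "op_le X T c \<longleftrightarrow> 0 \<le> c \<and> (\<forall>x\<in>carrier X. mnorm X (T x) \<le> c * mnorm X x)"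

definition theta :: "('a::cstar_algebra, 'x::complex_vector) corr \<Rightarrow> 'x \<Rightarrow> 'x \<Rightarrow> 'x \<Rightarrow> 'x" where
  "theta X x y = (\<lambda>z. if z \<in> carrier X then ract X x (inn X y z) else 0)"

text \<open>The linear span of the \<open>theta X x y\<close>; scalars are absorbed by \<open>x\<close>.\<close>

definition finite_rank :: "('a::cstar_algebra, 'x::complex_vector) corr \<Rightarrow> ('x \<Rightarrow> 'x) set" where
  "finite_rank X = {\<lambda>z. \<Sum>i<n. theta X (u i) (v i) z | (n::nat) u v.
     \<forall>i<n. u i \<in> carrier X \<and> v i \<in> carrier X}"

definition compacts :: "('a::cstar_algebra, 'x::complex_vector) corr \<Rightarrow> ('x \<Rightarrow> 'x) set" where
  "compacts X = {T \<in> adjointable X. \<forall>e>0. \<exists>F\<in>finite_rank X. op_le X (\<lambda>z. T z - F z) e}"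

text \<open>
  The strict topology on the adjointable operators, regarded as the multiplier algebra of the
  compact ones: it is given by the seminorms \<open>\<parallel>T K\<parallel>\<close> and \<open>\<parallel>K T\<parallel>\<close> for compact \<open>K\<close>.
\<close>

definition strict_topology :: "('a::cstar_algebra, 'x::complex_vector) corr \<Rightarrow> ('x \<Rightarrow> 'x) topology" where
  "strict_topology X = topology_generated_by
     ({{T \<in> adjointable X. \<exists>c<e. op_le X (\<lambda>z. T (K z) - T0 (K z)) c} | T0 K e.
         T0 \<in> adjointable X \<and> K \<in> compacts X \<and> e > 0} \<union>
      {{T \<in> adjointable X. \<exists>c<e. op_le X (\<lambda>z. K (T z) - K (T0 z)) c} | T0 K e.
         T0 \<in> adjointable X \<and> K \<in> compacts X \<and> e > 0})"


section \<open>Interior tensor products and product systems\<close>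

text \<open>
  \<open>Z\<close> together with \<open>(x, y) \<mapsto> m x y\<close> is the interior tensor product of \<open>X\<close> and \<open>Y\<close>: the map
  \<open>x \<otimes> y \<mapsto> m x y\<close> on the balanced algebraic tensor product preserves the inner product and
  the bimodule structure, and it has dense range in the complete module \<open>Z\<close>. Equivalently, it
  extends to a unitary bimodule isomorphism from the completion of the algebraic tensor product
  onto \<open>Z\<close>.
\<close>

locale interior_tensor = X: correspondence X + Y: correspondence Y + Z: correspondence Z
  for X Y Z :: "('a::cstar_algebra, 'x::complex_vector) corr" +
  fixes m :: "'x \<Rightarrow> 'x \<Rightarrow> 'x"
  assumes closed: "\<lbrakk>x \<in> carrier X; y \<in> carrier Y\<rbrakk> \<Longrightarrow> m x y \<in> carrier Z"
    and add_left: "\<lbrakk>x \<in> carrier X; x' \<in> carrier X; y \<in> carrier Y\<rbrakk> \<Longrightarrow> m (x + x') y = m x y + m x' y"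
    and add_right: "\<lbrakk>x \<in> carrier X; y \<in> carrier Y; y' \<in> carrier Y\<rbrakk> \<Longrightarrow> m x (y + y') = m x y + m x y'"
    and scaleC_left: "\<lbrakk>x \<in> carrier X; y \<in> carrier Y\<rbrakk> \<Longrightarrow> m (c *\<^sub>C x) y = c *\<^sub>C m x y"
    and scaleC_right: "\<lbrakk>x \<in> carrier X; y \<in> carrier Y\<rbrakk> \<Longrightarrow> m x (c *\<^sub>C y) = c *\<^sub>C m x y"
    and balanced: "\<lbrakk>x \<in> carrier X; y \<in> carrier Y\<rbrakk> \<Longrightarrow> m (ract X x a) y = m x (lact Y a y)"
    and inner: "\<lbrakk>x \<in> carrier X; y \<in> carrier Y; x' \<in> carrier X; y' \<in> carrier Y\<rbrakk>
          \<Longrightarrow> inn Z (m x y) (m x' y') = inn Y y (lact Y (inn X x x') y')"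
    and right_action: "\<lbrakk>x \<in> carrier X; y \<in> carrier Y\<rbrakk> \<Longrightarrow> ract Z (m x y) a = m x (ract Y y a)"
    and left_action: "\<lbrakk>x \<in> carrier X; y \<in> carrier Y\<rbrakk> \<Longrightarrow> lact Z a (m x y) = m (lact X a x) y"
    and dense: "mclosure Z (cspan {m x y | x y. x \<in> carrier X \<and> y \<in> carrier Y}) = carrier Z"

text \<open>
  The group is written additively and is given with its order, which determines and is determined by
  the positive cone \<open>P = {p. 0 \<le> p}\<close> via \<open>s \<le> t \<longleftrightarrow> t - s \<in> P\<close>; the least upper bound
  is \<open>sup\<close>. Fibres over elements outside \<open>P\<close> are irrelevant. The map \<open>coeff X\<close> identifies the
  coefficient algebra with the fibre over the neutral element.
\<close>

record ('g, 'a, 'x) psys =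
  fibre :: "'g \<Rightarrow> ('a, 'x) corr"
  mult :: "'g \<Rightarrow> 'g \<Rightarrow> 'x \<Rightarrow> 'x \<Rightarrow> 'x"
  coeff :: "'a \<Rightarrow> 'x"

locale product_system =
  fixes X :: "('g::semilattice_sup_ab_group_add, 'a::cstar_algebra, 'x::complex_vector) psys"
  assumes correspondence_fibre: "0 \<le> p \<Longrightarrow> correspondence (fibre X p)"
    and coeff_bij: "bij_betw (coeff X) UNIV (carrier (fibre X 0))"
    and coeff_linear: "Vector_Spaces.linear scaleC scaleC (coeff X)"
    and coeff_ract: "ract (fibre X 0) (coeff X a) b = coeff X (a * b)"
    and coeff_lact: "lact (fibre X 0) a (coeff X b) = coeff X (a * b)"
    and coeff_inn: "inn (fibre X 0) (coeff X a) (coeff X b) = star a * b"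
    and interior_tensor_mult: "\<lbrakk>0 \<le> p; 0 \<le> q\<rbrakk>
          \<Longrightarrow> interior_tensor (fibre X p) (fibre X q) (fibre X (p + q)) (mult X p q)"
    and mult_coeff_left: "\<lbrakk>0 \<le> p; x \<in> carrier (fibre X p)\<rbrakk>
          \<Longrightarrow> mult X 0 p (coeff X a) x = lact (fibre X p) a x"
    and mult_coeff_right: "\<lbrakk>0 \<le> p; x \<in> carrier (fibre X p)\<rbrakk>
          \<Longrightarrow> mult X p 0 x (coeff X a) = ract (fibre X p) x a"
    and mult_assoc: "\<lbrakk>0 \<le> p; 0 \<le> q; 0 \<le> r; x \<in> carrier (fibre X p); y \<in> carrier (fibre X q);
            z \<in> carrier (fibre X r)\<rbrakk>
          \<Longrightarrow> mult X (p + q) r (mult X p q x y) z = mult X p (q + r) x (mult X q r y z)"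

text \<open>\<open>amplify X p r S\<close> is the operator \<open>S \<otimes> I\<close> on the fibre over \<open>r \<ge> p\<close>, for \<open>S\<close> on the fibre over \<open>p\<close>.\<close>

definition amplify ::
    "('g::semilattice_sup_ab_group_add, 'a::cstar_algebra, 'x::complex_vector) psys
      \<Rightarrow> 'g \<Rightarrow> 'g \<Rightarrow> ('x \<Rightarrow> 'x) \<Rightarrow> 'x \<Rightarrow> 'x" where
  "amplify X p r S = (THE R. R \<in> adjointable (fibre X r) \<and>
     (\<forall>x\<in>carrier (fibre X p). \<forall>y\<in>carrier (fibre X (r - p)).
        R (mult X p (r - p) x y) = mult X p (r - p) (S x) y))"

definition compactly_aligned ::
    "('g::semilattice_sup_ab_group_add, 'a::cstar_algebra, 'x::complex_vector) psys \<Rightarrow> bool" where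
  "compactly_aligned X \<longleftrightarrow> (\<forall>p q S T. 0 \<le> p \<longrightarrow> 0 \<le> q \<longrightarrow>
     S \<in> compacts (fibre X p) \<longrightarrow> T \<in> compacts (fibre X q) \<longrightarrow>
     amplify X p (sup p q) S \<circ> amplify X q (sup p q) T \<in> compacts (fibre X (sup p q)))"


section \<open>Representations\<close>

definition isometric_representation ::
    "('g::semilattice_sup_ab_group_add, 'a::cstar_algebra, 'x::complex_vector) psys
      \<Rightarrow> ('g \<Rightarrow> 'x \<Rightarrow> 'b::cstar_algebra) \<Rightarrow> bool" where
  "isometric_representation X \<psi> \<longleftrightarrow>
     (\<forall>p x y c. 0 \<le> p \<longrightarrow> x \<in> carrier (fibre X p) \<longrightarrow> y \<in> carrier (fibre X p) \<longrightarrow>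
        \<psi> p (x + y) = \<psi> p x + \<psi> p y \<and> \<psi> p (c *\<^sub>C x) = c *\<^sub>C \<psi> p x) \<and>
     (\<forall>a b. \<psi> 0 (coeff X (a * b)) = \<psi> 0 (coeff X a) * \<psi> 0 (coeff X b)) \<and>
     (\<forall>a. \<psi> 0 (coeff X (star a)) = star (\<psi> 0 (coeff X a))) \<and>
     (\<forall>p q x y. 0 \<le> p \<longrightarrow> 0 \<le> q \<longrightarrow> x \<in> carrier (fibre X p) \<longrightarrow> y \<in> carrier (fibre X q) \<longrightarrow>
        \<psi> p x * \<psi> q y = \<psi> (p + q) (mult X p q x y)) \<and>
     (\<forall>p x y. 0 \<le> p \<longrightarrow> x \<in> carrier (fibre X p) \<longrightarrow> y \<in> carrier (fibre X p) \<longrightarrow>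
        star (\<psi> p x) * \<psi> p y = \<psi> 0 (coeff X (inn (fibre X p) x y)))"

definition faithful_representation ::
    "('g::semilattice_sup_ab_group_add, 'a::cstar_algebra, 'x::complex_vector) psys
      \<Rightarrow> ('g \<Rightarrow> 'x \<Rightarrow> 'b::cstar_algebra) \<Rightarrow> bool" where
  "faithful_representation X \<psi> \<longleftrightarrow> inj_on (\<psi> 0) (carrier (fibre X 0))"

text \<open>
  \<open>induced_on_compacts X f \<Phi>\<close> says that \<open>\<Phi>\<close> is the *-homomorphism on the compact operators
  with \<open>\<Phi> (theta X x y) = f x * star (f y)\<close>. The boundedness clause is automatic for
  *-homomorphisms of C*-algebras.
\<close>

definition induced_on_compacts ::
    "('a::cstar_algebra, 'x::complex_vector) corr \<Rightarrow> ('x \<Rightarrow> 'b::cstar_algebra)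
      \<Rightarrow> (('x \<Rightarrow> 'x) \<Rightarrow> 'b) \<Rightarrow> bool" where
  "induced_on_compacts X f \<Phi> \<longleftrightarrow>
     (\<forall>x\<in>carrier X. \<forall>y\<in>carrier X. \<Phi> (theta X x y) = f x * star (f y)) \<and>
     (\<forall>S\<in>compacts X. \<forall>T\<in>compacts X. \<Phi> (\<lambda>z. S z + T z) = \<Phi> S + \<Phi> T) \<and>
     (\<forall>S\<in>compacts X. \<forall>c. \<Phi> (\<lambda>z. c *\<^sub>C S z) = c *\<^sub>C \<Phi> S) \<and>
     (\<forall>S\<in>compacts X. \<forall>T\<in>compacts X. \<Phi> (S \<circ> T) = \<Phi> S * \<Phi> T) \<and>
     (\<forall>S\<in>compacts X. \<forall>T\<in>compacts X. adjoint_pair X S T \<longrightarrow> \<Phi> T = star (\<Phi> S)) \<and>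
     (\<exists>C\<ge>0. \<forall>S\<in>compacts X. \<forall>c. op_le X S c \<longrightarrow> norm (\<Phi> S) \<le> C * c)"

definition induced ::
    "('a::cstar_algebra, 'x::complex_vector) corr \<Rightarrow> ('x \<Rightarrow> 'b::cstar_algebra)
      \<Rightarrow> ('x \<Rightarrow> 'x) \<Rightarrow> 'b" where
  "induced X f S = (THE b. \<exists>\<Phi>. induced_on_compacts X f \<Phi> \<and> \<Phi> S = b)"

definition nica_covariant ::
    "('g::semilattice_sup_ab_group_add, 'a::cstar_algebra, 'x::complex_vector) psys
      \<Rightarrow> ('g \<Rightarrow> 'x \<Rightarrow> 'b::cstar_algebra) \<Rightarrow> bool" where
  "nica_covariant X \<psi> \<longleftrightarrow> (\<forall>p q S T. 0 \<le> p \<longrightarrow> 0 \<le> q \<longrightarrow>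
     S \<in> compacts (fibre X p) \<longrightarrow> T \<in> compacts (fibre X q) \<longrightarrow>
     induced (fibre X p) (\<psi> p) S * induced (fibre X q) (\<psi> q) T =
     induced (fibre X (sup p q)) (\<psi> (sup p q))
       (amplify X p (sup p q) S \<circ> amplify X q (sup p q) T))"

text \<open>
  The strict-to-strong continuous extension of \<open>induced X f\<close> to all adjointable operators; it
  is unique since the compact operators are strictly dense.
\<close>

definition strict_extension ::
    "('a::cstar_algebra, 'x::complex_vector) corr \<Rightarrow> ('x \<Rightarrow> 'h::complex_hilbert bop)
      \<Rightarrow> ('x \<Rightarrow> 'x) \<Rightarrow> 'h bop" where
  "strict_extension X f T = (THE b. \<exists>\<rho>. (\<forall>S\<in>compacts X. \<rho> S = induced X f S) \<and>
     continuous_map (strict_topology X) sot \<rho> \<and> \<rho> T = b)"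

definition nondegenerate_representation ::
    "('g::semilattice_sup_ab_group_add, 'a::cstar_algebra, 'x::complex_vector) psys
      \<Rightarrow> ('g \<Rightarrow> 'x \<Rightarrow> 'h::complex_hilbert bop) \<Rightarrow> bool" where
  "nondegenerate_representation X \<psi> \<longleftrightarrow>
     closure (cspan {bop_apply (\<psi> 0 x) h | x h. x \<in> carrier (fibre X 0)}) = UNIV"

definition nica_covariant_on_space ::
    "('g::semilattice_sup_ab_group_add, 'a::cstar_algebra, 'x::complex_vector) psys
      \<Rightarrow> ('g \<Rightarrow> 'x \<Rightarrow> 'h::complex_hilbert bop) \<Rightarrow> bool" where
  "nica_covariant_on_space X \<psi> \<longleftrightarrow> nondegenerate_representation X \<psi> \<and>
     (\<forall>p q. 0 \<le> p \<longrightarrow> 0 \<le> q \<longrightarrow>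
        strict_extension (fibre X p) (\<psi> p) (id_op (fibre X p)) *
        strict_extension (fibre X q) (\<psi> q) (id_op (fibre X q)) =
        strict_extension (fibre X (sup p q)) (\<psi> (sup p q)) (id_op (fibre X (sup p q))))"

end

theory Submission
  imports Defs
begin

text \<open>
  Given an isometric representation, a compact operator \<open>S\<close> on a fibre is represented by the unique
  element \<open>b\<close> of the closed span of the \<open>\<psi> u (\<psi> v)\<^sup>*\<close> with \<open>b (\<psi> z) = \<psi> (S z)\<close>. For \<open>S\<close> and \<open>T\<close> compact on the
  fibres over \<open>p\<close> and \<open>q\<close> with images \<open>b\<close> and \<open>c\<close>, the product \<open>b c\<close> acts on the fibre over \<open>r = p \<squnion> q\<close> as
  \<open>(S \<otimes> I) (T \<otimes> I)\<close>. The hypothesis on \<open>\<psi> x\<^sup>* \<psi> y\<close> places \<open>b c\<close> in the closed span of the \<open>\<psi> u (\<psi> v)\<^sup>*\<close> over \<open>r\<close>,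
  and for faithful \<open>\<psi>\<close> every element of that span is the image of a compact operator. Conversely,
  \<open>x\<close> and \<open>y\<close> are limits of \<open>K x\<close> and \<open>L y\<close> for finite rank \<open>K\<close> and \<open>L\<close>, and by Nica covariance
  \<open>\<psi> (K x)\<^sup>* \<psi> (L y)\<close> is \<open>\<psi> x\<^sup>*\<close> times the image of a compact operator over \<open>r\<close> times \<open>\<psi> y\<close>.

  Positivity of \<open>a\<^sup>* a\<close>, the Cauchy-Schwarz inequality and the isometry of injective *-homomorphisms are
  obtained from the square root of \<open>1 - a\<close> for \<open>\<parallel>a\<parallel> \<le> 1\<close>, without spectral theory.
\<close>

section \<open>Positivity in C*-algebras\<close>

text \<open>Two norm estimates carry the analysis: \<parallel>S \<otimes> I\<parallel> \<le>
  \<parallel>S\<parallel>, and the bound of a sum of products \<open>f u * star (f v)\<close> by the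
  norm of the matching sum of operators \<open>theta X u v\<close>. The usual arguments use positive
  matrices over the coefficient algebra and the C*-algebra of compact operators. Here the compact
  operators are only a set of functions, not an instance of the algebra class, so contractivity of
  homomorphisms says nothing about them. One device yields both estimates: powers of a self-adjoint
  operator applied to the left factors keep the number of terms, the triangle inequality bounds
  their growth, and 2^k-th roots remove the constant. A second concern is well-definedness:
  \<open>amplify\<close> and \<open>induced\<close> are definite descriptions, so existence and
  uniqueness must be proved before either has any property; existence rests on the two estimates.
  Faithfulness enters through isometry: the image of a fibre is then complete, so an element that
  maps it into its closure comes from an operator.\<close>

lemma star_scaleR: "star (r *\<^sub>R a) = r *\<^sub>R star (a :: 'a::cstar_algebra)"
  by (simp add: scaleR_scaleC star_scaleC)

lemma star_zero [simp]: "star (0 :: 'a::cstar_algebra) = 0"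
  using star_scaleR[of 0 "0::'a"] by simp

lemma star_minus: "star (- a) = - star (a :: 'a::cstar_algebra)"
  using star_scaleR[of "-1" a] by simp

lemma star_diff: "star (a - b) = star a - star (b :: 'a::cstar_algebra)"
  using star_add[of a "- b"] by (simp add: star_minus)

lemma norm_star: "norm (star a) = norm (a :: 'a::cstar_algebra)"
proof -
  have le: "norm b \<le> norm (star b)" for b :: 'a
  proof (cases "b = 0")
    case False
    have "norm b * norm b \<le> norm (star b) * norm b"
      using cstar_identity[of b] norm_mult_ineq[of "star b" b] by (simp add: power2_eq_square)
    then show ?thesis using False by simp
  qed simp
  from le[of a] le[of "star a"] show ?thesis by (simp add: star_star)
qed

lemma bounded_linear_star: "bounded_linear (star :: 'a::cstar_algebra \<Rightarrow> 'a)"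
  by (rule bounded_linear_intro[where K = 1]) (simp_all add: star_add star_scaleR norm_star)

lemma norm_square_selfadjoint:
  "star a = a \<Longrightarrow> norm (a * a) = (norm (a :: 'a::cstar_algebra))\<^sup>2"
  using cstar_identity[of a] by simp

lemma star_mult_self_eq_0: "star a * a = 0 \<Longrightarrow> a = (0 :: 'a::cstar_algebra)"
  using cstar_identity[of a] by simp

lemma star_mult_left_cancel:
  assumes "\<And>y. star u * y = star v * (y :: 'a::cstar_algebra)"
  shows "u = v"
proof -
  have "star (u - v) * (u - v) = 0" using assms[of "u - v"] by (simp add: star_diff left_diff_distrib)
  then show ?thesis using star_mult_self_eq_0 by force
qed

text \<open>
  The solution \<open>s = 1 - sqrt (1 - a)\<close> of the equation is found by iteration, which also covers
  the boundary case \<open>norm a = 1\<close>: the increments of the iteration are dominated by those of the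
  scalar iteration for \<open>a = 1\<close>, which is increasing and bounded.
\<close>

lemma ex_one_minus_sqrt:
  fixes a :: "'a::cstar_algebra"
  assumes "norm a \<le> 1"
  shows "\<exists>s. norm s \<le> 1 \<and> 2 *\<^sub>R s = a + s * s \<and> (star a = a \<longrightarrow> star s = s) \<and>
    (\<forall>c. a * c = c * a \<longrightarrow> s * c = c * s)"
proof -
  define r :: "nat \<Rightarrow> real" where "r = rec_nat 0 (\<lambda>_ t. (1 + t * t) / 2)"
  define s :: "nat \<Rightarrow> 'a" where "s = rec_nat 0 (\<lambda>_ t. (1/2) *\<^sub>R (a + t * t))"
  have r0: "r 0 = 0" and rS: "\<And>n. r (Suc n) = (1 + r n * r n) / 2" by (simp_all add: r_def)
  have s0: "s 0 = 0" and sS: "\<And>n. s (Suc n) = (1/2) *\<^sub>R (a + s n * s n)" by (simp_all add: s_def)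
  have r01: "0 \<le> r n \<and> r n \<le> 1" for n
  proof (induction n)
    case (Suc n)
    then have "r n * r n \<le> 1" by (simp add: mult_le_one)
    then show ?case using Suc by (simp add: rS)
  qed (simp add: r0)
  \<comment> \<open>This is \<open>(1 - r n)\<^sup>2 \<ge> 0\<close>.\<close>
  have "r n \<le> r (Suc n)" for n
    using sum_squares_bound[of "r n" 1] by (simp add: rS power2_eq_square)
  then have incr: "incseq r" by (rule incseq_SucI)
  have comm: "s n * c = c * s n" if "a * c = c * a" for n c
  proof (induction n)
    case (Suc n)
    have "s n * s n * c = c * (s n * s n)" by (metis Suc mult.assoc)
    then show ?case by (simp add: sS algebra_simps that)
  qed (simp add: s0)
  have sa: "s n * a = a * s n" for n by (rule comm) simp
  have ss: "s m * s n = s n * s m" for m n by (rule comm) (simp add: sa)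
  have star: "star (s n) = s n" if "star a = a" for n
    by (induction n) (simp_all add: s0 sS that star_scaleR star_add star_mult)
  have sr: "norm (s n) \<le> r n" for n
  proof (induction n)
    case (Suc n)
    have "norm (a + s n * s n) \<le> norm a + norm (s n) * norm (s n)"
      by (rule order_trans[OF norm_triangle_ineq]) (simp add: norm_mult_ineq)
    also have "\<dots> \<le> 1 + r n * r n" using Suc assms r01[of n] by (intro add_mono mult_mono) auto
    finally show ?case by (simp add: sS rS)
  qed (simp add: s0 r0)
  have step: "norm (s (Suc n) - s n) \<le> r (Suc n) - r n" for n
  proof (induction n)
    case 0
    then show ?case using sr[of 1] by (simp add: s0 r0)
  next
    case (Suc n)
    \<comment> \<open>The difference of squares factors because the iterates commute, so the
      increments obey the same recursion as in the scalar case.\<close>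
    have "s (Suc (Suc n)) - s (Suc n) = (1/2) *\<^sub>R (s (Suc n) * s (Suc n) - s n * s n)"
      by (simp add: sS[of "Suc n"] sS[of n] scaleR_diff_right[symmetric])
    also have "s (Suc n) * s (Suc n) - s n * s n = (s (Suc n) - s n) * (s (Suc n) + s n)"
      using ss[of n "Suc n"] by (simp add: algebra_simps)
    finally have "norm (s (Suc (Suc n)) - s (Suc n))
        \<le> (1/2) * (norm (s (Suc n) - s n) * norm (s (Suc n) + s n))"
      by (simp add: norm_mult_ineq)
    also have "\<dots> \<le> (1/2) * ((r (Suc n) - r n) * (r (Suc n) + r n))"
      using Suc norm_triangle_ineq[of "s (Suc n)" "s n"] sr[of "Suc n"] sr[of n] incseq_SucD[OF incr, of n]
      by (intro mult_left_mono mult_mono) auto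
    also have "\<dots> = r (Suc (Suc n)) - r (Suc n)"
      by (simp add: rS[of "Suc n"] rS[of n] field_simps)
    finally show ?case .
  qed
  have diff: "norm (s (n + k) - s n) \<le> r (n + k) - r n" for n k
  proof (induction k)
    case (Suc k)
    have "norm (s (n + Suc k) - s n) \<le> norm (s (Suc (n + k)) - s (n + k)) + norm (s (n + k) - s n)"
      using norm_triangle_ineq[of "s (Suc (n + k)) - s (n + k)" "s (n + k) - s n"] by simp
    then show ?case using Suc step[of "n + k"] by simp
  qed simp
  have "\<exists>l. r \<longlonglongrightarrow> l"
    using incseq_convergent[OF incr] r01 by metis
  then have "Cauchy r" using convergentI convergent_Cauchy by blast
  have "Cauchy s"
  proof (rule CauchyI')
    fix e :: real assume "0 < e"
    then obtain M where M: "\<And>m n. m \<ge> M \<Longrightarrow> n \<ge> M \<Longrightarrow> norm (r m - r n) < e"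
      using CauchyD[OF \<open>Cauchy r\<close>] by blast
    have "dist (s m) (s n) < e" if "m \<ge> M" "n > m" for m n
    proof -
      have "norm (s n - s m) \<le> r n - r m" using diff[of m "n - m"] that by simp
      moreover have "r n - r m < e" using M[of n m] that by simp
      ultimately show ?thesis by (simp add: dist_norm norm_minus_commute)
    qed
    then show "\<exists>M. \<forall>m\<ge>M. \<forall>n>m. dist (s m) (s n) < e" by blast
  qed
  then obtain l where l: "s \<longlonglongrightarrow> l" using Cauchy_convergent convergent_def by blast
  have "norm l \<le> 1"
    by (rule LIMSEQ_le_const2[OF tendsto_norm[OF l]]) (use sr r01 order_trans in blast)
  moreover have "2 *\<^sub>R l = a + l * l"
  proof -
    have "(\<lambda>n. s (Suc n)) \<longlonglongrightarrow> (1/2) *\<^sub>R (a + l * l)"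
      unfolding sS by (intro tendsto_intros l)
    then have "l = (1/2) *\<^sub>R (a + l * l)" using l LIMSEQ_Suc LIMSEQ_unique by blast
    then show ?thesis by (metis divide_self_if scaleR_one scaleR_scaleR times_divide_eq_right
          mult.right_neutral zero_neq_numeral)
  qed
  moreover have "star l = l" if "star a = a"
    using bounded_linear.tendsto[OF bounded_linear_star l] star[OF that] l LIMSEQ_unique by simp
  moreover have "l * c = c * l" if "a * c = c * a" for c
  proof -
    have "(\<lambda>n. s n * c) \<longlonglongrightarrow> l * c" "(\<lambda>n. c * s n) \<longlonglongrightarrow> c * l" by (intro tendsto_intros l)+
    then show ?thesis using comm[OF that] LIMSEQ_unique by simp
  qed
  ultimately show ?thesis by blast
qed

section \<open>Positive elements of a unital C*-algebra\<close>

class unital_cstar_algebra = cstar_algebra + monoid_mult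

lemma star_one [simp]: "star 1 = (1 :: 'a::unital_cstar_algebra)"
  using star_mult[of "star 1" "1::'a"] by (simp add: star_star)

text \<open>Equality is not claimed: in the zero algebra the unit has norm 0, and the multipliers of
  the zero algebra must qualify as well.\<close>

lemma norm_one_le: "norm (1 :: 'a::unital_cstar_algebra) \<le> 1"
  using cstar_identity[of "1::'a"] by (auto simp: power2_eq_square)

text \<open>The element \<open>u = a + \<i> *\<^sub>C k\<close> satisfies
  \<open>star u * u = 1\<close>, and \<open>a\<close> is its real part. This replaces functional
  calculus: \<open>a\<close> is bounded by 1 as soon as \<open>1 - a * a\<close> has a commuting
  self-adjoint square root.\<close>

lemma norm_le_1_if_square_sum_1:
  fixes a k :: "'a::unital_cstar_algebra"
  assumes a: "star a = a" and k: "star k = k" and c: "a * k = k * a" and eq: "a * a + k * k = 1"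
  shows "norm a \<le> 1"
proof -
  define u where "u = a + \<i> *\<^sub>C k"
  have su: "star u = a - \<i> *\<^sub>C k" by (simp add: u_def star_add star_scaleC a k)
  have "star u * u = a * a + k * k"
    unfolding su by (simp add: u_def algebra_simps mult_scaleC_left mult_scaleC_right scaleC_scaleC c
        complex_vector.scale_minus_left scaleC_one)
  then have "(norm u)\<^sup>2 \<le> 1" by (metis cstar_identity eq norm_one_le)
  then have "norm u \<le> 1" using power2_le_imp_le[of "norm u" 1] by simp
  moreover have "2 *\<^sub>R a = u + star u" unfolding su by (simp add: u_def scaleR_2)
  then have "2 * norm a \<le> norm u + norm (star u)" by (metis norm_scaleR norm_triangle_ineq abs_numeral)
  ultimately show ?thesis by (simp add: norm_star)
qed

text \<open>For self-adjoint \<open>a\<close>, the norm condition says that the spectrum of \<open>a\<close> lies in \<open>[0, 2 t]\<close>.\<close>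

definition pos :: "'a::unital_cstar_algebra \<Rightarrow> bool" where
  "pos a \<longleftrightarrow> star a = a \<and> (\<exists>t\<ge>0. norm (t *\<^sub>R 1 - a) \<le> t)"

lemma posI: "star a = a \<Longrightarrow> 0 \<le> t \<Longrightarrow> norm (t *\<^sub>R 1 - a) \<le> t \<Longrightarrow> pos a"
  unfolding pos_def by blast

lemma pos_selfadjoint: "pos a \<Longrightarrow> star a = a"
  by (simp add: pos_def)

lemma pos_add: "pos a \<Longrightarrow> pos b \<Longrightarrow> pos (a + b)"
proof -
  assume "pos a" "pos b"
  then obtain s t where st: "star a = a" "star b = b" "0 \<le> s" "0 \<le> t"
    "norm (s *\<^sub>R 1 - a) \<le> s" "norm (t *\<^sub>R 1 - b) \<le> t" by (auto simp: pos_def)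
  have "norm ((s + t) *\<^sub>R 1 - (a + b)) \<le> s + t"
    using norm_triangle_ineq[of "s *\<^sub>R 1 - a" "t *\<^sub>R 1 - b"] st by (simp add: algebra_simps)
  with st show ?thesis by (intro posI[of _ "s + t"]) (simp_all add: star_add)
qed

lemma pos_scaleR: "pos a \<Longrightarrow> 0 \<le> r \<Longrightarrow> pos (r *\<^sub>R a)"
proof -
  assume "pos a" and r: "0 \<le> r"
  then obtain t where t: "star a = a" "0 \<le> t" "norm (t *\<^sub>R 1 - a) \<le> t" by (auto simp: pos_def)
  have "norm ((r * t) *\<^sub>R 1 - r *\<^sub>R a) = r * norm (t *\<^sub>R 1 - a)"
    using r norm_scaleR[of r "t *\<^sub>R 1 - a"] by (simp add: scaleR_diff_right)
  with t r show ?thesis by (intro posI[of _ "r * t"]) (simp_all add: star_scaleR mult_left_mono)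
qed

lemma pos_norm_minus: "star a = a \<Longrightarrow> norm a \<le> t \<Longrightarrow> pos (t *\<^sub>R 1 - a)"
  by (rule posI[of _ t]) (simp_all add: star_diff star_scaleR order_trans[OF norm_ge_zero])

text \<open>After normalisation to norm one, \<open>1 - b * b\<close> is the square of a
  self-adjoint \<open>k\<close> that commutes with \<open>b\<close>, and the relation
  \<open>k * k + b * b = 1\<close> bounds \<open>k\<close> just as it bounds
  \<open>b\<close>.\<close>

lemma pos_square_bound:
  fixes h :: "'a::unital_cstar_algebra"
  assumes h: "star h = h"
  shows "norm ((norm h)\<^sup>2 *\<^sub>R 1 - h * h) \<le> (norm h)\<^sup>2"
proof (cases "h = 0")
  case False
  define b where "b = inverse (norm h) *\<^sub>R h"
  have b: "star b = b" "norm b = 1" and hb: "h = norm h *\<^sub>R b"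
    using False by (simp_all add: b_def star_scaleR h)
  have "norm (b * b) \<le> 1" using b by (simp add: norm_square_selfadjoint)
  from ex_one_minus_sqrt[OF this] obtain s where s: "2 *\<^sub>R s = b * b + s * s"
    "star s = s" "s * b = b * s"
    by (auto simp: star_mult b mult.assoc)
  define k where "k = 1 - s"
  have kk: "k * k = 1 - b * b"
    using s(1) by (simp add: k_def algebra_simps scaleR_2)
  have "norm k \<le> 1"
    by (rule norm_le_1_if_square_sum_1[of k b])
      (use b s kk in \<open>simp_all add: k_def star_diff algebra_simps\<close>)
  then have "norm (k * k) \<le> 1"
    using norm_mult_ineq[of k k] mult_le_one[of "norm k" "norm k"] by simp
  then have n: "norm (1 - b * b) \<le> 1" by (simp add: kk)
  have "(norm h)\<^sup>2 *\<^sub>R 1 - h * h = (norm h)\<^sup>2 *\<^sub>R (1 - b * b)"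
    by (subst (2 3) hb) (simp add: scaleR_diff_right power2_eq_square)
  then show ?thesis using mult_left_mono[OF n, of "(norm h)\<^sup>2"] by simp
qed simp

lemma pos_square: "star h = h \<Longrightarrow> pos (h * h)"
  by (rule posI[of _ "(norm h)\<^sup>2"]) (simp_all add: star_mult pos_square_bound)

text \<open>Up to the factor \<open>t\<close>, the element \<open>a\<close> is \<open>1 - x\<close>
  with \<open>norm x \<le> 1\<close>, the case solved by iteration. Commutation with everything that
  commutes with \<open>a\<close> is recorded because products of positive elements are positive only
  when the factors commute.\<close>

lemma pos_sqrt:
  fixes a :: "'a::unital_cstar_algebra"
  assumes "pos a"
  obtains h where "pos h" "h * h = a" "\<And>c. a * c = c * a \<Longrightarrow> h * c = c * h"
proof -
  obtain t where t: "star a = a" "0 \<le> t" "norm (t *\<^sub>R 1 - a) \<le> t"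
    using assms by (auto simp: pos_def)
  show thesis
  proof (cases "t = 0")
    case True
    then have "a = 0" using t by simp
    then show thesis using that[of 0] by (simp add: pos_square[of 0, simplified])
  next
    case False
    define x where "x = 1 - inverse t *\<^sub>R a"
    have "x = inverse t *\<^sub>R (t *\<^sub>R 1 - a)" using False by (simp add: x_def scaleR_diff_right)
    then have "norm x = norm (t *\<^sub>R 1 - a) / t" using t by (simp only: norm_scaleR) (simp add: divide_inverse)
    then have nx: "norm x \<le> 1" using t False by simp
    have sx: "star x = x" by (simp add: x_def star_diff star_scaleR t)
    from ex_one_minus_sqrt[OF nx] sx obtain s where s: "norm s \<le> 1" "2 *\<^sub>R s = x + s * s" "star s = s"
      and c: "\<And>c. x * c = c * x \<Longrightarrow> s * c = c * s" by blast
    define h where "h = sqrt t *\<^sub>R (1 - s)"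
    have ps: "pos (1 - s)" using pos_norm_minus[of s 1] s by simp
    show thesis
    proof (rule that[of h])
      show "pos h" unfolding h_def using t by (intro pos_scaleR ps) simp
      have "h * h = t *\<^sub>R ((1 - s) * (1 - s))" using t by (simp add: h_def)
      also have "(1 - s) * (1 - s) = inverse t *\<^sub>R a"
        using s(2) by (simp add: x_def algebra_simps scaleR_2)
      finally show "h * h = a" using False by simp
      fix d assume "a * d = d * a"
      then have "x * d = d * x" by (simp add: x_def algebra_simps)
      then have "s * d = d * s" by (rule c)
      then show "h * d = d * h" by (simp add: h_def algebra_simps)
    qed
  qed
qed

text \<open>Positivity asks for some radius \<open>t\<close>; writing \<open>a\<close> as the square
  of a self-adjoint element shows that the norm of \<open>a\<close> serves as the radius.\<close>

lemma pos_norm_bound: "pos a \<Longrightarrow> norm (norm a *\<^sub>R 1 - a) \<le> norm a"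
  by (metis norm_square_selfadjoint pos_selfadjoint pos_sqrt pos_square_bound)

lemma pos_mult:
  fixes a b :: "'a::unital_cstar_algebra"
  assumes a: "pos a" and b: "pos b" and ab: "a * b = b * a"
  shows "pos (a * b)"
proof -
  obtain h where h: "pos h" "h * h = a" "\<And>c. a * c = c * a \<Longrightarrow> h * c = c * h"
    by (rule pos_sqrt[OF a]) blast
  obtain k where k: "pos k" "k * k = b" "\<And>c. b * c = c * b \<Longrightarrow> k * c = c * k"
    by (rule pos_sqrt[OF b]) blast
  have hk: "k * h = h * k" by (rule k(3)) (simp add: h(3)[OF ab])
  have "star (h * k) = h * k" by (simp add: star_mult pos_selfadjoint h(1) k(1) hk)
  then have "pos (h * k * (h * k))" by (rule pos_square)
  also have "h * k * (h * k) = a * b"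
    unfolding h(2)[symmetric] k(2)[symmetric] by (metis hk mult.assoc)
  finally show ?thesis .
qed

lemma pos_one: "pos (1 :: 'a::unital_cstar_algebra)"
  using pos_square[of 1] by simp

lemma pos_power: "pos a \<Longrightarrow> pos (a ^ n)"
  by (induction n) (simp_all add: pos_one pos_mult power_commutes)

text \<open>The square roots of \<open>a\<close> and \<open>1 - a\<close> commute and their squares
  add up to 1.\<close>

lemma norm_le_1_if_pos:
  fixes a :: "'a::unital_cstar_algebra"
  assumes a: "pos a" and b: "pos (1 - a)"
  shows "norm a \<le> 1"
proof -
  obtain h where h: "pos h" "h * h = a" "\<And>c. a * c = c * a \<Longrightarrow> h * c = c * h"
    by (rule pos_sqrt[OF a]) blast
  obtain k where k: "pos k" "k * k = 1 - a" "\<And>c. (1 - a) * c = c * (1 - a) \<Longrightarrow> k * c = c * k"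
    by (rule pos_sqrt[OF b]) blast
  have ha: "h * a = a * h" by (rule h(3)) simp
  have "k * h = h * k" using k(3)[of h] ha by (simp add: algebra_simps)
  then have "norm h \<le> 1"
    using h(1,2) k(1,2) by (intro norm_le_1_if_square_sum_1[of h k]) (simp_all add: pos_selfadjoint)
  then show ?thesis using norm_mult_ineq[of h h] mult_le_one[of "norm h" "norm h"] h(2) by simp
qed

lemma norm_mono_pos:
  fixes a b :: "'a::unital_cstar_algebra"
  assumes a: "pos a" and b: "pos (b - a)"
  shows "norm a \<le> norm b"
proof -
  have sb: "star b = b" using pos_selfadjoint[OF a] pos_selfadjoint[OF b] by (simp add: star_diff)
  \<comment> \<open>A strictly positive bound is used because \<open>t\<close> is divided out, while
    \<open>norm b\<close> itself may vanish.\<close>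
  have *: "norm a \<le> t" if t: "norm b \<le> t" "0 < t" for t
  proof -
    have "pos ((t *\<^sub>R 1 - b) + (b - a))" by (intro pos_add pos_norm_minus sb t b)
    then have "pos (inverse t *\<^sub>R (t *\<^sub>R 1 - a))" using t by (intro pos_scaleR) simp_all
    then have "pos (1 - inverse t *\<^sub>R a)" using t by (simp add: scaleR_diff_right)
    moreover have "pos (inverse t *\<^sub>R a)" using t a by (intro pos_scaleR) simp_all
    ultimately have "norm (inverse t *\<^sub>R a) \<le> 1" by (rule norm_le_1_if_pos[rotated])
    then show ?thesis using t by (simp add: field_simps)
  qed
  show ?thesis
  proof (rule field_le_epsilon)
    fix e :: real assume "0 < e"
    then show "norm a \<le> norm b + e" by (intro *) (simp_all add: add_nonneg_pos)
  qed
qed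

text \<open>The usual argument compares the spectra of \<open>star c * c\<close> and
  \<open>c * star c\<close>. Here \<open>c * star c\<close> is positive because the sum of the two
  is half a sum of squares, and the conclusion is a comparison of norms: one expression for
  \<open>z\<close> bounds \<open>norm (z * star z)\<close> above by \<open>t * t\<^sup>2\<close>,
  the other bounds it below by \<open>2 * t * t\<^sup>2\<close>.\<close>

lemma star_mult_self_neg:
  fixes c :: "'a::unital_cstar_algebra"
  assumes neg: "pos (- (star c * c))"
  shows "c = 0"
proof -
  define x y t where "x = c * star c" and "y = - (star c * c)" and "t = (norm c)\<^sup>2"
  have ny: "norm y = t" by (simp add: y_def t_def cstar_identity)
  have nx: "norm x = t" using cstar_identity[of "star c"] by (simp add: x_def t_def norm_star star_star)
  \<comment> \<open>Twice the real and, up to sign, twice the imaginary part of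
    \<open>c\<close>.\<close>
  define h k where "h = c + star c" and "k = \<i> *\<^sub>C (c - star c)"
  have sh: "star h = h" by (simp add: h_def star_add star_star add.commute)
  have sk: "star k = k"
    by (simp add: k_def star_scaleC star_diff star_star complex_vector.scale_minus_left
        complex_vector.scale_right_diff_distrib)
  have "h * h + k * k = 2 *\<^sub>R (x - y)"
    by (simp add: h_def k_def x_def y_def algebra_simps mult_scaleC_left mult_scaleC_right
        scaleC_scaleC complex_vector.scale_minus_left scaleC_one scaleR_2
        complex_vector.scale_right_diff_distrib)
  then have "x = (1/2) *\<^sub>R (h * h + k * k) + y" by simp
  then have px: "pos x"
    by (simp only:) (intro pos_add pos_scaleR pos_square sh sk neg[folded y_def], simp)
  have px2: "pos (x * x)" and px3: "pos (x * x * x)"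
    using px by (simp_all add: pos_mult mult.assoc)
  \<comment> \<open>The factor \<open>t + x\<close> on the left of \<open>c\<close> becomes
    \<open>t - y\<close> on its right, and the latter has norm at most \<open>t\<close> because
    \<open>y\<close> is positive with norm \<open>t\<close>.\<close>
  define z where "z = (t *\<^sub>R 1 + x) * c"
  have zc: "z = c * (t *\<^sub>R 1 - y)"
    by (simp add: z_def x_def y_def algebra_simps)
  have "norm z \<le> norm c * t"
    using norm_mult_ineq[of c "t *\<^sub>R 1 - y"] pos_norm_bound[OF neg[folded y_def], unfolded ny]
    unfolding zc by (meson mult_left_mono norm_ge_zero order_trans)
  then have "(norm z)\<^sup>2 \<le> (norm c * t)\<^sup>2" by (intro power_mono) simp_all
  also have "\<dots> = t * t\<^sup>2" by (simp add: t_def power_mult_distrib)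
  finally have up: "norm (z * star z) \<le> t * t\<^sup>2"
    using cstar_identity[of "star z"] by (simp add: star_star norm_star)
  have "z * star z = t\<^sup>2 *\<^sub>R x + (t *\<^sub>R (x * x) + t *\<^sub>R (x * x)) + x * x * x"
    using pos_selfadjoint[OF px]
    by (simp add: z_def star_mult star_add star_scaleR x_def algebra_simps power2_eq_square)
  also have "t *\<^sub>R (x * x) + t *\<^sub>R (x * x) = (2 * t) *\<^sub>R (x * x)"
    by (simp add: scaleR_left_distrib[symmetric])
  finally have zz: "z * star z = t\<^sup>2 *\<^sub>R x + (2 * t) *\<^sub>R (x * x) + x * x * x" .
  have t0: "0 \<le> t" by (simp add: t_def)
  have "norm ((2 * t) *\<^sub>R (x * x)) \<le> norm (z * star z)"
  proof (rule norm_mono_pos)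
    show "pos ((2 * t) *\<^sub>R (x * x))" using t0 px2 by (intro pos_scaleR) simp_all
    have "pos (t\<^sup>2 *\<^sub>R x + x * x * x)" by (intro pos_add pos_scaleR px px3) simp
    then show "pos (z * star z - (2 * t) *\<^sub>R (x * x))" by (simp add: zz)
  qed
  then have "2 * t * t\<^sup>2 \<le> t * t\<^sup>2"
    using up t0 nx by (simp add: norm_square_selfadjoint[OF pos_selfadjoint[OF px]])
  then have "t * t\<^sup>2 \<le> 0" by simp
  then have "t = 0" using t0 by (metis mult_eq_0_iff order_antisym zero_le_power2 mult_nonneg_nonneg power2_eq_square)
  then show ?thesis by (simp add: t_def)
qed

text \<open>
  The self-adjoint element \<open>a = star b * b\<close> equals \<open>h = \<bar>a\<bar>\<close>: its negative part is \<open>n / 2\<close>, and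
  \<open>star (b * n) * (b * n) = n * a * n = - n * h * n\<close> is negative, hence \<open>b * n = 0\<close>.
\<close>

lemma pos_star_mult_self: "pos (star b * (b :: 'a::unital_cstar_algebra))"
proof -
  define a where "a = star b * b"
  have sa: "star a = a" by (simp add: a_def star_mult star_star)
  have "pos (a * a)" by (rule pos_square[OF sa])
  then obtain h where h: "pos h" "h * h = a * a" "\<And>c. a * a * c = c * (a * a) \<Longrightarrow> h * c = c * h"
    by (rule pos_sqrt) blast
  have ha: "h * a = a * h" by (rule h(3)) (simp add: mult.assoc)
  obtain k where k: "pos k" "k * k = h" "\<And>c. h * c = c * h \<Longrightarrow> k * c = c * k"
    by (rule pos_sqrt[OF h(1)]) blast
  define n where "n = h - a"
  have sn: "star n = n" by (simp add: n_def star_diff sa pos_selfadjoint[OF h(1)])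
  have hn: "h * n = n * h" by (simp add: n_def algebra_simps ha)
  have kn: "k * n = n * k" by (rule k(3)[OF hn])
  have an: "a * n = - (h * n)" by (simp add: n_def algebra_simps ha h(2))
  have nn: "n * n = 2 *\<^sub>R (h * n)" by (simp add: n_def algebra_simps ha h(2) scaleR_2)
  have "star (k * n) = k * n" by (simp add: star_mult sn pos_selfadjoint[OF k(1)] kn)
  then have "pos (k * n * (k * n))" by (rule pos_square)
  also have "k * n * (k * n) = n * (h * n)" unfolding k(2)[symmetric] by (metis kn mult.assoc)
  finally have p: "pos (n * (h * n))" .
  have e: "star (b * n) * (b * n) = n * (a * n)" by (simp add: star_mult sn a_def mult.assoc)
  have "pos (- (star (b * n) * (b * n)))" using p by (simp add: e an)
  then have "b * n = 0" by (rule star_mult_self_neg)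
  then have "n * (h * n) = 0" using e by (simp add: an)
  then have "n * (n * n) = 0" by (simp add: nn)
  \<comment> \<open>The fourth power is used because the C*-identity computes the norms of iterated
    squares.\<close>
  then have "n * n * (n * n) = 0" by (simp add: mult.assoc)
  then have "n = 0"
    using norm_square_selfadjoint[OF sn] norm_square_selfadjoint[of "n * n"] by (simp add: star_mult sn)
  then show ?thesis using h(1) by (simp add: n_def a_def)
qed

text \<open>The operator form of the bound 1 / N for \<open>(1 - s) ^ N * s\<close> on the unit
  interval. It holds because \<open>1 - e ^ N\<close> is the sum of the \<open>e ^ j * a\<close>
  over \<open>j < N\<close>, and each of these dominates \<open>e ^ N * a\<close>. It supplies the
  rate of convergence in the approximation of vectors by finite rank operators.\<close>

lemma norm_power_mult_bound:
  fixes a :: "'a::unital_cstar_algebra"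
  assumes a: "pos a" and n: "norm a \<le> 1"
  shows "real N * norm ((1 - a) ^ N * a) \<le> 1"
proof -
  define e where "e = 1 - a"
  have e: "pos e" using pos_norm_minus[OF pos_selfadjoint[OF a] n] by (simp add: e_def)
  have ea: "e * a = a * e" by (simp add: e_def algebra_simps)
  have eNa: "e ^ N * a = a * e ^ N" for N by (rule power_commuting_commutes[OF ea])
  have p1: "pos (e ^ N * a)" for N by (intro pos_mult pos_power e a eNa)
  have p2: "pos (e ^ N * a * a)" for N by (intro pos_mult p1 a) (simp add: eNa mult.assoc)
  have main: "pos (1 - e ^ N - real N *\<^sub>R (e ^ N * a))" for N
  proof (induction N)
    case 0
    then show ?case using pos_square[of "0::'a"] by simp
  next
    case (Suc N)
    have eS: "e ^ Suc N = e ^ N - e ^ N * a"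
      by (simp only: power_Suc2) (simp add: e_def right_diff_distrib)
    have "1 - e ^ Suc N - real (Suc N) *\<^sub>R (e ^ Suc N * a)
        = (1 - e ^ N - real N *\<^sub>R (e ^ N * a)) + real (Suc N) *\<^sub>R (e ^ N * a * a)"
      unfolding eS by (simp add: algebra_simps)
    then show ?case by (simp only:) (intro pos_add Suc pos_scaleR p2, simp)
  qed
  have "pos (1 - real N *\<^sub>R (e ^ N * a))"
    using pos_add[OF main[of N] pos_power[OF e, of N]] by simp
  then have "norm (real N *\<^sub>R (e ^ N * a)) \<le> 1"
    by (intro norm_le_1_if_pos pos_scaleR p1) simp_all
  then show ?thesis by (simp add: e_def)
qed

section \<open>The multiplier algebra\<close>

text \<open>Adjointness of maps on the algebra regarded as a Hilbert module over itself, with inner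
  product \<open>star x * y\<close>. Multipliers are thus encoded as adjointable operators, and the
  partner \<open>g\<close> supplies the involution.\<close>

definition multiplier_pair :: "('a::cstar_algebra \<Rightarrow> 'a) \<Rightarrow> ('a \<Rightarrow> 'a) \<Rightarrow> bool" where
  "multiplier_pair f g \<longleftrightarrow> (\<forall>x y. star (f x) * y = star x * g y)"

lemma multiplier_pair_sym: "multiplier_pair f g \<Longrightarrow> multiplier_pair g f"
  unfolding multiplier_pair_def by (metis star_mult star_star)

lemma multiplier_pair_unique: "multiplier_pair f g \<Longrightarrow> multiplier_pair f h \<Longrightarrow> g = h"
proof
  fix y assume *: "multiplier_pair f g" "multiplier_pair f h"
  show "g y = h y"
    by (rule star_mult_left_cancel) (use * in \<open>metis multiplier_pair_def multiplier_pair_sym\<close>)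
qed

lemma bounded_linear_multiplier_pair:
  assumes f: "bounded_linear f" and fg: "multiplier_pair f g"
  shows "bounded_linear g"
proof (rule bounded_linear_intro[where K = "onorm f"])
  have gf: "star (g x) * y = star x * f y" for x y
    using multiplier_pair_sym[OF fg] by (simp add: multiplier_pair_def)
  show "g (x + y) = g x + g y" for x y
    by (rule star_mult_left_cancel) (simp add: gf star_add distrib_right)
  show "g (r *\<^sub>R x) = r *\<^sub>R g x" for r x
    by (rule star_mult_left_cancel) (simp add: gf star_scaleR)
  show "norm (g x) \<le> norm x * onorm f" for x
  proof (cases "g x = 0")
    case False
    have "norm (g x) * norm (g x) = norm (star x * f (g x))"
      using cstar_identity[of "g x"] by (simp add: gf power2_eq_square)
    also have "\<dots> \<le> norm x * norm (f (g x))" by (metis norm_mult_ineq norm_star)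
    also have "\<dots> \<le> norm x * (onorm f * norm (g x))" by (intro mult_left_mono onorm f) simp
    finally show ?thesis using False by simp
  qed (simp add: onorm_pos_le f)
qed

lemma multiplier_pair_compose:
  "multiplier_pair f f' \<Longrightarrow> multiplier_pair g g' \<Longrightarrow> multiplier_pair (f \<circ> g) (g' \<circ> f')"
  by (simp add: multiplier_pair_def)

lemma multiplier_pair_add:
  "multiplier_pair f f' \<Longrightarrow> multiplier_pair g g' \<Longrightarrow> multiplier_pair (\<lambda>x. f x + g x) (\<lambda>x. f' x + g' x)"
  by (simp add: multiplier_pair_def star_add algebra_simps)

lemma multiplier_pair_scaleC:
  "multiplier_pair f f' \<Longrightarrow> multiplier_pair (\<lambda>x. c *\<^sub>C f x) (\<lambda>x. cnj c *\<^sub>C f' x)"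
  by (simp add: multiplier_pair_def star_scaleC mult_scaleC_left mult_scaleC_right)

lemma multiplier_pair_scaleR:
  "multiplier_pair f f' \<Longrightarrow> multiplier_pair (\<lambda>x. r *\<^sub>R f x) (\<lambda>x. r *\<^sub>R f' x)"
  using multiplier_pair_scaleC[of f f' "complex_of_real r"] by (simp add: scaleR_scaleC)

lemma multiplier_pair_zero: "multiplier_pair (\<lambda>x. 0) (\<lambda>x. 0)"
  by (simp add: multiplier_pair_def)

lemma multiplier_pair_id: "multiplier_pair (\<lambda>x. x) (\<lambda>x. x)"
  by (simp add: multiplier_pair_def)

lemma bounded_linear_scaleC_cstar:
  "bounded_linear f \<Longrightarrow> bounded_linear (\<lambda>x. c *\<^sub>C (f x :: 'a::cstar_algebra))"
  by (rule bounded_linear_compose[of "\<lambda>x. c *\<^sub>C x"], rule bounded_linear_intro[where K = "cmod c"])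
    (simp_all add: scaleC_add_right norm_scaleC scaleR_scaleC scaleC_scaleC mult.commute)

text \<open>The multiplier algebra serves as the unital algebra in which order arguments take place.
  The operator norm is a C*-norm on it in every case, whereas on the algebra with a formally
  adjoined unit it is only a seminorm if a unit was already present.\<close>

typedef (overloaded) ('a::cstar_algebra) multiplier =
  "{f :: 'a \<Rightarrow> 'a. bounded_linear f \<and> (\<exists>g. multiplier_pair f g)}"
  morphisms mul_apply Abs_multiplier
  by (rule exI[of _ "\<lambda>x. 0"]) (use multiplier_pair_zero in auto)

setup_lifting type_definition_multiplier

lemma bounded_linear_mul_apply: "bounded_linear (mul_apply T)"
  using mul_apply[of T] by simp

lemma mul_eqI: "(\<And>x. mul_apply S x = mul_apply T x) \<Longrightarrow> S = T"
  using mul_apply_inject by blast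

instantiation multiplier :: (cstar_algebra) real_normed_algebra
begin

lift_definition zero_multiplier :: "'a multiplier" is "\<lambda>x. 0"
  using multiplier_pair_zero by auto
lift_definition plus_multiplier :: "'a multiplier \<Rightarrow> 'a multiplier \<Rightarrow> 'a multiplier"
  is "\<lambda>f g x. f x + g x"
  using multiplier_pair_add bounded_linear_add by blast
lift_definition scaleR_multiplier :: "real \<Rightarrow> 'a multiplier \<Rightarrow> 'a multiplier"
  is "\<lambda>r f x. r *\<^sub>R f x"
  using multiplier_pair_scaleR bounded_linear_compose[OF bounded_linear_scaleR_right] by blast
lift_definition times_multiplier :: "'a multiplier \<Rightarrow> 'a multiplier \<Rightarrow> 'a multiplier"
  is "\<lambda>f g. f \<circ> g"
  using multiplier_pair_compose bounded_linear_compose unfolding comp_def by blast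
lift_definition norm_multiplier :: "'a multiplier \<Rightarrow> real" is onorm .
definition uminus_multiplier :: "'a multiplier \<Rightarrow> 'a multiplier" where "- T = (-1) *\<^sub>R (T :: 'a multiplier)"
definition minus_multiplier :: "'a multiplier \<Rightarrow> 'a multiplier \<Rightarrow> 'a multiplier" where
  "S - T = S + (- T :: 'a multiplier)"
definition dist_multiplier :: "'a multiplier \<Rightarrow> 'a multiplier \<Rightarrow> real" where
  "dist S T = norm (S - T :: 'a multiplier)"
definition sgn_multiplier :: "'a multiplier \<Rightarrow> 'a multiplier" where
  "sgn T = inverse (norm T) *\<^sub>R (T :: 'a multiplier)"
definition uniformity_multiplier :: "('a multiplier \<times> 'a multiplier) filter" where
  "uniformity_multiplier = (INF e\<in>{0<..}. principal {(S, T). dist S T < e})"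
definition open_multiplier :: "'a multiplier set \<Rightarrow> bool" where
  "open_multiplier U \<longleftrightarrow> (\<forall>S\<in>U. \<forall>\<^sub>F (S', T) in uniformity. S' = S \<longrightarrow> T \<in> U)"

lemma mul_apply_simps:
  fixes S T :: "'a multiplier"
  shows "mul_apply (0 :: 'a multiplier) x = 0"
    and "mul_apply (S + T) x = mul_apply S x + mul_apply T x"
    and "mul_apply (S - T) x = mul_apply S x - mul_apply T x"
    and "mul_apply (- T) x = - mul_apply T x"
    and "mul_apply (S * T) x = mul_apply S (mul_apply T x)"
    and "mul_apply (r *\<^sub>R T) x = r *\<^sub>R mul_apply T x"
  unfolding minus_multiplier_def uminus_multiplier_def by (transfer; simp)+

lemma norm_mul_apply: "norm (mul_apply T x) \<le> norm (T :: 'a multiplier) * norm x"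
  by transfer (simp add: onorm)

lemma norm_mul_bound:
  fixes T :: "'a multiplier"
  assumes "0 \<le> b" "\<And>x. norm (mul_apply T x) \<le> b * norm x"
  shows "norm T \<le> b"
  using assms by transfer (simp add: onorm_bound)

instance
proof
  fix R S T :: "'a multiplier" and r s :: real and U :: "'a multiplier set"
  note ext = mul_eqI and sm = mul_apply_simps
  show "R + S + T = R + (S + T)" "R + S = S + R" "0 + R = R" "- R + R = 0" "R - S = R + - S"
    by (rule ext, simp add: sm)+
  show "r *\<^sub>R (S + T) = r *\<^sub>R S + r *\<^sub>R T" "(r + s) *\<^sub>R T = r *\<^sub>R T + s *\<^sub>R T"
    "r *\<^sub>R s *\<^sub>R T = (r * s) *\<^sub>R T" "1 *\<^sub>R T = T"
    by (rule ext, simp add: sm algebra_simps)+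
  note lin = linear_add[OF bounded_linear.linear[OF bounded_linear_mul_apply]]
    linear_scale[OF bounded_linear.linear[OF bounded_linear_mul_apply]]
  show "R * S * T = R * (S * T)" "(R + S) * T = R * T + S * T" "R * (S + T) = R * S + R * T"
    "r *\<^sub>R S * T = r *\<^sub>R (S * T)" "S * r *\<^sub>R T = r *\<^sub>R (S * T)"
    by (rule ext, simp add: sm lin)+
  show "dist S T = norm (S - T)" by (rule dist_multiplier_def)
  show "sgn T = inverse (norm T) *\<^sub>R T" by (rule sgn_multiplier_def)
  show "uniformity = (INF e\<in>{0<..}. principal {(S, T::'a multiplier). dist S T < e})"
    by (rule uniformity_multiplier_def)
  show "open U \<longleftrightarrow> (\<forall>S\<in>U. \<forall>\<^sub>F (S', T) in uniformity. S' = S \<longrightarrow> T \<in> U)"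
    by (rule open_multiplier_def)
  show "norm T = 0 \<longleftrightarrow> T = 0" by transfer (auto simp: onorm_eq_0 fun_eq_iff)
  show "norm (S + T) \<le> norm S + norm T" by transfer (simp add: onorm_triangle)
  show "norm (r *\<^sub>R T) = \<bar>r\<bar> * norm T" by transfer (simp add: onorm_scaleR)
  show "norm (S * T) \<le> norm S * norm T" by transfer (simp add: onorm_compose)
qed

end

instantiation multiplier :: (cstar_algebra) complex_vector
begin

lift_definition scaleC_multiplier :: "complex \<Rightarrow> 'a multiplier \<Rightarrow> 'a multiplier"
  is "\<lambda>c f x. c *\<^sub>C f x"
  using multiplier_pair_scaleC bounded_linear_scaleC_cstar by blast

lemma mul_apply_scaleC: "mul_apply (c *\<^sub>C T) x = c *\<^sub>C mul_apply T x" for T :: "'a multiplier"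
  by transfer simp

instance
proof
  fix S T :: "'a multiplier" and c d :: complex and r :: real
  show "c *\<^sub>C (S + T) = c *\<^sub>C S + c *\<^sub>C T" "(c + d) *\<^sub>C T = c *\<^sub>C T + d *\<^sub>C T"
    "c *\<^sub>C d *\<^sub>C T = (c * d) *\<^sub>C T" "1 *\<^sub>C T = T" "r *\<^sub>R T = complex_of_real r *\<^sub>C T"
    by (rule mul_eqI, simp add: mul_apply_simps mul_apply_scaleC scaleC_add_right scaleC_add_left
        scaleC_scaleC scaleC_one scaleR_scaleC)+
qed

end

instantiation multiplier :: (cstar_algebra) unital_cstar_algebra
begin

lift_definition one_multiplier :: "'a multiplier" is "\<lambda>x. x"
  using multiplier_pair_id by auto
lift_definition star_multiplier :: "'a multiplier \<Rightarrow> 'a multiplier"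
  is "\<lambda>f. THE g. multiplier_pair f g"
proof -
  fix f :: "'a \<Rightarrow> 'a" assume f: "bounded_linear f \<and> (\<exists>g. multiplier_pair f g)"
  then obtain g where g: "multiplier_pair f g" by blast
  then have "(THE g. multiplier_pair f g) = g" by (metis multiplier_pair_unique the_equality)
  then show "bounded_linear (THE g. multiplier_pair f g) \<and> (\<exists>h. multiplier_pair (THE g. multiplier_pair f g) h)"
    using f g bounded_linear_multiplier_pair multiplier_pair_sym by metis
qed

lemma multiplier_pair_star: "multiplier_pair (mul_apply T) (mul_apply (star T))" for T :: "'a multiplier"
proof transfer
  fix f :: "'a \<Rightarrow> 'a" assume "bounded_linear f \<and> (\<exists>g. multiplier_pair f g)"
  then obtain g where g: "multiplier_pair f g" by blast
  then show "multiplier_pair f (THE g. multiplier_pair f g)" by (metis multiplier_pair_unique the_equality)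
qed

lemma star_mul_apply: "star (mul_apply T x) * y = star x * mul_apply (star T) y" for T :: "'a multiplier"
  using multiplier_pair_star by (simp add: multiplier_pair_def)

lemma star_multiplierI: "multiplier_pair (mul_apply T) (mul_apply S) \<Longrightarrow> star T = S" for T :: "'a multiplier"
  using multiplier_pair_unique[OF multiplier_pair_star] mul_apply_inject by blast

lemma mul_apply_one: "mul_apply (1 :: 'a multiplier) x = x"
  by transfer simp

lemma norm_multiplier_star_le: "norm (star T) \<le> norm T" for T :: "'a multiplier"
proof (rule norm_mul_bound)
  fix x
  have "(norm (mul_apply (star T) x))\<^sup>2 = norm (star (mul_apply (star T) x) * mul_apply (star T) x)"
    by (simp add: cstar_identity)
  also have "\<dots> = norm (star (mul_apply T (mul_apply (star T) x)) * x)"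
    by (simp add: star_mul_apply)
  also have "\<dots> \<le> norm (mul_apply T (mul_apply (star T) x)) * norm x"
    by (metis norm_mult_ineq norm_star)
  also have "\<dots> \<le> norm T * norm (mul_apply (star T) x) * norm x"
    by (intro mult_right_mono norm_mul_apply) simp
  finally have "norm (mul_apply (star T) x) * norm (mul_apply (star T) x)
      \<le> (norm T * norm x) * norm (mul_apply (star T) x)"
    by (simp add: power2_eq_square mult_ac)
  then show "norm (mul_apply (star T) x) \<le> norm T * norm x"
    by (cases "mul_apply (star T) x = 0") auto
qed simp

instance
proof
  fix S T :: "'a multiplier" and c :: complex
  show "1 * T = T" "T * 1 = T" by (rule mul_eqI, simp add: mul_apply_simps mul_apply_one)+
  \<comment> \<open>Complex linearity is not built into the type; it follows from the adjoint
    relation.\<close>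
  have lin: "mul_apply T (c *\<^sub>C x) = c *\<^sub>C mul_apply T x" for T :: "'a multiplier" and c x
    by (rule star_mult_left_cancel)
      (simp add: star_mul_apply star_scaleC mult_scaleC_left)
  have le: "norm (c *\<^sub>C T) \<le> cmod c * norm T" for c and T :: "'a multiplier"
  proof (rule norm_mul_bound)
    show "norm (mul_apply (c *\<^sub>C T) x) \<le> cmod c * norm T * norm x" for x
      using norm_mul_apply[of T x] by (simp add: mul_apply_scaleC norm_scaleC mult.assoc mult_left_mono)
  qed simp
  show "norm (c *\<^sub>C T) = cmod c * norm T"
  proof (cases "c = 0")
    case False
    have "norm (inverse c *\<^sub>C c *\<^sub>C T) \<le> cmod (inverse c) * norm (c *\<^sub>C T)" by (rule le)
    then have "cmod c * norm T \<le> norm (c *\<^sub>C T)"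
      using False by (simp add: scaleC_scaleC scaleC_one norm_inverse norm_divide field_simps)
    then show ?thesis using le[of c T] by simp
  qed simp
  show "(c *\<^sub>C S) * T = c *\<^sub>C (S * T)" "S * (c *\<^sub>C T) = c *\<^sub>C (S * T)"
    by (rule mul_eqI, simp add: mul_apply_simps mul_apply_scaleC lin)+
  show ss: "star (star T) = T" for T :: "'a multiplier"
    by (rule star_multiplierI) (rule multiplier_pair_sym, rule multiplier_pair_star)
  show "star (S + T) = star S + star T"
    by (rule star_multiplierI)
      (simp add: multiplier_pair_def mul_apply_simps star_add star_mul_apply algebra_simps)
  show "star (c *\<^sub>C T) = cnj c *\<^sub>C star T"
    by (rule star_multiplierI)
      (simp add: multiplier_pair_def mul_apply_scaleC star_scaleC star_mul_apply mult_scaleC_left mult_scaleC_right)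
  show "star (S * T) = star T * star S"
    by (rule star_multiplierI) (simp add: multiplier_pair_def mul_apply_simps star_mul_apply)
  have ns: "norm (star T) = norm T" for T :: "'a multiplier"
    using norm_multiplier_star_le[of T] norm_multiplier_star_le[of "star T"] by (simp add: ss)
  show "norm (star T * T) = (norm T)\<^sup>2"
  proof (rule antisym)
    show "norm (star T * T) \<le> (norm T)\<^sup>2"
      using norm_mult_ineq[of "star T" T] by (simp add: ns power2_eq_square)
    have "norm (mul_apply T x) \<le> sqrt (norm (star T * T)) * norm x" for x
    proof -
      have "(norm (mul_apply T x))\<^sup>2 = norm (star (mul_apply T x) * mul_apply T x)"
        by (simp add: cstar_identity)
      also have "\<dots> = norm (star x * mul_apply (star T * T) x)"
        by (simp add: star_mul_apply mul_apply_simps)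
      also have "\<dots> \<le> norm x * norm (mul_apply (star T * T) x)" by (metis norm_mult_ineq norm_star)
      also have "\<dots> \<le> norm x * (norm (star T * T) * norm x)"
        by (intro mult_left_mono norm_mul_apply) simp
      also have "\<dots> = (sqrt (norm (star T * T)) * norm x)\<^sup>2"
        by (simp add: power_mult_distrib power2_eq_square)
      finally show ?thesis by (rule power2_le_imp_le) simp
    qed
    then have "norm T \<le> sqrt (norm (star T * T))" by (intro norm_mul_bound) simp_all
    then have "(norm T)\<^sup>2 \<le> (sqrt (norm (star T * T)))\<^sup>2" by (intro power_mono) simp_all
    then show "(norm T)\<^sup>2 \<le> norm (star T * T)" by simp
  qed
next
  fix s :: "nat \<Rightarrow> 'a multiplier"
  assume C: "Cauchy s"
  have ns: "norm (star S - star T) \<le> norm (S - T)" for S T :: "'a multiplier"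
  proof -
    have "star (S - T) = star S - star T"
      by (rule star_multiplierI)
        (simp add: multiplier_pair_def mul_apply_simps star_diff star_mul_apply algebra_simps)
    then show ?thesis using norm_multiplier_star_le[of "S - T"] by simp
  qed
  have lims: "\<exists>f. (\<forall>x. (\<lambda>n. mul_apply (t n) x) \<longlonglongrightarrow> f x) \<and> bounded_linear f \<and>
      (\<forall>e>0. \<exists>N. \<forall>n\<ge>N. \<forall>x. norm (mul_apply (t n) x - f x) \<le> e * norm x)"
    if t: "Cauchy t" for t :: "nat \<Rightarrow> 'a multiplier"
  proof -
    have "Cauchy (\<lambda>n. Blinfun (mul_apply (t n)))"
    proof (rule CauchyI)
      fix e :: real assume "0 < e"
      then obtain N where N: "\<And>m n. m \<ge> N \<Longrightarrow> n \<ge> N \<Longrightarrow> norm (t m - t n) < e"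
        using CauchyD[OF t] by blast
      have "norm (Blinfun (mul_apply (t m)) - Blinfun (mul_apply (t n))) \<le> norm (t m - t n)" for m n
      proof (rule norm_blinfun_bound)
        fix x
        show "norm (blinfun_apply (Blinfun (mul_apply (t m)) - Blinfun (mul_apply (t n))) x) \<le> norm (t m - t n) * norm x"
          using norm_mul_apply[of "t m - t n" x]
          by (simp add: blinfun.diff_left bounded_linear_Blinfun_apply bounded_linear_mul_apply mul_apply_simps)
      qed simp
      then show "\<exists>M. \<forall>m\<ge>M. \<forall>n\<ge>M. norm (Blinfun (mul_apply (t m)) - Blinfun (mul_apply (t n))) < e"
        using N by (meson le_less_trans)
    qed
    then obtain L where L: "(\<lambda>n. Blinfun (mul_apply (t n))) \<longlonglongrightarrow> L"
      using Cauchy_convergent convergent_def by blast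
    have ap: "blinfun_apply (Blinfun (mul_apply (t n))) = mul_apply (t n)" for n
      by (simp add: bounded_linear_Blinfun_apply bounded_linear_mul_apply)
    show ?thesis
    proof (intro exI[of _ "blinfun_apply L"] conjI allI impI)
      show "(\<lambda>n. mul_apply (t n) x) \<longlonglongrightarrow> blinfun_apply L x" for x
        using bounded_linear.tendsto[OF blinfun.bounded_linear_left L, of x] by (simp add: ap)
      show "bounded_linear (blinfun_apply L)" by (rule blinfun.bounded_linear_right)
      fix e :: real assume "0 < e"
      then obtain N where N: "\<And>n. n \<ge> N \<Longrightarrow> norm (Blinfun (mul_apply (t n)) - L) < e"
        using LIMSEQ_D[OF L] by blast
      have "norm (mul_apply (t n) x - blinfun_apply L x) \<le> e * norm x" if "n \<ge> N" for n x
      proof -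
        have "norm (mul_apply (t n) x - blinfun_apply L x) \<le> norm (Blinfun (mul_apply (t n)) - L) * norm x"
          using norm_blinfun[of "Blinfun (mul_apply (t n)) - L" x] by (simp add: blinfun.diff_left ap)
        also have "\<dots> \<le> e * norm x" using N[OF that] by (intro mult_right_mono) simp_all
        finally show ?thesis .
      qed
      then show "\<exists>N. \<forall>n\<ge>N. \<forall>x. norm (mul_apply (t n) x - blinfun_apply L x) \<le> e * norm x" by blast
    qed
  qed
  \<comment> \<open>The adjoints converge as well, and their limit is the partner that makes the
    limit \<open>f\<close> of \<open>s\<close> a multiplier.\<close>
  have "Cauchy (\<lambda>n. star (s n))"
    using C ns unfolding Cauchy_iff by (meson le_less_trans)
  then obtain g where g: "\<And>x. (\<lambda>n. mul_apply (star (s n)) x) \<longlonglongrightarrow> g x" using lims by blast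
  obtain f where f: "\<And>x. (\<lambda>n. mul_apply (s n) x) \<longlonglongrightarrow> f x" "bounded_linear f"
    and e: "\<And>e. e > 0 \<Longrightarrow> \<exists>N. \<forall>n\<ge>N. \<forall>x. norm (mul_apply (s n) x - f x) \<le> e * norm x"
    using lims[OF C] by blast
  have "star (f x) * y = star x * g y" for x y
  proof (rule LIMSEQ_unique)
    show "(\<lambda>n. star (mul_apply (s n) x) * y) \<longlonglongrightarrow> star (f x) * y"
      by (intro tendsto_intros bounded_linear.tendsto[OF bounded_linear_star] f)
    show "(\<lambda>n. star (mul_apply (s n) x) * y) \<longlonglongrightarrow> star x * g y"
      unfolding star_mul_apply by (intro tendsto_intros g)
  qed
  then have "multiplier_pair f g" by (simp add: multiplier_pair_def)
  then have af: "mul_apply (Abs_multiplier f) = f" using f by (auto intro!: Abs_multiplier_inverse)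
  have "s \<longlonglongrightarrow> Abs_multiplier f"
  proof (rule LIMSEQ_I)
    fix r :: real assume r: "0 < r"
    then obtain N where N: "\<And>n x. n \<ge> N \<Longrightarrow> norm (mul_apply (s n) x - f x) \<le> r / 2 * norm x"
      using e[of "r / 2"] by auto
    have "norm (s n - Abs_multiplier f) \<le> r / 2" if "n \<ge> N" for n
      using N[OF that] r by (intro norm_mul_bound) (simp_all add: mul_apply_simps af)
    then show "\<exists>N. \<forall>n\<ge>N. norm (s n - Abs_multiplier f) < r"
      using r by (intro exI[of _ N]) force
  qed
  then show "convergent s" by (rule convergentI)
qed

end

section \<open>The algebra inside its multiplier algebra\<close>

lift_definition left_mult :: "'a::cstar_algebra \<Rightarrow> 'a multiplier" is "\<lambda>a x. a * x"
proof
  fix a :: 'a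
  show "bounded_linear ((*) a)" by (rule bounded_linear_mult_right)
  show "\<exists>g. multiplier_pair ((*) a) g"
    by (rule exI[of _ "(*) (star a)"]) (simp add: multiplier_pair_def star_mult mult.assoc)
qed

lemma mul_apply_left_mult: "mul_apply (left_mult a) x = a * x"
  by transfer simp

lemma left_mult_algebra:
  "left_mult 0 = 0"
  "left_mult (a + b) = left_mult a + left_mult b"
  "left_mult (a - b) = left_mult a - left_mult b"
  "left_mult (a * b) = left_mult a * left_mult b"
  "left_mult (r *\<^sub>R a) = r *\<^sub>R left_mult a"
  by (rule mul_eqI, simp add: mul_apply_left_mult mul_apply_simps algebra_simps)+

lemma left_mult_star: "left_mult (star a) = star (left_mult a)"
  by (rule star_multiplierI[symmetric]) (simp add: multiplier_pair_def mul_apply_left_mult star_mult mult.assoc)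

lemmas left_mult_simps = left_mult_algebra left_mult_star

text \<open>The element \<open>star a\<close> is a test vector at which left multiplication by
  \<open>a\<close> attains its norm.\<close>

lemma norm_left_mult: "norm (left_mult a) = norm a"
proof (rule antisym)
  show "norm (left_mult a) \<le> norm a"
    by (rule norm_mul_bound) (simp_all add: mul_apply_left_mult norm_mult_ineq)
  have "norm a * norm a = norm (mul_apply (left_mult a) (star a))"
    using cstar_identity[of "star a"] by (simp add: mul_apply_left_mult star_star norm_star power2_eq_square)
  also have "\<dots> \<le> norm (left_mult a) * norm a" using norm_mul_apply[of "left_mult a" "star a"] by (simp add: norm_star)
  finally show "norm a \<le> norm (left_mult a)" by (cases "a = 0") auto
qed

section \<open>Consequences for non-unital C*-algebras\<close>

lemma norm_mono_star_mult_self: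
  fixes a b :: "'a::cstar_algebra"
  assumes "star a * a + star b * b = c"
  shows "(norm a)\<^sup>2 \<le> norm c"
proof -
  have "norm (star (left_mult a) * left_mult a) \<le> norm (left_mult c)"
    by (rule norm_mono_pos)
      (simp_all add: assms[symmetric] left_mult_simps pos_star_mult_self)
  then show ?thesis by (simp add: cstar_identity norm_left_mult)
qed

lemma pos_left_mult: "cstar_pos g \<Longrightarrow> pos (left_mult g)"
  unfolding cstar_pos_def by (auto simp: left_mult_simps pos_star_mult_self)

text \<open>
  With \<open>g\<close>, \<open>a\<close> and \<open>c\<close> the inner products \<open>\<langle>x, x\<rangle>\<close>, \<open>\<langle>x, y\<rangle>\<close> and \<open>\<langle>y, y\<rangle>\<close>, the third
  hypothesis says that \<open>\<langle>y - t x a, y - t x a\<rangle>\<close> is positive for \<open>t = 1 / norm g\<close>.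
\<close>

lemma cauchy_schwarz_cstar:
  fixes a g c :: "'a::cstar_algebra"
  assumes g: "cstar_pos g" "g \<noteq> 0"
    and c: "cstar_pos (c - (2 / norm g) *\<^sub>R (star a * a) + (1 / (norm g)\<^sup>2) *\<^sub>R (star a * g * a))"
  shows "(norm a)\<^sup>2 \<le> norm g * norm c"
proof -
  define G where "G = norm g"
  have G: "G > 0" using g by (simp add: G_def)
  define A where "A = left_mult a"
  have pg: "pos (left_mult g)" by (rule pos_left_mult) fact
  then have "pos (G *\<^sub>R 1 - left_mult g)"
    by (intro pos_norm_minus pos_selfadjoint) (simp_all add: norm_left_mult G_def)
  then obtain k where k: "pos k" "k * k = G *\<^sub>R 1 - left_mult g" by (rule pos_sqrt) blast
  \<comment> \<open>This conjugates \<open>g \<le> G\<close> by \<open>a\<close>: the square root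
    \<open>k\<close> of \<open>G - g\<close> puts the conjugate into the form
    \<open>star b * b\<close>, whose positivity is known.\<close>
  have "pos (star (k * A) * (k * A))" by (rule pos_star_mult_self)
  also have "star (k * A) * (k * A) = star A * (k * k) * A"
    using pos_selfadjoint[OF k(1)] by (simp add: star_mult mult.assoc)
  also have "\<dots> = G *\<^sub>R (star A * A) - star A * left_mult g * A"
    by (simp add: k(2) algebra_simps)
  finally have "pos ((1 / G\<^sup>2) *\<^sub>R (G *\<^sub>R (star A * A) - star A * left_mult g * A))"
    by (rule pos_scaleR) simp
  moreover have "pos (left_mult c - (2 / G) *\<^sub>R (star A * A) + (1 / G\<^sup>2) *\<^sub>R (star A * left_mult g * A))"
    using pos_left_mult[OF c] by (simp add: left_mult_simps A_def G_def)
  ultimately have "pos ((1 / G\<^sup>2) *\<^sub>R (G *\<^sub>R (star A * A) - star A * left_mult g * A)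
      + (left_mult c - (2 / G) *\<^sub>R (star A * A) + (1 / G\<^sup>2) *\<^sub>R (star A * left_mult g * A)))"
    by (rule pos_add)
  also have "(1 / G\<^sup>2) *\<^sub>R (G *\<^sub>R (star A * A) - star A * left_mult g * A)
      + (left_mult c - (2 / G) *\<^sub>R (star A * A) + (1 / G\<^sup>2) *\<^sub>R (star A * left_mult g * A))
      = left_mult c - ((2 / G) *\<^sub>R (star A * A) - (1 / G) *\<^sub>R (star A * A))"
    using G by (simp add: scaleR_diff_right power2_eq_square)
  also have "(2 / G) *\<^sub>R (star A * A) - (1 / G) *\<^sub>R (star A * A) = (1 / G) *\<^sub>R (star A * A)"
    using G by (simp add: scaleR_left_diff_distrib[symmetric] diff_divide_distrib[symmetric])
  finally have "norm ((1 / G) *\<^sub>R (star A * A)) \<le> norm (left_mult c)"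
    using G by (intro norm_mono_pos pos_scaleR pos_star_mult_self) simp_all
  then show ?thesis using G
    by (simp add: cstar_identity norm_left_mult A_def G_def[symmetric] field_simps)
qed

section \<open>Contractivity and isometry of homomorphisms\<close>

locale star_hom =
  fixes \<pi> :: "'a::cstar_algebra \<Rightarrow> 'b::cstar_algebra"
  assumes add: "\<pi> (a + b) = \<pi> a + \<pi> b"
    and scaleC: "\<pi> (c *\<^sub>C a) = c *\<^sub>C \<pi> a"
    and mult: "\<pi> (a * b) = \<pi> a * \<pi> b"
    and star: "\<pi> (star a) = star (\<pi> a)"
begin

lemma scaleR: "\<pi> (r *\<^sub>R a) = r *\<^sub>R \<pi> a"
  by (simp add: scaleR_scaleC scaleC)

lemma minus: "\<pi> (- a) = - \<pi> a"
  using scaleR[of "-1" a] by simp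

lemma diff: "\<pi> (a - b) = \<pi> a - \<pi> b"
  using add[of a "- b"] by (simp add: minus)

lemma zero: "\<pi> 0 = 0"
  using scaleR[of 0 0] by simp

text \<open>The relation \<open>a * a + (1 - s) * (1 - s) = 1\<close> is equivalent to
  \<open>2 *\<^sub>R s = a * a + s * s\<close>, which mentions no unit and is therefore preserved by
  \<open>\<pi>\<close>. In the multipliers of the target it can be read in the first form again,
  where it bounds the image of \<open>a\<close>.\<close>

lemma norm_le_1_selfadjoint:
  assumes a: "star a = a" "norm a \<le> 1"
  shows "norm (\<pi> a) \<le> 1"
proof -
  have "norm (a * a) \<le> 1" using a by (simp add: norm_square_selfadjoint power_le_one)
  from ex_one_minus_sqrt[OF this] obtain s where
    s: "2 *\<^sub>R s = a * a + s * s" "star s = s" "s * a = a * s"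
    by (auto simp: star_mult a mult.assoc)
  define A S where "A = left_mult (\<pi> a)" and "S = left_mult (\<pi> s)"
  have "2 *\<^sub>R S = left_mult (\<pi> (2 *\<^sub>R s))" by (simp add: S_def left_mult_simps scaleR)
  also have "\<dots> = A * A + S * S" by (simp add: s(1) A_def S_def left_mult_simps add mult)
  finally have SS: "2 *\<^sub>R S = A * A + S * S" .
  have "S * A = left_mult (\<pi> (s * a))" by (simp add: A_def S_def left_mult_simps mult)
  then have SA: "S * A = A * S" by (simp add: s(3) A_def S_def left_mult_simps mult)
  have "star A = A" "star S = S" by (simp_all add: A_def S_def a s(2) left_mult_star[symmetric] star[symmetric])
  moreover have "A * A + (1 - S) * (1 - S) = 1"
    using SS by (simp add: algebra_simps scaleR_2)
  ultimately have "norm A \<le> 1"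
    by (intro norm_le_1_if_square_sum_1[of A "1 - S"]) (simp_all add: star_diff algebra_simps SA)
  then show ?thesis by (simp add: A_def norm_left_mult)
qed

lemma norm_le_selfadjoint:
  assumes a: "star a = a"
  shows "norm (\<pi> a) \<le> norm a"
proof (cases "a = 0")
  case False
  have "norm (\<pi> (inverse (norm a) *\<^sub>R a)) \<le> 1"
    using a False by (intro norm_le_1_selfadjoint) (simp_all add: star_scaleR)
  then show ?thesis using False by (simp add: scaleR field_simps)
qed (simp add: zero)

lemma norm_le: "norm (\<pi> a) \<le> norm a"
proof -
  have "(norm (\<pi> a))\<^sup>2 = norm (\<pi> (star a * a))" by (simp add: mult star cstar_identity)
  also have "\<dots> \<le> norm (star a * a)" by (intro norm_le_selfadjoint) (simp add: star_mult star_star)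
  also have "\<dots> = (norm a)\<^sup>2" by (rule cstar_identity)
  finally show ?thesis by (rule power2_le_imp_le) simp
qed

text \<open>
  The element \<open>s\<close> below is \<open>1 - \<bar>1 - 2 x\<bar>\<close> for \<open>x = b * b\<close>. Where the spectrum of \<open>\<pi> x\<close> lies in
  \<open>[0, 1/4]\<close>, this agrees with \<open>2 x\<close>, so injectivity forces \<open>s = 2 x\<close>.
\<close>

lemma norm_square_le_half:
  assumes inj: "inj \<pi>" and b: "star b = b" "norm b \<le> 1" and small: "norm (\<pi> (b * b)) \<le> 1/4"
  shows "norm (b * b) \<le> 1/2"
proof -
  define x where "x = b * b"
  define w where "w = 4 *\<^sub>R (x - x * x)"
  have x: "star x = x" by (simp add: x_def star_mult b)
  \<comment> \<open>Since \<open>1 - w\<close> is the square of \<open>1 - 2 x\<close>, the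
    quadratic equation that yields \<open>s\<close> from \<open>w\<close> is solved by
    \<open>2 x\<close> as well.\<close>
  have "norm w \<le> 1"
  proof -
    define B where "B = left_mult b"
    have B: "star B = B" "norm B \<le> 1" by (simp_all add: B_def left_mult_star[symmetric] b norm_left_mult)
    have "pos (B * B)" by (rule pos_square) fact
    moreover have "norm (B * B) \<le> 1" using B by (simp add: norm_square_selfadjoint power_le_one)
    ultimately have pc: "pos (1 - B * B)" using pos_norm_minus[of "B * B" 1] pos_selfadjoint[of "B * B"] by simp
    have w: "left_mult w = 4 *\<^sub>R (B * B * (1 - B * B))"
      by (simp add: w_def x_def B_def left_mult_simps algebra_simps)
    have "pos (left_mult w)"
      unfolding w by (intro pos_scaleR pos_mult \<open>pos (B * B)\<close> pc) (simp_all add: algebra_simps)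
    moreover have "pos (1 - left_mult w)"
    proof -
      have "1 - left_mult w = (1 - 2 *\<^sub>R (B * B)) * (1 - 2 *\<^sub>R (B * B))"
        by (simp add: w algebra_simps scaleR_2[symmetric])
      also have "pos \<dots>" by (rule pos_square) (simp add: star_diff star_scaleR star_mult B)
      finally show ?thesis .
    qed
    ultimately show ?thesis using norm_le_1_if_pos[of "left_mult w"] by (simp add: norm_left_mult)
  qed
  from ex_one_minus_sqrt[OF this] obtain s where s: "norm s \<le> 1" "2 *\<^sub>R s = w + s * s"
    "\<And>c. w * c = c * w \<Longrightarrow> s * c = c * s" by blast
  have sx: "s * x = x * s" by (rule s(3)) (simp add: w_def algebra_simps)
  define \<sigma> \<xi> where "\<sigma> = \<pi> s" and "\<xi> = 2 *\<^sub>R \<pi> x"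
  have n: "norm \<sigma> \<le> 1" "norm \<xi> \<le> 1/2"
    using norm_le[of s] s(1) small by (simp_all add: \<sigma>_def \<xi>_def x_def)
  have c: "\<sigma> * \<xi> = \<xi> * \<sigma>" using arg_cong[OF sx, of \<pi>] by (simp add: \<sigma>_def \<xi>_def mult)
  have e1: "2 *\<^sub>R \<sigma> - \<sigma> * \<sigma> = \<pi> w"
    using arg_cong[OF s(2), of \<pi>] by (simp add: \<sigma>_def add mult scaleR)
  have e2: "2 *\<^sub>R \<xi> - \<xi> * \<xi> = \<pi> w"
    by (simp add: \<xi>_def w_def diff mult scaleR scaleR_diff_right)
  \<comment> \<open>Both \<open>\<xi>\<close> and \<open>\<sigma>\<close> solve the same quadratic
    equation, and their sum has norm at most 3/2, which is less than 2; so their difference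
    vanishes.\<close>
  have "2 *\<^sub>R (\<xi> - \<sigma>) = (\<xi> - \<sigma>) * (\<xi> + \<sigma>)"
    using e1 e2 c by (simp add: algebra_simps)
  then have "2 * norm (\<xi> - \<sigma>) \<le> norm (\<xi> - \<sigma>) * norm (\<xi> + \<sigma>)"
    by (metis abs_numeral norm_mult_ineq norm_scaleR)
  also have "\<dots> \<le> norm (\<xi> - \<sigma>) * (3/2)"
    using norm_triangle_ineq[of \<xi> \<sigma>] n by (intro mult_left_mono) simp_all
  finally have "\<xi> = \<sigma>" by simp
  then have "\<pi> (2 *\<^sub>R x) = \<pi> s" by (simp add: \<xi>_def \<sigma>_def scaleR)
  then have "2 *\<^sub>R x = s" using inj by (simp add: inj_eq)
  then have "2 * norm x \<le> 1" using s(1) by auto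
  then show ?thesis by (simp add: x_def)
qed

text \<open>Under iterated squaring the norm of \<open>a\<close> stays 1, while that of
  \<open>\<pi> a\<close>, if it were below 1, would tend to 0. The preceding lemma excludes this
  gap.\<close>

lemma isometric_selfadjoint:
  assumes inj: "inj \<pi>" and a: "star a = a" "norm a = 1"
  shows "1 \<le> norm (\<pi> a)"
proof (rule ccontr)
  assume less: "\<not> ?thesis"
  define b where "b = rec_nat a (\<lambda>_ x. x * x)"
  have bS: "b (Suc n) = b n * b n" and b0: "b 0 = a" for n by (simp_all add: b_def)
  have b: "star (b n) = b n \<and> norm (b n) = 1" for n
    by (induction n) (simp_all add: bS b0 a star_mult norm_square_selfadjoint)
  have pb: "norm (\<pi> (b n)) = norm (\<pi> a) ^ (2 ^ n)" for n
    by (induction n) (simp_all add: b0 bS mult norm_square_selfadjoint star[symmetric] b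
        power_mult[symmetric] mult.commute)
  obtain m where m: "norm (\<pi> a) ^ m < 1/4"
    using real_arch_pow_inv[of "1/4" "norm (\<pi> a)"] less by auto
  \<comment> \<open>The successor makes the last iterate a square \<open>b m * b m\<close>, which is
    the form \<open>norm_square_le_half\<close> requires.\<close>
  have "m \<le> 2 ^ Suc m" using less_exp[of "Suc m"] by simp
  then have "norm (\<pi> a) ^ (2 ^ Suc m) \<le> norm (\<pi> a) ^ m" using less by (intro power_decreasing) simp_all
  then have "norm (\<pi> (b m * b m)) \<le> 1/4" using pb[of "Suc m"] m by (simp add: bS)
  then have "norm (b m * b m) \<le> 1/2" using b by (intro norm_square_le_half inj) simp_all
  then show False using b[of "Suc m"] by (simp add: bS)
qed

lemma norm_eq:
  assumes inj: "inj \<pi>"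
  shows "norm (\<pi> a) = norm a"
proof (cases "a = 0")
  case False
  define c where "c = inverse ((norm a)\<^sup>2) *\<^sub>R (star a * a)"
  have "1 \<le> norm (\<pi> c)"
    using False by (intro isometric_selfadjoint inj)
      (simp_all add: c_def star_scaleR star_mult star_star cstar_identity)
  then have "(norm a)\<^sup>2 \<le> (norm (\<pi> a))\<^sup>2"
    using False by (simp add: c_def scaleR mult star cstar_identity field_simps)
  then have "norm a \<le> norm (\<pi> a)" by (rule power2_le_imp_le) simp
  then show ?thesis using norm_le[of a] by simp
qed (simp add: zero)

end

section \<open>Hilbert modules\<close>

text \<open>Taking 2^k-th roots makes the constant \<open>K\<close> disappear. The exponent
  \<open>2 ^ k - 1\<close> is the one produced by the iterations below; for \<open>c = 0\<close> the
  case \<open>k = 1\<close> already decides.\<close>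

lemma le_if_iterated_square_le:
  fixes v c K :: real
  assumes v: "0 \<le> v" and c: "0 \<le> c" and le: "\<And>k. v ^ (2 ^ k) \<le> K * c ^ (2 ^ k - 1)"
  shows "v \<le> c"
proof (rule ccontr)
  assume less: "\<not> v \<le> c"
  show False
  proof (cases "c = 0")
    case True
    then show False using le[of 1] less by simp
  next
    case False
    then have c0: "c > 0" using c by simp
    have *: "(v / c) ^ (2 ^ k) \<le> K / c" for k
    proof -
      have "c ^ (2 ^ k) = c * c ^ (2 ^ k - 1)" by (metis power_eq_if power_not_zero zero_neq_numeral)
      then show ?thesis using le[of k] c0 by (simp add: power_divide field_simps)
    qed
    have gt: "v / c > 1" using less c0 by simp
    obtain m where m: "K / c < (v / c) ^ m" using real_arch_pow[OF gt] by blast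
    have "m \<le> 2 ^ m" using less_exp[of m] by simp
    then have "(v / c) ^ m \<le> (v / c) ^ (2 ^ m)" using gt by (intro power_increasing) simp_all
    then show False using * m by (meson leD order_trans)
  qed
qed

text \<open>A list of pairs stands for a formal element of an algebraic tensor product. One and the
  same list is evaluated under several maps \<open>g\<close>, and whether the values depend on the
  represented tensor alone is a separate question.\<close>

definition tensor_sum :: "('u \<Rightarrow> 'v \<Rightarrow> 'w::comm_monoid_add) \<Rightarrow> ('u \<times> 'v) list \<Rightarrow> 'w" where
  "tensor_sum g xs = (\<Sum>(x, y)\<leftarrow>xs. g x y)"

lemma tensor_sum_simps [simp]:
  "tensor_sum g [] = 0"
  "tensor_sum g (p # xs) = g (fst p) (snd p) + tensor_sum g xs"
  "tensor_sum g (xs @ ys) = tensor_sum g xs + tensor_sum g ys"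
  by (simp_all add: tensor_sum_def case_prod_unfold)

text \<open>The operator \<open>S \<otimes> I\<close> on formal tensors. It never changes the length
  of the list, on which the growth estimates depend.\<close>

definition map_left :: "('u \<Rightarrow> 'u) \<Rightarrow> ('u \<times> 'v) list \<Rightarrow> ('u \<times> 'v) list" where
  "map_left S = map (\<lambda>(x, y). (S x, y))"

lemma map_left_simps [simp]:
  "map_left S [] = []"
  "map_left S (p # xs) = (S (fst p), snd p) # map_left S xs"
  "map_left S (xs @ ys) = map_left S xs @ map_left S ys"
  "map_left S (map_left T xs) = map_left (S \<circ> T) xs"
  by (simp_all add: map_left_def case_prod_unfold)

text \<open>Scalar coefficients are absorbed into the left factor, so lists without coefficients
  exhaust the span.\<close>

lemma cspan_tensor_sum:
  fixes g :: "'u::complex_vector \<Rightarrow> 'v \<Rightarrow> 'w::complex_vector"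
  assumes A: "\<And>c x. x \<in> A \<Longrightarrow> c *\<^sub>C x \<in> A"
    and g: "\<And>c x y. x \<in> A \<Longrightarrow> y \<in> B \<Longrightarrow> g (c *\<^sub>C x) y = c *\<^sub>C g x y"
  shows "cspan {g x y | x y. x \<in> A \<and> y \<in> B} = {tensor_sum g xs | xs. set xs \<subseteq> A \<times> B}"
proof (intro equalityI subsetI)
  fix w assume "w \<in> cspan {g x y | x y. x \<in> A \<and> y \<in> B}"
  then show "w \<in> {tensor_sum g xs | xs. set xs \<subseteq> A \<times> B}"
  proof (induction rule: complex_vector.span_induct_alt)
    case base
    show ?case using tensor_sum_simps(1)[of g] by (metis (mono_tags, lifting) empty_set empty_subsetI mem_Collect_eq)
  next
    case (step c w w')
    then obtain x y xs where "w = g x y" "x \<in> A" "y \<in> B" "w' = tensor_sum g xs" "set xs \<subseteq> A \<times> B"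
      by blast
    then have "c *\<^sub>C w + w' = tensor_sum g ((c *\<^sub>C x, y) # xs)" "set ((c *\<^sub>C x, y) # xs) \<subseteq> A \<times> B"
      using A g by simp_all
    then show ?case by blast
  qed
next
  fix w assume "w \<in> {tensor_sum g xs | xs. set xs \<subseteq> A \<times> B}"
  then obtain xs where xs: "w = tensor_sum g xs" "set xs \<subseteq> A \<times> B" by blast
  have "tensor_sum g xs \<in> cspan {g x y | x y. x \<in> A \<and> y \<in> B}"
    using xs(2)
  proof (induction xs)
    case (Cons p xs)
    then have "fst p \<in> A" "snd p \<in> B" by auto
    then have "g (fst p) (snd p) \<in> {g x y | x y. x \<in> A \<and> y \<in> B}" by blast
    with Cons show ?case by (simp add: complex_vector.span_add complex_vector.span_base)
  qed (simp add: complex_vector.span_zero)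
  then show "w \<in> cspan {g x y | x y. x \<in> A \<and> y \<in> B}" by (simp add: xs)
qed

lemma finite_rank_eq:
  "finite_rank X = {\<lambda>z. tensor_sum (\<lambda>u v. theta X u v z) xs | xs. set xs \<subseteq> carrier X \<times> carrier X}"
proof (intro equalityI subsetI)
  fix F assume "F \<in> finite_rank X"
  then obtain n u v where F: "F = (\<lambda>z. \<Sum>i<(n::nat). theta X (u i) (v i) z)"
    "\<forall>i<n. u i \<in> carrier X \<and> v i \<in> carrier X" by (auto simp: finite_rank_def)
  have "F = (\<lambda>z. tensor_sum (\<lambda>u v. theta X u v z) (map (\<lambda>i. (u i, v i)) [0..<n]))"
    unfolding F(1) tensor_sum_def
    by (simp add: comp_def interv_sum_list_conv_sum_set_nat atLeast0LessThan)
  moreover have "set (map (\<lambda>i. (u i, v i)) [0..<n]) \<subseteq> carrier X \<times> carrier X" using F(2) by auto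
  ultimately show "F \<in> {\<lambda>z. tensor_sum (\<lambda>u v. theta X u v z) xs | xs. set xs \<subseteq> carrier X \<times> carrier X}"
    by blast
next
  fix F assume "F \<in> {\<lambda>z. tensor_sum (\<lambda>u v. theta X u v z) xs | xs. set xs \<subseteq> carrier X \<times> carrier X}"
  then obtain xs where F: "F = (\<lambda>z. tensor_sum (\<lambda>u v. theta X u v z) xs)"
    "set xs \<subseteq> carrier X \<times> carrier X" by blast
  have eq: "F = (\<lambda>z. \<Sum>i<length xs. theta X (fst (xs ! i)) (snd (xs ! i)) z)"
    unfolding F(1) tensor_sum_def by (simp add: sum_list_sum_nth atLeast0LessThan case_prod_unfold)
  have mem: "\<forall>i<length xs. fst (xs ! i) \<in> carrier X \<and> snd (xs ! i) \<in> carrier X"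
    using F(2) nth_mem by fastforce
  show "F \<in> finite_rank X"
    unfolding finite_rank_def mem_Collect_eq
    by (rule exI[of _ "length xs"], rule exI[of _ "\<lambda>i. fst (xs ! i)"],
        rule exI[of _ "\<lambda>i. snd (xs ! i)"], rule conjI[OF eq mem])
qed

section \<open>Inner product and norm of a Hilbert module\<close>

context hilbert_module
begin

abbreviation pairs :: "('x \<times> 'x) list \<Rightarrow> bool" where
  "pairs xs \<equiv> set xs \<subseteq> carrier X \<times> carrier X"

lemma zero_closed: "0 \<in> carrier X"
  by (rule complex_vector.subspace_0[OF subspace])

lemma add_closed: "x \<in> carrier X \<Longrightarrow> y \<in> carrier X \<Longrightarrow> x + y \<in> carrier X"
  by (rule complex_vector.subspace_add[OF subspace])

lemma scaleC_closed: "x \<in> carrier X \<Longrightarrow> c *\<^sub>C x \<in> carrier X"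
  by (rule complex_vector.subspace_scale[OF subspace])

lemma diff_closed: "x \<in> carrier X \<Longrightarrow> y \<in> carrier X \<Longrightarrow> x - y \<in> carrier X"
  by (rule complex_vector.subspace_diff[OF subspace])

lemma minus_closed: "x \<in> carrier X \<Longrightarrow> - x \<in> carrier X"
  by (rule complex_vector.subspace_neg[OF subspace])

lemma scaleR_closed: "x \<in> carrier X \<Longrightarrow> r *\<^sub>R x \<in> carrier X"
  by (simp add: scaleR_scaleC scaleC_closed)

lemma tensor_sum_closed:
  "(\<And>x y. (x, y) \<in> set xs \<Longrightarrow> g x y \<in> carrier X) \<Longrightarrow> tensor_sum g xs \<in> carrier X"
  by (induction xs) (auto intro!: zero_closed add_closed)

lemma inn_scaleR_right: "x \<in> carrier X \<Longrightarrow> y \<in> carrier X \<Longrightarrow> inn X x (r *\<^sub>R y) = r *\<^sub>R inn X x y"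
  by (simp add: scaleR_scaleC inn_scaleC_right)

lemma inn_add_left:
  "x \<in> carrier X \<Longrightarrow> y \<in> carrier X \<Longrightarrow> z \<in> carrier X \<Longrightarrow> inn X (x + y) z = inn X x z + inn X y z"
  using arg_cong[OF inn_add_right[of z x y], of star] by (simp add: add_closed inn_star star_add)

lemma inn_scaleC_left:
  "x \<in> carrier X \<Longrightarrow> y \<in> carrier X \<Longrightarrow> inn X (c *\<^sub>C x) y = cnj c *\<^sub>C inn X x y"
  using arg_cong[OF inn_scaleC_right[of y x c], of star] by (simp add: scaleC_closed inn_star star_scaleC)

lemma inn_scaleR_left: "x \<in> carrier X \<Longrightarrow> y \<in> carrier X \<Longrightarrow> inn X (r *\<^sub>R x) y = r *\<^sub>R inn X x y"
  by (simp add: scaleR_scaleC inn_scaleC_left)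

lemma inn_zero_right: "x \<in> carrier X \<Longrightarrow> inn X x 0 = 0"
  using inn_scaleR_right[of x 0 0] zero_closed by simp

lemma inn_zero_left: "x \<in> carrier X \<Longrightarrow> inn X 0 x = 0"
  using inn_scaleR_left[of 0 x 0] zero_closed by simp

lemma inn_minus_right: "x \<in> carrier X \<Longrightarrow> y \<in> carrier X \<Longrightarrow> inn X x (- y) = - inn X x y"
  using inn_scaleR_right[of x y "-1"] by simp

lemma inn_minus_left: "x \<in> carrier X \<Longrightarrow> y \<in> carrier X \<Longrightarrow> inn X (- x) y = - inn X x y"
  using inn_scaleR_left[of x y "-1"] by simp

lemma inn_diff_right:
  "x \<in> carrier X \<Longrightarrow> y \<in> carrier X \<Longrightarrow> z \<in> carrier X \<Longrightarrow> inn X x (y - z) = inn X x y - inn X x z"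
  using inn_add_right[of x y "- z"] by (simp add: minus_closed inn_minus_right)

lemma inn_diff_left:
  "x \<in> carrier X \<Longrightarrow> y \<in> carrier X \<Longrightarrow> z \<in> carrier X \<Longrightarrow> inn X (x - y) z = inn X x z - inn X y z"
  using inn_add_left[of x "- y" z] by (simp add: minus_closed inn_minus_left)

lemma inn_ract_left: "x \<in> carrier X \<Longrightarrow> y \<in> carrier X \<Longrightarrow> inn X (ract X x a) y = star a * inn X x y"
  using arg_cong[OF inn_ract_right[of y x a], of star] by (simp add: ract_closed inn_star star_mult)

lemmas inn_simps = inn_add_left inn_add_right inn_diff_left inn_diff_right inn_scaleR_left
  inn_scaleR_right inn_ract_left inn_ract_right inn_zero_left inn_zero_right inn_minus_left inn_minus_right
lemmas closed_simps = zero_closed add_closed diff_closed minus_closed scaleC_closed scaleR_closed ract_closed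

lemma mnorm_nonneg: "0 \<le> mnorm X x"
  by (simp add: mnorm_def)

lemma mnorm_square: "(mnorm X x)\<^sup>2 = norm (inn X x x)"
  by (simp add: mnorm_def)

lemma mnorm_zero: "mnorm X 0 = 0"
  by (simp add: mnorm_def inn_zero_left zero_closed)

lemma mnorm_eq_0: "x \<in> carrier X \<Longrightarrow> mnorm X x = 0 \<Longrightarrow> x = 0"
  using inn_definite by (simp add: mnorm_def)

lemma mnorm_scaleR: "x \<in> carrier X \<Longrightarrow> mnorm X (r *\<^sub>R x) = \<bar>r\<bar> * mnorm X x"
  by (simp add: mnorm_def inn_simps closed_simps real_sqrt_mult)

lemma mnorm_scaleC: "x \<in> carrier X \<Longrightarrow> mnorm X (c *\<^sub>C x) = cmod c * mnorm X x"
  by (simp add: mnorm_def inn_scaleC_left inn_scaleC_right closed_simps real_sqrt_mult norm_scaleC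
      norm_mult)

lemma mnorm_minus: "x \<in> carrier X \<Longrightarrow> mnorm X (- x) = mnorm X x"
  using mnorm_scaleR[of x "-1"] by simp

lemma mnorm_commute: "x \<in> carrier X \<Longrightarrow> y \<in> carrier X \<Longrightarrow> mnorm X (x - y) = mnorm X (y - x)"
  using mnorm_minus[of "x - y"] by (simp add: closed_simps)

lemma norm_inn_le:
  assumes x: "x \<in> carrier X" and y: "y \<in> carrier X"
  shows "norm (inn X x y) \<le> mnorm X x * mnorm X y"
proof (cases "inn X x x = 0")
  case True
  then have "x = 0" using x inn_definite by blast
  then show ?thesis by (simp add: inn_zero_left y mnorm_zero)
next
  case False
  define a where "a = inn X x y"
  have sa: "inn X y x = star a" by (simp add: a_def inn_star x y)
  \<comment> \<open>The projection of \<open>y\<close> onto the submodule generated by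
    \<open>x\<close> would divide by \<open>inn X x x\<close>, which need not be invertible; its
    norm takes its place.\<close>
  define t where "t = 1 / norm (inn X x x)"
  define z where "z = y - t *\<^sub>R ract X x a"
  have z: "z \<in> carrier X" by (simp add: z_def x y closed_simps)
  have "inn X z z = inn X y y - (t *\<^sub>R (star a * a) + t *\<^sub>R (star a * a)) + (t * t) *\<^sub>R (star a * inn X x x * a)"
    by (simp add: z_def x y closed_simps inn_simps sa a_def[symmetric] algebra_simps)
  also have "t *\<^sub>R (star a * a) + t *\<^sub>R (star a * a) = (2 * t) *\<^sub>R (star a * a)"
    by (simp add: scaleR_left_distrib[symmetric])
  finally have "inn X z z = inn X y y - (2 / norm (inn X x x)) *\<^sub>R (star a * a)
      + (1 / (norm (inn X x x))\<^sup>2) *\<^sub>R (star a * inn X x x * a)"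
    by (simp add: t_def power2_eq_square)
  with inn_pos[OF z] have "(norm a)\<^sup>2 \<le> norm (inn X x x) * norm (inn X y y)"
    by (intro cauchy_schwarz_cstar inn_pos x False) simp
  also have "\<dots> = (mnorm X x * mnorm X y)\<^sup>2" by (simp add: power_mult_distrib mnorm_square)
  finally have "norm a \<le> mnorm X x * mnorm X y" by (rule power2_le_imp_le) (simp add: mnorm_nonneg)
  then show ?thesis by (simp add: a_def)
qed

lemma mnorm_triangle:
  assumes x: "x \<in> carrier X" and y: "y \<in> carrier X"
  shows "mnorm X (x + y) \<le> mnorm X x + mnorm X y"
proof (rule power2_le_imp_le)
  have "(mnorm X (x + y))\<^sup>2 = norm (inn X x x + inn X y x + (inn X x y + inn X y y))"
    by (simp add: mnorm_square x y inn_simps closed_simps algebra_simps)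
  also have "\<dots> \<le> mnorm X x * mnorm X x + mnorm X y * mnorm X x + (mnorm X x * mnorm X y + mnorm X y * mnorm X y)"
    by (intro norm_triangle_le add_mono norm_inn_le x y)
  also have "\<dots> = (mnorm X x + mnorm X y)\<^sup>2" by (simp add: power2_eq_square algebra_simps)
  finally show "(mnorm X (x + y))\<^sup>2 \<le> (mnorm X x + mnorm X y)\<^sup>2" .
qed (simp add: mnorm_nonneg)

lemma mnorm_triangle_diff:
  assumes "x \<in> carrier X" "y \<in> carrier X" "z \<in> carrier X"
  shows "mnorm X (x - z) \<le> mnorm X (x - y) + mnorm X (y - z)"
  using mnorm_triangle[of "x - y" "y - z"] assms by (simp add: closed_simps)

lemma mnorm_ract_le: "x \<in> carrier X \<Longrightarrow> mnorm X (ract X x a) \<le> mnorm X x * norm a"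
proof (rule power2_le_imp_le)
  assume x: "x \<in> carrier X"
  have "(mnorm X (ract X x a))\<^sup>2 = norm (star a * (inn X x x * a))"
    by (simp add: mnorm_square x inn_simps closed_simps mult.assoc)
  also have "\<dots> \<le> norm a * (norm (inn X x x) * norm a)"
    by (rule order_trans[OF norm_mult_ineq]) (simp add: norm_star mult_left_mono norm_mult_ineq)
  also have "\<dots> = (mnorm X x * norm a)\<^sup>2"
    by (simp add: power_mult_distrib mnorm_square) (simp add: power2_eq_square)
  finally show "(mnorm X (ract X x a))\<^sup>2 \<le> (mnorm X x * norm a)\<^sup>2" .
qed (simp add: mnorm_nonneg)

lemma inn_eqI:
  assumes "x \<in> carrier X" "y \<in> carrier X" "\<And>z. z \<in> carrier X \<Longrightarrow> inn X x z = inn X y z"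
  shows "x = y"
proof -
  have "inn X (x - y) (x - y) = 0" using assms by (simp add: inn_diff_left closed_simps)
  then have "x - y = 0" using assms by (intro inn_definite) (simp_all add: closed_simps)
  then show ?thesis by simp
qed

lemma inn_eqI_right:
  assumes "x \<in> carrier X" "y \<in> carrier X" "\<And>z. z \<in> carrier X \<Longrightarrow> inn X z x = inn X z y"
  shows "x = y"
proof (rule inn_eqI[OF assms(1,2)])
  fix z assume z: "z \<in> carrier X"
  show "inn X x z = inn X y z"
    using arg_cong[OF assms(3)[OF z], of star] by (simp add: inn_star assms(1,2) z)
qed

text \<open>The carrier has no topology of its own, so convergence in a module is expressed
  throughout by \<open>mnorm\<close> of the difference.\<close>

lemma tendsto_inn:
  assumes s: "\<And>n. s n \<in> carrier X" "x \<in> carrier X" "(\<lambda>n. mnorm X (s n - x)) \<longlonglongrightarrow> 0"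
    and t: "\<And>n. t n \<in> carrier X" "y \<in> carrier X" "(\<lambda>n. mnorm X (t n - y)) \<longlonglongrightarrow> 0"
  shows "(\<lambda>n. inn X (s n) (t n)) \<longlonglongrightarrow> inn X x y"
proof -
  have le: "norm (inn X (s n) (t n) - inn X x y) \<le> mnorm X (s n - x) * mnorm X (t n - y)
      + (mnorm X (s n - x) * mnorm X y + mnorm X x * mnorm X (t n - y))" for n
  proof -
    have "inn X (s n) (t n) - inn X x y
        = inn X (s n - x) (t n - y) + (inn X (s n - x) y + inn X x (t n - y))"
      using s t by (simp add: inn_diff_left inn_diff_right closed_simps)
    also have "norm \<dots> \<le> mnorm X (s n - x) * mnorm X (t n - y)
        + (mnorm X (s n - x) * mnorm X y + mnorm X x * mnorm X (t n - y))"
      using s t by (intro norm_triangle_le add_mono norm_inn_le) (simp_all add: closed_simps)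
    finally show ?thesis .
  qed
  have "(\<lambda>n. mnorm X (s n - x) * mnorm X (t n - y)
      + (mnorm X (s n - x) * mnorm X y + mnorm X x * mnorm X (t n - y))) \<longlonglongrightarrow> 0 * 0 + (0 * mnorm X y + mnorm X x * 0)"
    by (intro tendsto_intros s t)
  then have "(\<lambda>n. mnorm X (s n - x) * mnorm X (t n - y)
      + (mnorm X (s n - x) * mnorm X y + mnorm X x * mnorm X (t n - y))) \<longlonglongrightarrow> 0" by simp
  then have "(\<lambda>n. inn X (s n) (t n) - inn X x y) \<longlonglongrightarrow> 0"
    by (rule Lim_null_comparison[OF always_eventually, rotated]) (use le in blast)
  then show ?thesis using LIM_zero_iff by blast
qed

lemma tendsto_mnorm:
  assumes s: "\<And>n. s n \<in> carrier X" "x \<in> carrier X" "(\<lambda>n. mnorm X (s n - x)) \<longlonglongrightarrow> 0"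
  shows "(\<lambda>n. mnorm X (s n)) \<longlonglongrightarrow> mnorm X x"
  unfolding mnorm_def by (intro tendsto_real_sqrt tendsto_norm tendsto_inn s)

lemma tendsto_diff:
  assumes s: "\<And>n. s n \<in> carrier X" "x \<in> carrier X" "(\<lambda>n. mnorm X (s n - x)) \<longlonglongrightarrow> 0"
    and t: "\<And>n. t n \<in> carrier X" "y \<in> carrier X" "(\<lambda>n. mnorm X (t n - y)) \<longlonglongrightarrow> 0"
  shows "(\<lambda>n. mnorm X ((s n - t n) - (x - y))) \<longlonglongrightarrow> 0"
proof (rule Lim_null_comparison[OF always_eventually])
  show "(\<lambda>n. mnorm X (s n - x) + mnorm X (t n - y)) \<longlonglongrightarrow> 0" using tendsto_add[OF s(3) t(3)] by simp
  show "\<forall>n. norm (mnorm X ((s n - t n) - (x - y))) \<le> mnorm X (s n - x) + mnorm X (t n - y)"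
  proof
    fix n
    have "mnorm X ((s n - t n) - (x - y)) = mnorm X ((s n - x) + - (t n - y))"
      by (simp add: algebra_simps)
    also have "\<dots> \<le> mnorm X (s n - x) + mnorm X (- (t n - y))"
      using s t by (intro mnorm_triangle closed_simps)
    also have "mnorm X (- (t n - y)) = mnorm X (t n - y)"
      using t by (intro mnorm_minus closed_simps)
    finally show "norm (mnorm X ((s n - t n) - (x - y))) \<le> mnorm X (s n - x) + mnorm X (t n - y)"
      by (simp add: mnorm_nonneg)
  qed
qed

text \<open>
  With \<open>a = \<langle>x, x\<rangle>\<close>, the iterates \<open>s n = x (1 - a) ^ n\<close> tend to zero, and \<open>x - s n\<close> is the sum of the
  \<open>s i a = \<theta> (s i) x x\<close> for \<open>i < n\<close>.
\<close>

lemma approx_finite_rank_unit: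
  assumes x: "x \<in> carrier X" "mnorm X x \<le> 1" and e: "0 < e"
  shows "\<exists>xs. pairs xs \<and> mnorm X (x - tensor_sum (\<lambda>u v. ract X u (inn X v x)) xs) < e"
proof -
  define a where "a = inn X x x"
  define A where "A = left_mult a"
  define s where "s = rec_nat x (\<lambda>_ y. y - ract X y a)"
  have s0: "s 0 = x" and sS: "\<And>n. s (Suc n) = s n - ract X (s n) a" by (simp_all add: s_def)
  have sc: "s n \<in> carrier X" for n by (induction n) (simp_all add: s0 sS x closed_simps)
  have sa: "star a = a" by (simp add: a_def inn_star x)
  have pA: "pos A" unfolding A_def a_def by (intro pos_left_mult inn_pos x)
  have "(mnorm X x)\<^sup>2 \<le> 1" using x(2) by (simp add: mnorm_nonneg power_le_one)
  then have nA: "norm A \<le> 1" by (simp add: A_def norm_left_mult mnorm_square[symmetric] a_def)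
  have c: "(1 - A) ^ n * A = A * (1 - A) ^ n" for n by (rule power_commuting_commutes) (simp add: algebra_simps)
  \<comment> \<open>Each step multiplies the vector by \<open>1 - a\<close> from the right and hence
    conjugates its inner square by the self-adjoint \<open>1 - A\<close>.\<close>
  have G: "left_mult (inn X (s n) (s n)) = (1 - A) ^ (2 * n) * A" for n
  proof (induction n)
    case (Suc n)
    have "left_mult (inn X (s (Suc n)) (s (Suc n))) = (1 - A) * (left_mult (inn X (s n) (s n)) * (1 - A))"
      by (simp add: sS sc inn_simps closed_simps sa A_def left_mult_simps algebra_simps)
    also have "\<dots> = (1 - A) ^ (2 * Suc n) * A"
      unfolding Suc by (simp add: algebra_simps c)
    finally show ?case .
  qed (simp add: s0 a_def[symmetric] A_def)
  \<comment> \<open>\<open>norm_power_mult_bound\<close> with exponent \<open>2 * n\<close> makes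
    the inner square of \<open>s n\<close> at most \<open>1 / n\<close>, so this \<open>n\<close>
    pushes the norm below \<open>e\<close>.\<close>
  obtain n where n: "1 / e\<^sup>2 < real n" using reals_Archimedean2 by blast
  have n0: "0 < real n" using n e by (smt (verit) divide_pos_pos zero_less_power)
  have "real n * (mnorm X (s n))\<^sup>2 \<le> real (2 * n) * norm ((1 - A) ^ (2 * n) * A)"
    by (simp add: mnorm_square G[symmetric] norm_left_mult mult_right_mono)
  also have "\<dots> \<le> 1" by (rule norm_power_mult_bound[OF pA nA])
  finally have "(mnorm X (s n))\<^sup>2 \<le> 1 / real n" using n0 by (simp add: field_simps)
  also have "\<dots> < e\<^sup>2" using n n0 e by (simp add: field_simps)
  finally have small: "mnorm X (s n) < e" using e by (simp add: power_less_imp_less_base)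
  have "\<exists>xs. pairs xs \<and> x - s n = tensor_sum (\<lambda>u v. ract X u (inn X v x)) xs" for n
  proof (induction n)
    case 0
    then show ?case by (intro exI[of _ "[]"]) (simp add: s0)
  next
    case (Suc n)
    then obtain xs where "pairs xs" "x - s n = tensor_sum (\<lambda>u v. ract X u (inn X v x)) xs"
      by blast
    then show ?case using sc[of n] x
      by (intro exI[of _ "(s n, x) # xs"]) (auto simp: sS a_def)
  qed
  then obtain xs where xs: "pairs xs"
    "x - s n = tensor_sum (\<lambda>u v. ract X u (inn X v x)) xs" by blast
  then have "x - tensor_sum (\<lambda>u v. ract X u (inn X v x)) xs = s n" by (simp add: algebra_simps)
  then show ?thesis using xs small by metis
qed

text \<open>This takes the place of an approximate unit of the compact operators. It reduces to the
  unit ball by scaling; the summand 1 in \<open>r\<close> keeps the scale positive for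
  \<open>x = 0\<close>.\<close>

lemma approx_finite_rank:
  assumes x: "x \<in> carrier X" and e: "0 < e"
  shows "\<exists>xs. pairs xs \<and> mnorm X (x - tensor_sum (\<lambda>u v. ract X u (inn X v x)) xs) < e"
proof -
  define r where "r = mnorm X x + 1"
  have r: "r > 0" "mnorm X x \<le> r" using mnorm_nonneg[of x] by (simp_all add: r_def)
  define y where "y = inverse r *\<^sub>R x"
  have y: "y \<in> carrier X" by (simp add: y_def x closed_simps)
  have yx: "x = r *\<^sub>R y" using r by (simp add: y_def)
  have "mnorm X y \<le> 1" using r by (simp add: y_def mnorm_scaleR x field_simps)
  then obtain xs where xs: "pairs xs"
    "mnorm X (y - tensor_sum (\<lambda>u v. ract X u (inn X v y)) xs) < e / r"
    using approx_finite_rank_unit[of y "e / r"] y e r by auto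
  let ?t = "tensor_sum (\<lambda>u v. ract X u (inn X v y)) xs"
  have t: "?t \<in> carrier X" using xs(1) by (intro tensor_sum_closed) (auto intro!: closed_simps)
  have "tensor_sum (\<lambda>u v. ract X u (inn X v x)) xs = r *\<^sub>R ?t"
    using xs(1)
  proof (induction xs)
    case (Cons p xs)
    then have "fst p \<in> carrier X" "snd p \<in> carrier X" by auto
    then have "ract X (fst p) (inn X (snd p) x) = r *\<^sub>R ract X (fst p) (inn X (snd p) y)"
      by (simp add: yx y scaleR_scaleC inn_scaleC_right ract_scaleC_right)
    with Cons show ?case by (simp add: scaleR_add_right)
  qed simp
  then have "x - tensor_sum (\<lambda>u v. ract X u (inn X v x)) xs = r *\<^sub>R (y - ?t)"
    by (simp add: yx scaleR_diff_right)
  then have "mnorm X (x - tensor_sum (\<lambda>u v. ract X u (inn X v x)) xs) = r * mnorm X (y - ?t)"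
    using r y t by (simp add: mnorm_scaleR closed_simps)
  also have "\<dots> < e" using r xs(2) by (simp add: field_simps)
  finally have "mnorm X (x - tensor_sum (\<lambda>u v. ract X u (inn X v x)) xs) < e" .
  then show ?thesis using xs by blast
qed

subsection \<open>Adjointable and compact operators\<close>

text \<open>The adjoint \<open>T\<close> may be given by a formula that does not vanish outside the
  carrier; it is cut off there.\<close>

lemma adjointableI:
  assumes "\<And>x. x \<in> carrier X \<Longrightarrow> S x \<in> carrier X" "\<And>x. x \<notin> carrier X \<Longrightarrow> S x = 0"
    "\<And>x. x \<in> carrier X \<Longrightarrow> T x \<in> carrier X"
    "\<And>x y. x \<in> carrier X \<Longrightarrow> y \<in> carrier X \<Longrightarrow> inn X (S x) y = inn X x (T y)"
  shows "S \<in> adjointable X"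
proof -
  have "(\<lambda>x. if x \<in> carrier X then T x else 0) \<in> module_maps X"
    "adjoint_pair X S (\<lambda>x. if x \<in> carrier X then T x else 0)" "S \<in> module_maps X"
    using assms by (auto simp: module_maps_def adjoint_pair_def)
  then show ?thesis by (auto simp: adjointable_def)
qed

lemma adjointableE:
  assumes "S \<in> adjointable X"
  obtains T where "\<And>x. x \<in> carrier X \<Longrightarrow> S x \<in> carrier X" "\<And>x. x \<notin> carrier X \<Longrightarrow> S x = 0"
    "\<And>x. x \<in> carrier X \<Longrightarrow> T x \<in> carrier X" "\<And>x. x \<notin> carrier X \<Longrightarrow> T x = 0"
    "\<And>x y. x \<in> carrier X \<Longrightarrow> y \<in> carrier X \<Longrightarrow> inn X (S x) y = inn X x (T y)"
    "\<And>x y. x \<in> carrier X \<Longrightarrow> y \<in> carrier X \<Longrightarrow> inn X (T x) y = inn X x (S y)"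
proof -
  obtain T where T: "S \<in> module_maps X" "T \<in> module_maps X" "adjoint_pair X S T"
    using assms by (auto simp: adjointable_def)
  have "inn X (T x) y = inn X x (S y)" if "x \<in> carrier X" "y \<in> carrier X" for x y
  proof -
    have "inn X (S y) x = inn X y (T x)" using T that by (simp add: adjoint_pair_def)
    then have "star (inn X (S y) x) = star (inn X y (T x))" by simp
    then show ?thesis using T that by (simp add: inn_star module_maps_def)
  qed
  then show thesis
    by (intro that[of T]) (use T in \<open>auto simp: module_maps_def adjoint_pair_def\<close>)
qed

lemma adjointable_closed: "S \<in> adjointable X \<Longrightarrow> x \<in> carrier X \<Longrightarrow> S x \<in> carrier X"
  by (auto simp: adjointable_def module_maps_def)

lemma adjointable_outside: "S \<in> adjointable X \<Longrightarrow> x \<notin> carrier X \<Longrightarrow> S x = 0"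
  by (auto simp: adjointable_def module_maps_def)

lemma adjointable_add:
  assumes S: "S \<in> adjointable X" and x: "x \<in> carrier X" "y \<in> carrier X"
  shows "S (x + y) = S x + S y"
proof -
  obtain T where T: "\<And>x. x \<in> carrier X \<Longrightarrow> T x \<in> carrier X"
    "\<And>x y. x \<in> carrier X \<Longrightarrow> y \<in> carrier X \<Longrightarrow> inn X (S x) y = inn X x (T y)"
    using adjointableE[OF S] by metis
  show ?thesis by (rule inn_eqI) (simp_all add: adjointable_closed[OF S] x closed_simps inn_add_left T)
qed

lemma adjointable_scaleC:
  assumes S: "S \<in> adjointable X" and x: "x \<in> carrier X"
  shows "S (c *\<^sub>C x) = c *\<^sub>C S x"
proof -
  obtain T where T: "\<And>x. x \<in> carrier X \<Longrightarrow> T x \<in> carrier X"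
    "\<And>x y. x \<in> carrier X \<Longrightarrow> y \<in> carrier X \<Longrightarrow> inn X (S x) y = inn X x (T y)"
    using adjointableE[OF S] by metis
  show ?thesis by (rule inn_eqI) (simp_all add: adjointable_closed[OF S] x closed_simps inn_scaleC_left T)
qed

lemma adjointable_minus: "S \<in> adjointable X \<Longrightarrow> x \<in> carrier X \<Longrightarrow> S (- x) = - S x"
  using adjointable_scaleC[of S x "-1"] by (simp add: complex_vector.scale_minus_left scaleC_one)

lemma adjointable_diff:
  "S \<in> adjointable X \<Longrightarrow> x \<in> carrier X \<Longrightarrow> y \<in> carrier X \<Longrightarrow> S (x - y) = S x - S y"
  using adjointable_add[of S x "- y"] by (simp add: adjointable_minus minus_closed)

lemma adjointable_plus:
  assumes "S \<in> adjointable X" "T \<in> adjointable X"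
  shows "(\<lambda>z. S z + T z) \<in> adjointable X"
proof -
  obtain S' where S': "\<And>x. x \<in> carrier X \<Longrightarrow> S' x \<in> carrier X"
    "\<And>x y. x \<in> carrier X \<Longrightarrow> y \<in> carrier X \<Longrightarrow> inn X (S x) y = inn X x (S' y)"
    using adjointableE[OF assms(1)] by metis
  obtain T' where T': "\<And>x. x \<in> carrier X \<Longrightarrow> T' x \<in> carrier X"
    "\<And>x y. x \<in> carrier X \<Longrightarrow> y \<in> carrier X \<Longrightarrow> inn X (T x) y = inn X x (T' y)"
    using adjointableE[OF assms(2)] by metis
  show ?thesis
    by (rule adjointableI[of _ "\<lambda>z. S' z + T' z"])
      (simp_all add: assms adjointable_closed adjointable_outside closed_simps S' T' inn_add_left inn_add_right)
qed

lemma adjointable_times_scaleC: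
  assumes "S \<in> adjointable X"
  shows "(\<lambda>z. c *\<^sub>C S z) \<in> adjointable X"
proof -
  obtain S' where S': "\<And>x. x \<in> carrier X \<Longrightarrow> S' x \<in> carrier X"
    "\<And>x y. x \<in> carrier X \<Longrightarrow> y \<in> carrier X \<Longrightarrow> inn X (S x) y = inn X x (S' y)"
    using adjointableE[OF assms(1)] by metis
  show ?thesis
    by (rule adjointableI[of _ "\<lambda>z. cnj c *\<^sub>C S' z"])
      (simp_all add: assms adjointable_closed adjointable_outside closed_simps S' inn_scaleC_left inn_scaleC_right
        complex_vector.scale_zero_right)
qed

lemma op_le_adjoint:
  assumes S: "\<And>x. x \<in> carrier X \<Longrightarrow> S x \<in> carrier X" and T: "\<And>x. x \<in> carrier X \<Longrightarrow> T x \<in> carrier X"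
    and ST: "\<And>x y. x \<in> carrier X \<Longrightarrow> y \<in> carrier X \<Longrightarrow> inn X (S x) y = inn X x (T y)"
    and le: "op_le X S c"
  shows "op_le X T c"
  unfolding op_le_def
proof (intro conjI ballI)
  show c: "0 \<le> c" using le by (simp add: op_le_def)
  fix x assume x: "x \<in> carrier X"
  have "(mnorm X (T x))\<^sup>2 = norm (inn X (S (T x)) x)"
    by (simp add: mnorm_square ST T x)
  also have "\<dots> \<le> mnorm X (S (T x)) * mnorm X x" by (intro norm_inn_le S T x)
  also have "\<dots> \<le> (c * mnorm X (T x)) * mnorm X x"
    using le T x by (intro mult_right_mono) (simp_all add: op_le_def mnorm_nonneg)
  finally have "mnorm X (T x) * mnorm X (T x) \<le> (c * mnorm X x) * mnorm X (T x)"
    by (simp add: power2_eq_square mult_ac)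
  then show "mnorm X (T x) \<le> c * mnorm X x"
    by (cases "mnorm X (T x) = 0") (use mnorm_nonneg[of x] mnorm_nonneg[of "T x"] c in auto)
qed

lemma theta_apply: "z \<in> carrier X \<Longrightarrow> theta X x y z = ract X x (inn X y z)"
  by (simp add: theta_def)

lemma theta_adjointable:
  assumes "x \<in> carrier X" "y \<in> carrier X"
  shows "theta X x y \<in> adjointable X"
  by (rule adjointableI[of _ "theta X y x"])
    (use assms in \<open>auto simp: theta_def closed_simps inn_simps inn_star\<close>)

lemma theta_inn:
  "x \<in> carrier X \<Longrightarrow> y \<in> carrier X \<Longrightarrow> z \<in> carrier X \<Longrightarrow> w \<in> carrier X \<Longrightarrow>
    inn X (theta X x y z) w = inn X z (theta X y x w)"
  by (simp add: theta_def closed_simps inn_simps inn_star)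

lemma theta_closed: "x \<in> carrier X \<Longrightarrow> theta X x y z \<in> carrier X"
  by (simp add: theta_def closed_simps)

lemma op_le_theta:
  assumes "x \<in> carrier X" "y \<in> carrier X"
  shows "op_le X (theta X x y) (mnorm X x * mnorm X y)"
  unfolding op_le_def
proof (intro conjI ballI)
  fix z assume z: "z \<in> carrier X"
  have "mnorm X (theta X x y z) \<le> mnorm X x * norm (inn X y z)"
    by (simp add: theta_apply z mnorm_ract_le assms)
  also have "\<dots> \<le> mnorm X x * (mnorm X y * mnorm X z)"
    by (intro mult_left_mono norm_inn_le assms z mnorm_nonneg)
  finally show "mnorm X (theta X x y z) \<le> mnorm X x * mnorm X y * mnorm X z" by (simp add: mult.assoc)
qed (simp add: mnorm_nonneg)

lemma op_le_add:
  assumes "op_le X S c" "op_le X T d" "\<And>x. x \<in> carrier X \<Longrightarrow> S x \<in> carrier X"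
    "\<And>x. x \<in> carrier X \<Longrightarrow> T x \<in> carrier X"
  shows "op_le X (\<lambda>z. S z + T z) (c + d)"
  unfolding op_le_def
proof (intro conjI ballI)
  show "0 \<le> c + d" using assms by (simp add: op_le_def)
  fix x assume x: "x \<in> carrier X"
  have "mnorm X (S x + T x) \<le> mnorm X (S x) + mnorm X (T x)" by (intro mnorm_triangle assms x)
  also have "\<dots> \<le> c * mnorm X x + d * mnorm X x" using assms x by (intro add_mono) (simp_all add: op_le_def)
  finally show "mnorm X (S x + T x) \<le> (c + d) * mnorm X x" by (simp add: algebra_simps)
qed

lemma op_le_scaleC:
  assumes "op_le X S d" "\<And>x. x \<in> carrier X \<Longrightarrow> S x \<in> carrier X"
  shows "op_le X (\<lambda>z. c *\<^sub>C S z) (cmod c * d)"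
  using assms by (simp add: op_le_def mnorm_scaleC mult.assoc mult_left_mono)

text \<open>The list is kept as a name for the operator because a representation will evaluate the
  same list; that the result depends on the operator alone is shown later by a norm
  estimate.\<close>

definition theta_sum :: "('x \<times> 'x) list \<Rightarrow> 'x \<Rightarrow> 'x" where
  "theta_sum xs = (\<lambda>z. tensor_sum (\<lambda>u v. theta X u v z) xs)"

lemma theta_sum_simps [simp]:
  "theta_sum [] = (\<lambda>z. 0)"
  "theta_sum (p # xs) = (\<lambda>z. theta X (fst p) (snd p) z + theta_sum xs z)"
  "theta_sum (xs @ ys) = (\<lambda>z. theta_sum xs z + theta_sum ys z)"
  by (simp_all add: theta_sum_def)

lemma finite_rank_theta_sum: "finite_rank X = {theta_sum xs | xs. pairs xs}"
  by (simp add: finite_rank_eq theta_sum_def)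

lemma zero_adjointable: "(\<lambda>z. 0) \<in> adjointable X"
  by (rule adjointableI[of _ "\<lambda>z. 0"]) (simp_all add: closed_simps inn_simps)

lemma theta_sum_adjointable: "pairs xs \<Longrightarrow> theta_sum xs \<in> adjointable X"
proof (induction xs)
  case (Cons p xs)
  then show ?case by (simp add: adjointable_plus theta_adjointable mem_Times_iff)
qed (simp add: zero_adjointable)

lemma theta_sum_closed: "pairs xs \<Longrightarrow> z \<in> carrier X \<Longrightarrow> theta_sum xs z \<in> carrier X"
  by (rule adjointable_closed[OF theta_sum_adjointable])

lemma theta_sum_inn:
  "pairs xs \<Longrightarrow> z \<in> carrier X \<Longrightarrow> w \<in> carrier X \<Longrightarrow>
    inn X (theta_sum xs z) w = inn X z (theta_sum (map prod.swap xs) w)"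
proof (induction xs)
  case (Cons p xs)
  have "pairs (map prod.swap xs)" using Cons by auto
  with Cons show ?case
    by (simp add: mem_Times_iff inn_add_left inn_add_right theta_closed theta_sum_closed theta_inn)
qed (simp add: inn_simps)

lemma op_le_theta_sum:
  "pairs xs \<Longrightarrow> \<exists>c. op_le X (theta_sum xs) c"
proof (induction xs)
  case Nil
  then show ?case by (intro exI[of _ 0]) (simp add: op_le_def mnorm_zero)
next
  case (Cons p xs)
  then have p: "fst p \<in> carrier X" "snd p \<in> carrier X" and xs: "pairs xs" by auto
  from Cons.IH[OF xs] obtain c where "op_le X (theta_sum xs) c" by blast
  then have "op_le X (\<lambda>z. theta X (fst p) (snd p) z + theta_sum xs z) (mnorm X (fst p) * mnorm X (snd p) + c)"
    by (intro op_le_add op_le_theta p theta_closed theta_sum_closed xs) simp_all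
  then show ?case by auto
qed

lemma compacts_adjointable: "S \<in> compacts X \<Longrightarrow> S \<in> adjointable X"
  by (simp add: compacts_def)

lemma compacts_closed: "S \<in> compacts X \<Longrightarrow> x \<in> carrier X \<Longrightarrow> S x \<in> carrier X"
  by (simp add: compacts_adjointable adjointable_closed)

lemma compacts_approx:
  assumes "S \<in> compacts X" "0 < e"
  obtains xs where "pairs xs" "op_le X (\<lambda>z. S z - theta_sum xs z) e"
  using assms unfolding compacts_def finite_rank_theta_sum by blast

lemma compactsI:
  assumes "S \<in> adjointable X"
    "\<And>e. 0 < e \<Longrightarrow> \<exists>xs. pairs xs \<and> op_le X (\<lambda>z. S z - theta_sum xs z) e"
  shows "S \<in> compacts X"
  using assms unfolding compacts_def finite_rank_theta_sum by blast

lemma theta_sum_compact: "pairs xs \<Longrightarrow> theta_sum xs \<in> compacts X"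
  by (rule compactsI)
    (auto intro!: theta_sum_adjointable exI[of _ xs] simp: op_le_def mnorm_zero mnorm_nonneg)

lemma theta_compact: "x \<in> carrier X \<Longrightarrow> y \<in> carrier X \<Longrightarrow> theta X x y \<in> compacts X"
  using theta_sum_compact[of "[(x, y)]"] by simp

lemma op_le_compact:
  assumes S: "S \<in> compacts X"
  shows "\<exists>c. op_le X S c"
proof -
  obtain xs where xs: "pairs xs" "op_le X (\<lambda>z. S z - theta_sum xs z) 1"
    by (rule compacts_approx[OF S, of 1]) simp_all
  obtain c where "op_le X (theta_sum xs) c" using op_le_theta_sum[OF xs(1)] by blast
  then have "op_le X (\<lambda>z. (S z - theta_sum xs z) + theta_sum xs z) (1 + c)"
    using xs S by (intro op_le_add) (simp_all add: diff_closed compacts_closed theta_sum_closed)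
  then show ?thesis by auto
qed

lemma compacts_plus:
  assumes S: "S \<in> compacts X" and T: "T \<in> compacts X"
  shows "(\<lambda>z. S z + T z) \<in> compacts X"
proof (rule compactsI)
  show "(\<lambda>z. S z + T z) \<in> adjointable X" by (intro adjointable_plus compacts_adjointable S T)
  fix e :: real assume e: "0 < e"
  obtain xs where xs: "pairs xs" "op_le X (\<lambda>z. S z - theta_sum xs z) (e / 2)"
    by (rule compacts_approx[OF S, of "e / 2"]) (use e in simp_all)
  obtain ys where ys: "pairs ys" "op_le X (\<lambda>z. T z - theta_sum ys z) (e / 2)"
    by (rule compacts_approx[OF T, of "e / 2"]) (use e in simp_all)
  have "op_le X (\<lambda>z. (S z - theta_sum xs z) + (T z - theta_sum ys z)) (e / 2 + e / 2)"
    using xs ys S T by (intro op_le_add) (simp_all add: diff_closed compacts_closed theta_sum_closed)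
  then have "op_le X (\<lambda>z. S z + T z - theta_sum (xs @ ys) z) e" by (simp add: algebra_simps)
  then show "\<exists>zs. pairs zs \<and> op_le X (\<lambda>z. S z + T z - theta_sum zs z) e"
    using xs ys by (intro exI[of _ "xs @ ys"]) simp
qed

lemma theta_sum_map_left_scaleC:
  "pairs xs \<Longrightarrow> theta_sum (map_left ((*\<^sub>C) c) xs) = (\<lambda>z. c *\<^sub>C theta_sum xs z)"
  by (induction xs)
    (auto simp: fun_eq_iff theta_def ract_scaleC_left scaleC_add_right complex_vector.scale_zero_right)

lemma map_left_closed:
  "set xs \<subseteq> A \<times> B \<Longrightarrow> (\<And>x. x \<in> A \<Longrightarrow> S x \<in> A') \<Longrightarrow> set (map_left S xs) \<subseteq> A' \<times> B"
  by (auto simp: map_left_def)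

lemma compacts_scaleC:
  assumes S: "S \<in> compacts X"
  shows "(\<lambda>z. c *\<^sub>C S z) \<in> compacts X"
proof (rule compactsI)
  show "(\<lambda>z. c *\<^sub>C S z) \<in> adjointable X" by (intro adjointable_times_scaleC compacts_adjointable S)
  fix e :: real assume e: "0 < e"
  define d where "d = e / (cmod c + 1)"
  have c1: "cmod c + 1 > 0" using norm_ge_zero[of c] by linarith
  have d: "0 < d" "cmod c * d \<le> e" using e c1 by (simp_all add: d_def field_simps)
  obtain xs where xs: "pairs xs" "op_le X (\<lambda>z. S z - theta_sum xs z) d"
    by (rule compacts_approx[OF S d(1)])
  have "op_le X (\<lambda>z. c *\<^sub>C (S z - theta_sum xs z)) (cmod c * d)"
    using xs S by (intro op_le_scaleC) (simp_all add: diff_closed compacts_closed theta_sum_closed)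
  then have "op_le X (\<lambda>z. c *\<^sub>C S z - c *\<^sub>C theta_sum xs z) e"
    using d mnorm_nonneg unfolding op_le_def complex_vector.scale_right_diff_distrib
    by (meson less_imp_le mult_right_mono order_trans e)
  then show "\<exists>zs. pairs zs \<and> op_le X (\<lambda>z. c *\<^sub>C S z - theta_sum zs z) e"
    using xs by (intro exI[of _ "map_left ((*\<^sub>C) c) xs"])
      (simp add: theta_sum_map_left_scaleC map_left_closed[OF xs(1)] scaleC_closed)
qed

end

section \<open>Correspondences and interior tensor products\<close>

context correspondence
begin

lemma lact_scaleR: "x \<in> carrier X \<Longrightarrow> lact X (r *\<^sub>R a) x = r *\<^sub>R lact X a x"
  by (simp add: scaleR_scaleC lact_scaleC)

text \<open>The equation for \<open>s\<close> is the unit-free form of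
  \<open>c * c + (1 - s) * (1 - s) = 1\<close>. Applied to \<open>x\<close>, it splits
  \<open>inn X x x\<close> into the inner squares of \<open>lact X c x\<close> and
  \<open>x - lact X s x\<close>, both positive.\<close>

lemma mnorm_lact_selfadjoint:
  assumes c: "star c = c" "norm c \<le> 1" and x: "x \<in> carrier X"
  shows "mnorm X (lact X c x) \<le> mnorm X x"
proof -
  have "norm (c * c) \<le> 1" using c by (simp add: norm_square_selfadjoint power_le_one)
  from ex_one_minus_sqrt[OF this] obtain s where s: "2 *\<^sub>R s = c * c + s * s" "star s = s"
    by (auto simp: star_mult c)
  define u v where "u = lact X c x" and "v = x - lact X s x"
  have uv: "u \<in> carrier X" "v \<in> carrier X" by (simp_all add: u_def v_def x closed_simps lact_closed)
  have "inn X x (lact X s x) + inn X x (lact X s x) = inn X x (lact X (2 *\<^sub>R s) x)"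
    by (simp add: x lact_closed lact_add inn_add_right scaleR_2)
  also have "\<dots> = inn X u u + inn X (lact X s x) (lact X s x)"
    unfolding s(1) u_def by (simp add: x lact_closed lact_add lact_mult inn_add_right lact_star c s(2))
  finally have "inn X u u + inn X v v = inn X x x"
    unfolding v_def by (simp add: x lact_closed closed_simps inn_simps lact_star s(2) algebra_simps)
  moreover obtain d e where "inn X u u = star d * d" "inn X v v = star e * e"
    using inn_pos[OF uv(1)] inn_pos[OF uv(2)] by (auto simp: cstar_pos_def)
  ultimately have "norm (inn X u u) \<le> norm (inn X x x)"
    using norm_mono_star_mult_self[of d e "inn X x x"] by (simp add: cstar_identity)
  then show ?thesis by (simp add: mnorm_def u_def)
qed

text \<open>The self-adjoint case applies to \<open>star a * a\<close> scaled to norm one, and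
  \<open>star a * a\<close> controls \<open>a\<close> by the Cauchy-Schwarz inequality.\<close>

lemma mnorm_lact_le:
  assumes x: "x \<in> carrier X"
  shows "mnorm X (lact X a x) \<le> norm a * mnorm X x"
proof (cases "a = 0")
  case True
  have "lact X 0 x = 0" using lact_scaleR[OF x, of 0 0] by simp
  then show ?thesis using True by (simp add: mnorm_zero)
next
  case False
  define c where "c = inverse ((norm a)\<^sup>2) *\<^sub>R (star a * a)"
  have "mnorm X (lact X c x) \<le> mnorm X x"
    using False by (intro mnorm_lact_selfadjoint x)
      (simp_all add: c_def star_scaleR star_mult star_star cstar_identity)
  moreover have "lact X (star a * a) x = (norm a)\<^sup>2 *\<^sub>R lact X c x"
    using False by (simp add: c_def lact_scaleR x)
  ultimately have le: "mnorm X (lact X (star a * a) x) \<le> (norm a)\<^sup>2 * mnorm X x"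
    by (simp add: mnorm_scaleR x lact_closed mult_left_mono)
  have "(mnorm X (lact X a x))\<^sup>2 = norm (inn X x (lact X (star a * a) x))"
    by (simp add: mnorm_square x lact_closed lact_star lact_mult)
  also have "\<dots> \<le> mnorm X x * mnorm X (lact X (star a * a) x)"
    by (intro norm_inn_le x lact_closed)
  also have "\<dots> \<le> mnorm X x * ((norm a)\<^sup>2 * mnorm X x)" by (intro mult_left_mono le mnorm_nonneg)
  also have "\<dots> = (norm a * mnorm X x)\<^sup>2" by (simp add: power2_eq_square mult_ac)
  finally show ?thesis by (rule power2_le_imp_le) (simp add: mnorm_nonneg)
qed

end

section \<open>Interior tensor products and the operators S \<otimes> I\<close>

context interior_tensor
begin

abbreviation tens :: "('x \<times> 'x) list \<Rightarrow> 'x" where "tens \<equiv> tensor_sum m"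

abbreviation factors :: "('x \<times> 'x) list \<Rightarrow> bool" where
  "factors xs \<equiv> set xs \<subseteq> carrier X \<times> carrier Y"

lemma mnorm_m_le:
  assumes x: "x \<in> carrier X" and y: "y \<in> carrier Y"
  shows "mnorm Z (m x y) \<le> mnorm X x * mnorm Y y"
proof (rule power2_le_imp_le)
  have "(mnorm Z (m x y))\<^sup>2 = norm (inn Y y (lact Y (inn X x x) y))"
    by (simp add: Z.mnorm_square inner x y)
  also have "\<dots> \<le> mnorm Y y * mnorm Y (lact Y (inn X x x) y)"
    by (intro Y.norm_inn_le y Y.lact_closed)
  also have "\<dots> \<le> mnorm Y y * (norm (inn X x x) * mnorm Y y)"
    by (intro mult_left_mono Y.mnorm_lact_le y Y.mnorm_nonneg)
  also have "\<dots> = (mnorm X x * mnorm Y y)\<^sup>2"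
    by (simp add: X.mnorm_square power_mult_distrib) (simp add: power2_eq_square)
  finally show "(mnorm Z (m x y))\<^sup>2 \<le> (mnorm X x * mnorm Y y)\<^sup>2" .
qed (simp add: X.mnorm_nonneg Y.mnorm_nonneg)

lemma tens_closed: "factors xs \<Longrightarrow> tens xs \<in> carrier Z"
  by (rule Z.tensor_sum_closed) (auto intro: closed)

lemma tens_map_left_closed:
  "factors xs \<Longrightarrow> (\<And>x. x \<in> carrier X \<Longrightarrow> S x \<in> carrier X) \<Longrightarrow>
    tens (map_left S xs) \<in> carrier Z"
  by (intro tens_closed X.map_left_closed)

text \<open>Adjointness at the level of lists, available before \<open>S \<otimes> I\<close> is
  known to depend on the represented vector alone.\<close>

lemma inn_tens_map_left:
  assumes S: "\<And>x. x \<in> carrier X \<Longrightarrow> S x \<in> carrier X" and T: "\<And>x. x \<in> carrier X \<Longrightarrow> T x \<in> carrier X"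
    and ST: "\<And>x y. x \<in> carrier X \<Longrightarrow> y \<in> carrier X \<Longrightarrow> inn X (S x) y = inn X x (T y)"
    and xs: "factors xs" and ys: "factors ys"
  shows "inn Z (tens (map_left S xs)) (tens ys) = inn Z (tens xs) (tens (map_left T ys))"
proof -
  have one: "inn Z (m (S x) y) (tens ys) = inn Z (m x y) (tens (map_left T ys))"
    if xy: "x \<in> carrier X" "y \<in> carrier Y" for x y
    using ys
  proof (induction ys)
    case Nil
    then show ?case by (simp add: Z.inn_zero_right closed S xy)
  next
    case (Cons p ys)
    then have p: "fst p \<in> carrier X" "snd p \<in> carrier Y" and ys: "factors ys" by auto
    have "tens ys \<in> carrier Z" "tens (map_left T ys) \<in> carrier Z"
      by (intro tens_closed tens_map_left_closed ys T; assumption)+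
    then show ?case using Cons.IH[OF ys] p xy
      by (simp add: Z.inn_add_right closed S T inner ST)
  qed
  show ?thesis
    using xs
  proof (induction xs)
    case Nil
    have "tens ys \<in> carrier Z" "tens (map_left T ys) \<in> carrier Z"
      by (intro tens_closed tens_map_left_closed ys T; assumption)+
    then show ?case by (simp add: Z.inn_zero_left)
  next
    case (Cons p xs)
    then have p: "fst p \<in> carrier X" "snd p \<in> carrier Y" and xs: "factors xs" by auto
    have "tens xs \<in> carrier Z" "tens (map_left S xs) \<in> carrier Z"
      "tens ys \<in> carrier Z" "tens (map_left T ys) \<in> carrier Z"
      by (intro tens_closed tens_map_left_closed xs ys S T; assumption)+
    then show ?case using Cons.IH[OF xs] p one by (simp add: Z.inn_add_left closed S)
  qed
qed

text \<open>
  Positivity of the matrix \<open>c\<^sup>2 \<langle>x i, x j\<rangle> - \<langle>S (x i), S (x j)\<rangle>\<close> is avoided: for \<open>N = T S\<close> and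
  \<open>v n = \<parallel>\<Sum> N\<^sup>n (x i) \<otimes> y i\<parallel>\<close>, iterating \<open>(v n)\<^sup>2 \<le> v 0 * v (2 n)\<close> bounds \<open>v 1\<close> by the growth rate of \<open>v\<close>.
\<close>

lemma mnorm_tens_map_left:
  assumes S: "\<And>x. x \<in> carrier X \<Longrightarrow> S x \<in> carrier X" and T: "\<And>x. x \<in> carrier X \<Longrightarrow> T x \<in> carrier X"
    and ST: "\<And>x y. x \<in> carrier X \<Longrightarrow> y \<in> carrier X \<Longrightarrow> inn X (S x) y = inn X x (T y)"
    and c: "op_le X S c"
    and xs: "factors xs"
  shows "mnorm Z (tens (map_left S xs)) \<le> c * mnorm Z (tens xs)"
proof -
  have c0: "0 \<le> c" using c by (simp add: op_le_def)
  have cT: "op_le X T c" by (rule X.op_le_adjoint[OF S T ST c])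
  have TS: "inn X (T x) y = inn X x (S y)" if "x \<in> carrier X" "y \<in> carrier X" for x y
    using arg_cong[OF ST[of y x], of star] that by (simp add: X.inn_star S T)
  define N where "N = T \<circ> S"
  have Nc: "(N ^^ n) x \<in> carrier X" if "x \<in> carrier X" for n x
    by (induction n) (simp_all add: N_def S T that)
  have NN: "inn X ((N ^^ n) x) y = inn X x ((N ^^ n) y)" if "x \<in> carrier X" "y \<in> carrier X" for n x y
    using that
  proof (induction n arbitrary: y)
    case (Suc n)
    have "inn X ((N ^^ Suc n) x) y = inn X ((N ^^ n) x) (N y)"
      using Suc Nc[of x n] by (simp add: N_def ST TS S T)
    also have "\<dots> = inn X x ((N ^^ n) (N y))" using Suc Nc[of y 1] by simp
    finally show ?case by (simp add: funpow_swap1)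
  qed simp
  have Nb: "mnorm X ((N ^^ n) x) \<le> (c\<^sup>2) ^ n * mnorm X x" if "x \<in> carrier X" for n x
  proof (induction n)
    case (Suc n)
    have "mnorm X (N ((N ^^ n) x)) \<le> c * (c * mnorm X ((N ^^ n) x))"
    proof -
      define z where "z = (N ^^ n) x"
      have z: "z \<in> carrier X" by (simp add: z_def Nc that)
      have "mnorm X (T (S z)) \<le> c * mnorm X (S z)" using cT S[OF z] by (simp add: op_le_def)
      also have "\<dots> \<le> c * (c * mnorm X z)" using c z by (intro mult_left_mono) (simp_all add: op_le_def)
      finally show ?thesis by (simp add: N_def z_def)
    qed
    also have "\<dots> \<le> c * (c * ((c\<^sup>2) ^ n * mnorm X x))" using Suc c0 by (intro mult_left_mono)
    finally show ?case by (simp add: power2_eq_square mult_ac)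
  qed simp
  define v where "v n = mnorm Z (tens (map_left (N ^^ n) xs))" for n
  have v0: "v 0 = mnorm Z (tens xs)" by (simp add: v_def map_left_def)
  have vnn: "0 \<le> v n" for n by (simp add: v_def Z.mnorm_nonneg)
  have cl: "tens (map_left (N ^^ n) xs) \<in> carrier Z" for n
    using Nc by (intro tens_closed X.map_left_closed[OF xs])
  have vv: "(v n)\<^sup>2 \<le> v 0 * v (2 * n)" for n
  proof -
    have "(v n)\<^sup>2 = norm (inn Z (tens (map_left (N ^^ n) xs)) (tens (map_left (N ^^ n) xs)))"
      by (simp add: v_def Z.mnorm_square)
    also have "\<dots> = norm (inn Z (tens xs) (tens (map_left (N ^^ n) (map_left (N ^^ n) xs))))"
      using inn_tens_map_left[of "N ^^ n" "N ^^ n" xs "map_left (N ^^ n) xs"] xs Nc NN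
        X.map_left_closed[OF xs Nc]
      by simp
    also have "map_left (N ^^ n) (map_left (N ^^ n) xs) = map_left (N ^^ (2 * n)) xs"
      by (simp add: funpow_add[symmetric] mult_2)
    also have "norm (inn Z (tens xs) (tens (map_left (N ^^ (2 * n)) xs))) \<le> v 0 * v (2 * n)"
      unfolding v0 unfolding v_def by (intro Z.norm_inn_le cl tens_closed xs)
    finally show ?thesis .
  qed
  \<comment> \<open>The triangle inequality over a fixed list: \<open>K\<close> is crude but
    independent of \<open>n\<close>.\<close>
  define K where "K = (\<Sum>(x, y)\<leftarrow>xs. mnorm X x * mnorm Y y)"
  have vK: "v n \<le> K * (c\<^sup>2) ^ n" for n
    using xs unfolding v_def K_def
  proof (induction xs)
    case (Cons p xs)
    then have p: "fst p \<in> carrier X" "snd p \<in> carrier Y" and xs: "factors xs" by auto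
    have "mnorm Z (tens (map_left (N ^^ n) (p # xs)))
        \<le> mnorm Z (m ((N ^^ n) (fst p)) (snd p)) + mnorm Z (tens (map_left (N ^^ n) xs))"
      using p Nc by (simp, intro Z.mnorm_triangle closed tens_closed X.map_left_closed[OF xs]) simp_all
    also have "\<dots> \<le> (c\<^sup>2) ^ n * mnorm X (fst p) * mnorm Y (snd p) + (\<Sum>(x, y)\<leftarrow>xs. mnorm X x * mnorm Y y) * (c\<^sup>2) ^ n"
      using p Nc by (intro add_mono Cons.IH[OF xs] order_trans[OF mnorm_m_le] mult_right_mono Nb Y.mnorm_nonneg)
    finally show ?case by (simp add: case_prod_unfold algebra_simps)
  qed (simp add: Z.mnorm_zero)
  \<comment> \<open>Each further squaring applies \<open>vv\<close> with
    \<open>n = 2 ^ k\<close>.\<close>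
  have "v 1 ^ (2 ^ k) \<le> v 0 ^ (2 ^ k - 1) * v (2 ^ k)" for k
  proof (induction k)
    case (Suc k)
    have "v 1 ^ (2 ^ Suc k) = (v 1 ^ (2 ^ k))\<^sup>2" by (simp add: power_mult[symmetric] mult.commute)
    also have "\<dots> \<le> (v 0 ^ (2 ^ k - 1) * v (2 ^ k))\<^sup>2" using Suc vnn by (intro power_mono) simp_all
    also have "\<dots> \<le> (v 0 ^ (2 ^ k - 1))\<^sup>2 * (v 0 * v (2 * 2 ^ k))"
      unfolding power_mult_distrib by (intro mult_left_mono vv) simp
    also have "\<dots> = v 0 ^ (2 ^ Suc k - 1) * v (2 ^ Suc k)"
    proof -
      obtain j where "(2::nat) ^ k = Suc j" by (metis gr0_implies_Suc zero_less_numeral zero_less_power)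
      then have e: "(2::nat) ^ Suc k - 1 = Suc ((2 ^ k - 1) * 2)" by simp
      show ?thesis unfolding e unfolding power_Suc power_mult by (simp add: mult_ac)
    qed
    finally show ?case .
  qed simp
  then have "v 1 ^ (2 ^ k) \<le> (K * c\<^sup>2) * (v 0 * c\<^sup>2) ^ (2 ^ k - 1)" for k
  proof -
    have "v 1 ^ (2 ^ k) \<le> v 0 ^ (2 ^ k - 1) * v (2 ^ k)" by fact
    also have "\<dots> \<le> v 0 ^ (2 ^ k - 1) * (K * (c\<^sup>2) ^ (2 ^ k))" by (intro mult_left_mono vK) (simp add: vnn)
    also have "(c\<^sup>2) ^ (2 ^ k) = c\<^sup>2 * (c\<^sup>2) ^ (2 ^ k - 1)"
      by (subst power_eq_if) (simp only: power_eq_0_iff, simp)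
    finally show ?thesis by (simp add: power_mult_distrib mult_ac)
  qed
  note growth = this
  \<comment> \<open>This bounds \<open>N \<otimes> I\<close>. The bound for
    \<open>S \<otimes> I\<close> follows because the inner square of its value pairs the original
    tensor with its image under \<open>N \<otimes> I\<close>.\<close>
  have v1: "v 1 \<le> v 0 * c\<^sup>2"
    by (rule le_if_iterated_square_le[OF _ _ growth]) (simp_all add: vnn)
  have Sc: "tens (map_left S xs) \<in> carrier Z"
    by (intro tens_closed X.map_left_closed[OF xs] S)
  have "(mnorm Z (tens (map_left S xs)))\<^sup>2 = norm (inn Z (tens xs) (tens (map_left N xs)))"
    using inn_tens_map_left[OF S T ST xs X.map_left_closed[OF xs, of S]] S
    by (simp add: Z.mnorm_square N_def)
  also have "\<dots> \<le> v 0 * v 1"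
    unfolding v0 unfolding v_def using cl[of 1] by (simp add: Z.norm_inn_le tens_closed xs)
  also have "\<dots> \<le> v 0 * (v 0 * c\<^sup>2)" by (intro mult_left_mono v1 vnn)
  also have "\<dots> = (c * mnorm Z (tens xs))\<^sup>2" by (simp add: v0 power2_eq_square mult_ac)
  finally show ?thesis by (rule power2_le_imp_le) (simp add: c0 Z.mnorm_nonneg)
qed

lemma approx_tens:
  assumes "V \<in> carrier Z"
  shows "\<exists>xs. (\<forall>n. factors (xs n)) \<and> (\<lambda>n. mnorm Z (tens (xs n) - V)) \<longlonglongrightarrow> 0"
proof -
  have "\<exists>xs. factors xs \<and> mnorm Z (V - tens xs) < inverse (real (Suc n))" for n
  proof -
    have "V \<in> mclosure Z (cspan {m x y | x y. x \<in> carrier X \<and> y \<in> carrier Y})" using assms dense by simp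
    moreover have "cspan {m x y | x y. x \<in> carrier X \<and> y \<in> carrier Y}
        = {tens xs | xs. factors xs}"
      by (intro cspan_tensor_sum X.scaleC_closed scaleC_left)
    ultimately show ?thesis unfolding mclosure_def by (auto dest!: spec[of _ "inverse (real (Suc n))"])
  qed
  then obtain xs where xs: "\<And>n. factors (xs n)"
    "\<And>n. mnorm Z (V - tens (xs n)) < inverse (real (Suc n))" by metis
  have "(\<lambda>n. mnorm Z (tens (xs n) - V)) \<longlonglongrightarrow> 0"
  proof (rule Lim_null_comparison[OF always_eventually LIMSEQ_inverse_real_of_nat])
    show "\<forall>n. norm (mnorm Z (tens (xs n) - V)) \<le> inverse (real (Suc n))"
      using xs assms by (simp add: Z.mnorm_commute[of V] tens_closed Z.mnorm_nonneg less_imp_le)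
  qed
  then show ?thesis using xs by blast
qed

text \<open>The condition inside the definite description of \<open>amplify\<close>.\<close>

definition is_amplification :: "('x \<Rightarrow> 'x) \<Rightarrow> ('x \<Rightarrow> 'x) \<Rightarrow> bool" where
  "is_amplification S R \<longleftrightarrow> R \<in> adjointable Z \<and>
     (\<forall>x\<in>carrier X. \<forall>y\<in>carrier Y. R (m x y) = m (S x) y)"

text \<open>Negated left factors turn a difference of two formal tensors into a single list, to
  which the norm estimate applies.\<close>

lemma tens_approx_minus:
  assumes "\<And>x. x \<in> carrier X \<Longrightarrow> S (- x) = - S x" "\<And>x. x \<in> carrier X \<Longrightarrow> S x \<in> carrier X"
    and "factors xs"
  shows "tens (map_left S (map_left uminus xs)) = - tens (map_left S xs)"
  using assms(3)
proof (induction xs)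
  case (Cons p xs)
  then have p: "fst p \<in> carrier X" "snd p \<in> carrier Y" by auto
  have "m (- S (fst p)) (snd p) = - m (S (fst p)) (snd p)"
    using scaleC_left[of "S (fst p)" "snd p" "-1"] p assms(2)
    by (simp add: complex_vector.scale_minus_left scaleC_one)
  with Cons p show ?case by (simp add: assms(1))
qed simp

text \<open>By the norm estimate \<open>S \<otimes> I\<close> is independent of the representing
  list and uniformly continuous, so it extends to limits of formal tensors. The adjoint
  \<open>T \<otimes> I\<close> is built alongside in the same way, since adjointability is part of
  what is claimed.\<close>

lemma amplification_exists:
  assumes S: "S \<in> adjointable X" and c: "op_le X S c"
  shows "\<exists>R. is_amplification S R \<and> op_le Z R c"
proof -
  obtain T where T: "\<And>x. x \<in> carrier X \<Longrightarrow> T x \<in> carrier X" "\<And>x. x \<notin> carrier X \<Longrightarrow> T x = 0"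
    "\<And>x y. x \<in> carrier X \<Longrightarrow> y \<in> carrier X \<Longrightarrow> inn X (S x) y = inn X x (T y)"
    "\<And>x y. x \<in> carrier X \<Longrightarrow> y \<in> carrier X \<Longrightarrow> inn X (T x) y = inn X x (S y)"
    using X.adjointableE[OF S] by metis
  have Sc: "\<And>x. x \<in> carrier X \<Longrightarrow> S x \<in> carrier X" by (rule X.adjointable_closed[OF S])
  have Tadj: "T \<in> adjointable X" by (rule X.adjointableI[of _ S]) (simp_all add: T Sc)
  have cT: "op_le X T c" by (rule X.op_le_adjoint[OF Sc T(1,3) c])
  \<comment> \<open>The pairs \<open>(V, W)\<close> in the closure of the graph of
    \<open>A \<otimes> I\<close> on formal tensors; \<open>lim_diff\<close> below shows that this
    graph is single-valued.\<close>
  define lim where "lim A V W \<longleftrightarrow> (\<exists>xs. (\<forall>n. factors (xs n)) \<and>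
      (\<lambda>n. mnorm Z (tens (xs n) - V)) \<longlonglongrightarrow> 0 \<and> (\<lambda>n. mnorm Z (tens (map_left A (xs n)) - W)) \<longlonglongrightarrow> 0)"
    for A :: "'x \<Rightarrow> 'x" and V W
  have diff: "mnorm Z (tens (map_left A xs) - tens (map_left A ys)) \<le> c * mnorm Z (tens xs - tens ys)"
    if A: "A = S \<or> A = T" and xs: "factors xs" and ys: "factors ys"
    for A xs ys
  proof -
    have Aadj: "A \<in> adjointable X" using A S Tadj by blast
    have set: "factors (xs @ map_left uminus ys)"
      using xs X.map_left_closed[OF ys, of uminus] X.minus_closed by simp
    have "mnorm Z (tens (map_left A (xs @ map_left uminus ys))) \<le> c * mnorm Z (tens (xs @ map_left uminus ys))"
      using A
    proof
      assume "A = S" then show ?thesis using mnorm_tens_map_left[OF Sc T(1,3) c set] by simp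
    next
      assume "A = T" then show ?thesis using mnorm_tens_map_left[OF T(1) Sc T(4) cT set] by simp
    qed
    moreover have "tens (map_left A (map_left uminus ys)) = - tens (map_left A ys)"
      by (rule tens_approx_minus[where S = A, OF X.adjointable_minus[OF Aadj] X.adjointable_closed[OF Aadj] ys])
    moreover have "tens (map_left (\<lambda>x. x) (map_left uminus ys)) = - tens (map_left (\<lambda>x. x) ys)"
      using tens_approx_minus[of "\<lambda>x. x" ys] ys by simp
    ultimately show ?thesis by (simp add: map_left_def)
  qed
  have ex: "\<exists>W\<in>carrier Z. lim A V W" if A: "A = S \<or> A = T" and V: "V \<in> carrier Z" for A V
  proof -
    obtain xs where xs: "\<And>n. factors (xs n)" "(\<lambda>n. mnorm Z (tens (xs n) - V)) \<longlonglongrightarrow> 0"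
      using approx_tens[OF V] by blast
    have Axs: "tens (map_left A (xs n)) \<in> carrier Z" for n
      using A Sc T(1) tens_map_left_closed[OF xs(1)] by blast
    have "\<exists>N. \<forall>i\<ge>N. \<forall>j\<ge>N. mnorm Z (tens (map_left A (xs i)) - tens (map_left A (xs j))) < e" if e: "0 < e" for e
    proof -
      \<comment> \<open>The summand 1 covers \<open>c = 0\<close> and makes
        \<open>c * (d + d)\<close> strictly smaller than \<open>e\<close>.\<close>
      define d where "d = e / (2 * (c + 1))"
      have c0: "0 \<le> c" using c by (simp add: op_le_def)
      have d0: "0 < d" using e c0 by (simp add: d_def)
      have "(2 * (c + 1)) * d = e" using c0 by (simp add: d_def)
      then have "c * (d + d) + (d + d) = e" by (simp add: algebra_simps)
      with d0 have d: "0 < d" "c * (d + d) < e" by simp_all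
      obtain N where N: "\<And>n. n \<ge> N \<Longrightarrow> mnorm Z (tens (xs n) - V) < d"
        using order_tendstoD(2)[OF xs(2) d(1)] by (auto simp: eventually_sequentially)
      have "mnorm Z (tens (map_left A (xs i)) - tens (map_left A (xs j))) < e" if ij: "i \<ge> N" "j \<ge> N" for i j
      proof -
        have "mnorm Z (tens (xs i) - tens (xs j)) \<le> mnorm Z (tens (xs i) - V) + mnorm Z (V - tens (xs j))"
          by (intro Z.mnorm_triangle_diff tens_closed xs V)
        also have "\<dots> \<le> d + d" using N[OF ij(1)] N[OF ij(2)] by (simp add: Z.mnorm_commute V tens_closed xs(1))
        finally have "c * mnorm Z (tens (xs i) - tens (xs j)) \<le> c * (d + d)" using c0 by (intro mult_left_mono)
        then show ?thesis using diff[OF A xs(1)[of i] xs(1)[of j]] d by simp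
      qed
      then show ?thesis by blast
    qed
    then obtain W where W: "W \<in> carrier Z" "(\<lambda>n. mnorm Z (tens (map_left A (xs n)) - W)) \<longlonglongrightarrow> 0"
      using Z.complete[of "\<lambda>n. tens (map_left A (xs n))"] Axs by blast
    then show ?thesis using xs unfolding lim_def by blast
  qed
  have lim_diff: "mnorm Z (W - W') \<le> c * mnorm Z (V - V')"
    if A: "A = S \<or> A = T" and V: "V \<in> carrier Z" "V' \<in> carrier Z" and W: "W \<in> carrier Z" "W' \<in> carrier Z"
      and lim: "lim A V W" "lim A V' W'" for A V V' W W'
  proof -
    obtain xs where xs: "\<And>n. factors (xs n)" "(\<lambda>n. mnorm Z (tens (xs n) - V)) \<longlonglongrightarrow> 0"
      "(\<lambda>n. mnorm Z (tens (map_left A (xs n)) - W)) \<longlonglongrightarrow> 0" using lim unfolding lim_def by blast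
    obtain ys where ys: "\<And>n. factors (ys n)" "(\<lambda>n. mnorm Z (tens (ys n) - V')) \<longlonglongrightarrow> 0"
      "(\<lambda>n. mnorm Z (tens (map_left A (ys n)) - W')) \<longlonglongrightarrow> 0" using lim unfolding lim_def by blast
    have cl: "tens (map_left A (xs n)) \<in> carrier Z" "tens (map_left A (ys n)) \<in> carrier Z"
       "tens (xs n) \<in> carrier Z" "tens (ys n) \<in> carrier Z" for n
      using A Sc T(1) tens_map_left_closed[OF xs(1)] tens_map_left_closed[OF ys(1)]
        tens_closed[OF xs(1)] tens_closed[OF ys(1)] by blast+
    have "(\<lambda>n. mnorm Z (tens (map_left A (xs n)) - tens (map_left A (ys n)))) \<longlonglongrightarrow> mnorm Z (W - W')"
      by (intro Z.tendsto_mnorm Z.tendsto_diff Z.diff_closed cl W xs ys)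
    moreover have "(\<lambda>n. c * mnorm Z (tens (xs n) - tens (ys n))) \<longlonglongrightarrow> c * mnorm Z (V - V')"
      by (intro tendsto_intros Z.tendsto_mnorm Z.tendsto_diff Z.diff_closed cl V xs ys)
    ultimately show ?thesis
      by (rule LIMSEQ_le) (use diff[OF A xs(1) ys(1)] in blast)
  qed
  \<comment> \<open>Any limit may be chosen, for \<open>lim_diff\<close> with \<open>V = V'\<close>
    leaves only one.\<close>
  define R where "R A V = (if V \<in> carrier Z then SOME W. W \<in> carrier Z \<and> lim A V W else 0)" for A V
  have R: "R A V \<in> carrier Z \<and> lim A V (R A V)" if "A = S \<or> A = T" "V \<in> carrier Z" for A V
    using someI_ex[of "\<lambda>W. W \<in> carrier Z \<and> lim A V W"] ex[OF that] that(2) by (auto simp: R_def)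
  have Radj: "inn Z (R S V) V' = inn Z V (R T V')" if V: "V \<in> carrier Z" "V' \<in> carrier Z" for V V'
  proof -
    have RV: "lim S V (R S V)" "lim T V' (R T V')" "R S V \<in> carrier Z" "R T V' \<in> carrier Z"
      using R V by blast+
    obtain xs where xs: "\<And>n. factors (xs n)" "(\<lambda>n. mnorm Z (tens (xs n) - V)) \<longlonglongrightarrow> 0"
      "(\<lambda>n. mnorm Z (tens (map_left S (xs n)) - R S V)) \<longlonglongrightarrow> 0" using RV unfolding lim_def by blast
    obtain ys where ys: "\<And>n. factors (ys n)" "(\<lambda>n. mnorm Z (tens (ys n) - V')) \<longlonglongrightarrow> 0"
      "(\<lambda>n. mnorm Z (tens (map_left T (ys n)) - R T V')) \<longlonglongrightarrow> 0" using RV unfolding lim_def by blast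
    have cl: "tens (map_left S (xs n)) \<in> carrier Z" "tens (map_left T (ys n)) \<in> carrier Z"
       "tens (xs n) \<in> carrier Z" "tens (ys n) \<in> carrier Z" for n
      using Sc T(1) tens_map_left_closed[OF xs(1)] tens_map_left_closed[OF ys(1)]
        tens_closed[OF xs(1)] tens_closed[OF ys(1)] by blast+
    have "(\<lambda>n. inn Z (tens (map_left S (xs n))) (tens (ys n))) \<longlonglongrightarrow> inn Z (R S V) V'"
      by (intro Z.tendsto_inn cl RV V xs ys)
    moreover have "(\<lambda>n. inn Z (tens (xs n)) (tens (map_left T (ys n)))) \<longlonglongrightarrow> inn Z V (R T V')"
      by (intro Z.tendsto_inn cl RV V xs ys)
    ultimately show ?thesis
      using LIMSEQ_unique inn_tens_map_left[OF Sc T(1,3) xs(1) ys(1)] by auto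
  qed
  have lim_m: "lim S (m x y) (m (S x) y)" if "x \<in> carrier X" "y \<in> carrier Y" for x y
    unfolding lim_def using that
    by (intro exI[of _ "\<lambda>_. [(x, y)]"]) (simp add: Z.mnorm_zero)
  have Rm: "R S (m x y) = m (S x) y" if xy: "x \<in> carrier X" "y \<in> carrier Y" for x y
  proof -
    have cl: "m x y \<in> carrier Z" "m (S x) y \<in> carrier Z" using closed xy Sc by simp_all
    then have "mnorm Z (R S (m x y) - m (S x) y) \<le> c * mnorm Z (m x y - m x y)"
      using R lim_m xy by (intro lim_diff[of S]) simp_all
    then have "mnorm Z (R S (m x y) - m (S x) y) = 0"
      using Z.mnorm_nonneg[of "R S (m x y) - m (S x) y"] by (simp add: Z.mnorm_zero)
    then have "R S (m x y) - m (S x) y = 0" using R cl by (intro Z.mnorm_eq_0) (simp_all add: Z.diff_closed)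
    then show ?thesis by simp
  qed
  have adj: "R S \<in> adjointable Z"
    by (rule Z.adjointableI[of _ "R T"]) (use R Radj in \<open>auto simp: R_def[of _ "_ :: 'x"]\<close>)
  have lim0: "lim S 0 0"
    unfolding lim_def by (intro exI[of _ "\<lambda>_. []"]) (simp add: Z.mnorm_zero)
  have "mnorm Z (R S V) \<le> c * mnorm Z V" if V: "V \<in> carrier Z" for V
    using lim_diff[of S V 0 "R S V" 0] R[of S V] V Z.zero_closed lim0 by simp
  then have "op_le Z (R S) c" using c by (simp add: op_le_def)
  then show ?thesis using adj Rm unfolding is_amplification_def by blast
qed

text \<open>Boundedness is not part of adjointability, so elementary tensors are not approached
  inside \<open>R\<close> and \<open>Q\<close> themselves. Instead the adjoints are compared: the
  inner product with a fixed vector is continuous.\<close>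

lemma amplification_unique:
  assumes R: "is_amplification S R" and Q: "is_amplification S Q"
  shows "R = Q"
proof
  obtain R' where R': "\<And>x. x \<in> carrier Z \<Longrightarrow> R' x \<in> carrier Z"
    "\<And>x y. x \<in> carrier Z \<Longrightarrow> y \<in> carrier Z \<Longrightarrow> inn Z (R x) y = inn Z x (R' y)"
    using R Z.adjointableE[of R] unfolding is_amplification_def by metis
  obtain Q' where Q': "\<And>x. x \<in> carrier Z \<Longrightarrow> Q' x \<in> carrier Z"
    "\<And>x y. x \<in> carrier Z \<Longrightarrow> y \<in> carrier Z \<Longrightarrow> inn Z (Q x) y = inn Z x (Q' y)"
    using Q Z.adjointableE[of Q] unfolding is_amplification_def by metis
  have RQ: "R \<in> adjointable Z" "Q \<in> adjointable Z"
    using R Q by (simp_all add: is_amplification_def)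
  have tens: "inn Z (tens xs) (R' w) = inn Z (tens xs) (Q' w)"
    if w: "w \<in> carrier Z" and xs: "factors xs" for w xs
    using xs
  proof (induction xs)
    case (Cons p xs)
    then have p: "fst p \<in> carrier X" "snd p \<in> carrier Y" and xs: "factors xs" by auto
    have "inn Z (m (fst p) (snd p)) (R' w) = inn Z (m (fst p) (snd p)) (Q' w)"
      using R Q p w by (simp add: R'(2)[symmetric] Q'(2)[symmetric] closed is_amplification_def)
    then show ?case using Cons.IH[OF xs] p w by (simp add: Z.inn_add_left closed tens_closed xs R' Q')
  qed (simp add: Z.inn_zero_left R' Q' w)
  have eq: "R' w = Q' w" if w: "w \<in> carrier Z" for w
  proof (rule Z.inn_eqI_right)
    fix V assume V: "V \<in> carrier Z"
    obtain xs where xs: "\<And>n. factors (xs n)" "(\<lambda>n. mnorm Z (tens (xs n) - V)) \<longlonglongrightarrow> 0"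
      using approx_tens[OF V] by blast
    have "(\<lambda>n. inn Z (tens (xs n)) (R' w)) \<longlonglongrightarrow> inn Z V (R' w)"
      "(\<lambda>n. inn Z (tens (xs n)) (Q' w)) \<longlonglongrightarrow> inn Z V (Q' w)"
      by (intro Z.tendsto_inn tens_closed xs V R' Q' w, simp add: Z.mnorm_zero)+
    then show "inn Z V (R' w) = inn Z V (Q' w)" using tens[OF w xs(1)] LIMSEQ_unique by simp
  qed (simp_all add: R' Q' w)
  fix V show "R V = Q V"
  proof (cases "V \<in> carrier Z")
    case True
    then show ?thesis
      by (intro Z.inn_eqI) (simp_all add: R' Q' eq Z.adjointable_closed RQ)
  next
    case False
    then show ?thesis by (simp add: Z.adjointable_outside RQ)
  qed
qed

end

section \<open>Representations of Hilbert modules\<close>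

lemma csubspace_closure:
  fixes V :: "'b::cstar_algebra set"
  assumes V: "csubspace V"
  shows "csubspace (closure V)"
proof (rule complex_vector.subspaceI)
  show "0 \<in> closure V" using complex_vector.subspace_0[OF V] closure_subset by blast
next
  fix x y assume "x \<in> closure V" "y \<in> closure V"
  then obtain s t where s: "\<And>n. s n \<in> V" "s \<longlonglongrightarrow> x" and t: "\<And>n. t n \<in> V" "t \<longlonglongrightarrow> y"
    by (auto simp: closure_sequential)
  have "(\<lambda>n. s n + t n) \<longlonglongrightarrow> x + y" by (intro tendsto_intros s t)
  moreover have "s n + t n \<in> V" for n by (intro complex_vector.subspace_add[OF V] s t)
  ultimately show "x + y \<in> closure V"
    unfolding closure_sequential by (intro exI[of _ "\<lambda>n. s n + t n"]) simp
next
  fix c x assume "x \<in> closure V"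
  then obtain s where s: "\<And>n. s n \<in> V" "s \<longlonglongrightarrow> x"
    by (auto simp: closure_sequential)
  have "(\<lambda>n. c *\<^sub>C s n) \<longlonglongrightarrow> c *\<^sub>C x"
    by (rule bounded_linear.tendsto[OF bounded_linear_scaleC_cstar[OF bounded_linear_ident] s(2)])
  moreover have "c *\<^sub>C s n \<in> V" for n by (intro complex_vector.subspace_scale[OF V] s)
  ultimately show "c *\<^sub>C x \<in> closure V"
    unfolding closure_sequential by (intro exI[of _ "\<lambda>n. c *\<^sub>C s n"]) simp
qed

lemma csubspace_closure_cspan: "csubspace (closure (cspan (S :: 'b::cstar_algebra set)))"
  by (intro csubspace_closure complex_vector.subspace_span)

text \<open>The scalars are allowed to change so that the lemma applies to the involution.\<close>

lemma closure_cspan_image: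
  fixes g :: "'b::cstar_algebra \<Rightarrow> 'c::cstar_algebra"
  assumes g: "bounded_linear g" and sc: "\<And>c x. \<exists>d. g (c *\<^sub>C x) = d *\<^sub>C g x"
    and S: "\<And>s. s \<in> S \<Longrightarrow> g s \<in> closure (cspan T)" and a: "a \<in> closure (cspan S)"
  shows "g a \<in> closure (cspan T)"
proof -
  interpret g: bounded_linear g by fact
  note V = csubspace_closure_cspan[of T]
  have "g b \<in> closure (cspan T)" if "b \<in> cspan S" for b
    using that
  proof (induction rule: complex_vector.span_induct_alt)
    case base
    then show ?case by (simp add: g.zero complex_vector.subspace_0[OF V])
  next
    case (step c x y)
    obtain d where "g (c *\<^sub>C x) = d *\<^sub>C g x" using sc by blast
    then show ?case using step S
      by (simp add: g.add complex_vector.subspace_add[OF V] complex_vector.subspace_scale[OF V])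
  qed
  then have "g ` closure (cspan S) \<subseteq> closure (cspan T)"
    by (intro image_closure_subset linear_continuous_on g closed_closure) blast
  then show ?thesis using a by blast
qed

lemma closure_cspan_mult:
  fixes x y :: "'b::cstar_algebra"
  assumes "\<And>s. s \<in> S \<Longrightarrow> x * s * y \<in> closure (cspan T)" "a \<in> closure (cspan S)"
  shows "x * a * y \<in> closure (cspan T)"
proof (rule closure_cspan_image[where g = "\<lambda>a. x * a * y" and S = S])
  show "bounded_linear (\<lambda>a. x * a * y)"
    by (rule bounded_linear_compose[OF bounded_linear_mult_left bounded_linear_mult_right])
  show "\<exists>d. x * c *\<^sub>C a * y = d *\<^sub>C (x * a * y)" for c a
    by (rule exI[of _ c]) (simp add: mult_scaleC_left mult_scaleC_right)
qed (use assms in auto)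

lemma closure_cspan_mult_left:
  fixes x :: "'b::cstar_algebra"
  assumes "\<And>s. s \<in> S \<Longrightarrow> x * s \<in> closure (cspan T)" "a \<in> closure (cspan S)"
  shows "x * a \<in> closure (cspan T)"
proof (rule closure_cspan_image[where g = "\<lambda>a. x * a" and S = S])
  show "\<exists>d. x * c *\<^sub>C a = d *\<^sub>C (x * a)" for c a
    by (rule exI[of _ c]) (simp add: mult_scaleC_right)
qed (use assms bounded_linear_mult_right in auto)

lemma closure_cspan_mult_right:
  fixes x :: "'b::cstar_algebra"
  assumes "\<And>s. s \<in> S \<Longrightarrow> s * x \<in> closure (cspan T)" "a \<in> closure (cspan S)"
  shows "a * x \<in> closure (cspan T)"
proof (rule closure_cspan_image[where g = "\<lambda>a. a * x" and S = S])
  show "\<exists>d. c *\<^sub>C a * x = d *\<^sub>C (a * x)" for c a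
    by (rule exI[of _ c]) (simp add: mult_scaleC_left)
qed (use assms bounded_linear_mult_left in auto)

section \<open>Representations of a single Hilbert module\<close>

locale module_rep = hilbert_module X + hom: star_hom \<pi>
  for X :: "('a::cstar_algebra, 'x::complex_vector) corr" and \<pi> :: "'a \<Rightarrow> 'b::cstar_algebra" +
  fixes f :: "'x \<Rightarrow> 'b"
  assumes f_add: "x \<in> carrier X \<Longrightarrow> y \<in> carrier X \<Longrightarrow> f (x + y) = f x + f y"
    and f_scaleC: "x \<in> carrier X \<Longrightarrow> f (c *\<^sub>C x) = c *\<^sub>C f x"
    and f_ract: "x \<in> carrier X \<Longrightarrow> f (ract X x a) = f x * \<pi> a"
    and f_inn: "x \<in> carrier X \<Longrightarrow> y \<in> carrier X \<Longrightarrow> star (f x) * f y = \<pi> (inn X x y)"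
begin

lemma f_minus: "x \<in> carrier X \<Longrightarrow> f (- x) = - f x"
  using f_scaleC[of x "-1"] by (simp add: complex_vector.scale_minus_left scaleC_one)

lemma f_diff: "x \<in> carrier X \<Longrightarrow> y \<in> carrier X \<Longrightarrow> f (x - y) = f x - f y"
  using f_add[of x "- y"] by (simp add: minus_closed f_minus)

lemma f_zero: "f 0 = 0"
  using f_diff[of 0 0] zero_closed by simp

lemma norm_f_square: "x \<in> carrier X \<Longrightarrow> (norm (f x))\<^sup>2 = norm (\<pi> (inn X x x))"
  by (simp add: f_inn[symmetric] cstar_identity)

lemma norm_f_le: "x \<in> carrier X \<Longrightarrow> norm (f x) \<le> mnorm X x"
  by (rule power2_le_imp_le) (simp_all add: norm_f_square mnorm_square hom.norm_le mnorm_nonneg)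

lemma norm_f_eq: "inj \<pi> \<Longrightarrow> x \<in> carrier X \<Longrightarrow> norm (f x) = mnorm X x"
  by (rule power2_eq_imp_eq) (simp_all add: norm_f_square mnorm_square hom.norm_eq mnorm_nonneg)

lemma tendsto_f:
  assumes s: "\<And>n. s n \<in> carrier X" "x \<in> carrier X" "(\<lambda>n. mnorm X (s n - x)) \<longlonglongrightarrow> 0"
  shows "(\<lambda>n. f (s n)) \<longlonglongrightarrow> f x"
proof -
  have "(\<lambda>n. f (s n) - f x) \<longlonglongrightarrow> 0"
    by (rule Lim_null_comparison[OF always_eventually s(3)])
      (use s norm_f_le diff_closed f_diff in metis)
  then show ?thesis using LIM_zero_iff by blast
qed

definition image_sum :: "('x \<times> 'x) list \<Rightarrow> 'b" where
  "image_sum xs = tensor_sum (\<lambda>u v. f u * star (f v)) xs"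

text \<open>This closed span is available before the induced homomorphism exists. Inside it an
  element \<open>d\<close> with \<open>d * f z = 0\<close> for all \<open>z\<close> must vanish, and
  this determines the images of compact operators.\<close>

definition image_alg :: "'b set" where
  "image_alg = closure (cspan {f u * star (f v) | u v. u \<in> carrier X \<and> v \<in> carrier X})"

lemma image_sum_simps [simp]:
  "image_sum [] = 0"
  "image_sum (p # xs) = f (fst p) * star (f (snd p)) + image_sum xs"
  "image_sum (xs @ ys) = image_sum xs + image_sum ys"
  by (simp_all add: image_sum_def)

lemma image_alg_basis: "u \<in> carrier X \<Longrightarrow> v \<in> carrier X \<Longrightarrow> f u * star (f v) \<in> image_alg"
  unfolding image_alg_def by (rule subsetD[OF closure_subset]) (auto intro: complex_vector.span_base)

lemma cspan_image_sum:
  "cspan {f u * star (f v) | u v. u \<in> carrier X \<and> v \<in> carrier X} = {image_sum xs | xs. pairs xs}"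
  unfolding image_sum_def by (rule cspan_tensor_sum) (simp_all add: scaleC_closed f_scaleC mult_scaleC_left)

lemma image_sum_image_alg: "pairs xs \<Longrightarrow> image_sum xs \<in> image_alg"
  unfolding image_alg_def by (rule subsetD[OF closure_subset]) (auto simp: cspan_image_sum)

lemma image_alg_approx:
  assumes "b \<in> image_alg" "0 < e"
  shows "\<exists>xs. pairs xs \<and> norm (b - image_sum xs) < e"
proof -
  obtain y where "y \<in> {image_sum xs | xs. pairs xs}" "dist y b < e"
    using assms unfolding image_alg_def cspan_image_sum closure_approachable by blast
  then show ?thesis by (auto simp: dist_norm norm_minus_commute)
qed

lemma csubspace_image_alg: "csubspace image_alg"
  unfolding image_alg_def by (rule csubspace_closure_cspan)

lemma star_image_alg: "b \<in> image_alg \<Longrightarrow> star b \<in> image_alg"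
  unfolding image_alg_def
proof (rule closure_cspan_image[OF bounded_linear_star])
  show "\<exists>d. star (c *\<^sub>C x) = d *\<^sub>C star x" for c and x :: 'b using star_scaleC by blast
  fix s assume "s \<in> {f u * star (f v) | u v. u \<in> carrier X \<and> v \<in> carrier X}"
  then obtain u v where "s = f u * star (f v)" "u \<in> carrier X" "v \<in> carrier X" by blast
  then show "star s \<in> closure (cspan {f u * star (f v) | u v. u \<in> carrier X \<and> v \<in> carrier X})"
    using image_alg_basis[unfolded image_alg_def, of v u] by (simp add: star_mult star_star)
qed

lemma star_image_sum: "star (image_sum xs) = image_sum (map prod.swap xs)"
  by (induction xs) (simp_all add: star_add star_mult star_star)

lemma f_theta:
  "x \<in> carrier X \<Longrightarrow> y \<in> carrier X \<Longrightarrow> z \<in> carrier X \<Longrightarrow> f (theta X x y z) = f x * star (f y) * f z"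
  by (simp add: theta_apply f_ract f_inn[symmetric] mult.assoc)

lemma image_sum_apply:
  "pairs xs \<Longrightarrow> z \<in> carrier X \<Longrightarrow> image_sum xs * f z = f (theta_sum xs z)"
proof (induction xs)
  case (Cons p xs)
  then have p: "fst p \<in> carrier X" "snd p \<in> carrier X" and xs: "pairs xs" by auto
  then show ?case using Cons
    by (simp add: f_add theta_closed theta_sum_closed f_theta distrib_right)
qed (simp add: f_zero)

lemma image_sum_mult:
  assumes "pairs xs" "pairs ys"
  shows "image_sum xs * image_sum ys = image_sum (map_left (theta_sum xs) ys)"
  using assms(2)
  by (induction ys) (auto simp: distrib_left mult.assoc[symmetric] image_sum_apply[OF assms(1)])

text \<open>The sum over the list is independent of \<open>A\<close>; with powers of an operator for
  \<open>A\<close>, only the factor \<open>a\<close> varies with the exponent.\<close>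

lemma norm_image_sum_map_left_le:
  assumes A: "\<And>x. x \<in> carrier X \<Longrightarrow> A x \<in> carrier X" "op_le X A a"
    and xs: "pairs xs"
  shows "norm (image_sum (map_left A xs)) \<le> (\<Sum>(u, v)\<leftarrow>xs. mnorm X u * mnorm X v) * a"
  using xs
proof (induction xs)
  case (Cons p xs)
  then have p: "fst p \<in> carrier X" "snd p \<in> carrier X" and xs: "pairs xs" by auto
  have "norm (image_sum (map_left A (p # xs))) \<le> norm (f (A (fst p))) * norm (f (snd p)) + norm (image_sum (map_left A xs))"
    using norm_mult_ineq[of "f (A (fst p))" "star (f (snd p))"]
    by (simp add: norm_star norm_triangle_le)
  also have "\<dots> \<le> (a * mnorm X (fst p)) * mnorm X (snd p) + (\<Sum>(u, v)\<leftarrow>xs. mnorm X u * mnorm X v) * a"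
    using A p Cons.IH[OF xs] norm_f_le[of "A (fst p)"] norm_f_le[of "snd p"] mnorm_nonneg[of "fst p"]
    by (intro add_mono mult_mono) (auto simp: op_le_def intro: order_trans)
  finally show ?case by (simp add: case_prod_unfold algebra_simps)
qed simp

text \<open>
  For \<open>t = \<Sum> f (u i) (f (v i))\<^sup>*\<close> and \<open>T = \<Sum> \<theta> (u i) (v i)\<close> the powers of \<open>h = t t\<^sup>*\<close> are again finite sums with
  the same number of terms, which bounds their growth rate in terms of \<open>T\<close>; and
  \<open>\<parallel>h ^ n\<parallel> = \<parallel>t\<parallel> ^ (2 * n)\<close> if \<open>n\<close> is a power of two.
\<close>

lemma norm_image_sum_le:
  assumes xs: "pairs xs" and c: "op_le X (theta_sum xs) c"
  shows "norm (image_sum xs) \<le> c"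
proof -
  define ys where "ys = map prod.swap xs"
  have ys: "pairs ys" using xs by (auto simp: ys_def)
  have c0: "0 \<le> c" using c by (simp add: op_le_def)
  have cT: "op_le X (theta_sum ys) c"
    unfolding ys_def by (rule op_le_adjoint[OF theta_sum_closed[OF xs] theta_sum_closed[OF ys[unfolded ys_def]] theta_sum_inn[OF xs] c])
  define N where "N = theta_sum xs \<circ> theta_sum ys"
  have N: "N z = theta_sum xs (theta_sum ys z)" for z by (simp add: N_def)
  define h where "h = image_sum xs * image_sum ys"
  have sh: "star h = h" by (simp add: h_def ys_def star_mult star_image_sum comp_def)
  \<comment> \<open>Without a unit the powers start at exponent one: \<open>H n\<close> is the power
    of \<open>h\<close> with exponent \<open>n + 1\<close>.\<close>
  define H where "H n = ((*) h ^^ n) h" for n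
  have H0: "H 0 = h" and HS: "\<And>n. H (Suc n) = h * H n" by (simp_all add: H_def)
  have HH: "H m * H n = H (Suc (m + n))" for m n
    by (induction m) (simp_all add: H0 HS mult.assoc)
  have sH: "star (H n) = H n" for n
    using HH[of _ 0] by (induction n) (simp_all add: H0 HS sh star_mult)
  have Hrk: "H n = image_sum (map_left (N ^^ n \<circ> theta_sum xs) ys)" for n
  proof (induction n)
    case 0
    then show ?case by (simp add: H0 h_def image_sum_mult xs ys)
  next
    case (Suc n)
    have cl: "(N ^^ n) z \<in> carrier X" if "z \<in> carrier X" for n z
      by (induction n) (simp_all add: N theta_sum_closed xs ys that)
    have s: "pairs (map_left (N ^^ n \<circ> theta_sum xs) ys)"
      by (rule map_left_closed[OF ys]) (simp add: cl theta_sum_closed xs)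
    have "H (Suc n) = image_sum xs * (image_sum ys * image_sum (map_left (N ^^ n \<circ> theta_sum xs) ys))"
      unfolding HS Suc unfolding h_def mult.assoc ..
    also have "\<dots> = image_sum (map_left (theta_sum xs) (map_left (theta_sum ys) (map_left (N ^^ n \<circ> theta_sum xs) ys)))"
      by (simp only: image_sum_mult ys s xs map_left_closed[OF s theta_sum_closed[OF ys]])
    also have "\<dots> = image_sum (map_left (N ^^ Suc n \<circ> theta_sum xs) ys)"
      unfolding map_left_simps(4) by (rule arg_cong[where f = "\<lambda>A. image_sum (map_left A ys)"]) (simp add: fun_eq_iff N)
    finally show ?case .
  qed
  define M where "M = (\<Sum>(u, v)\<leftarrow>ys. mnorm X u * mnorm X v)"
  \<comment> \<open>The right factors remain those of \<open>ys\<close>; the left ones receive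
    \<open>N ^^ n\<close> after one further operator, whence the exponent
    \<open>2 * n + 1\<close>.\<close>
  have Hb: "norm (H n) \<le> M * c ^ (2 * n + 1)" for n
  proof -
    have "(N ^^ n) z \<in> carrier X \<and> mnorm X ((N ^^ n) z) \<le> c ^ (2 * n) * mnorm X z" if z: "z \<in> carrier X" for z
    proof (induction n)
      case (Suc n)
      let ?w = "(N ^^ n) z"
      have w: "?w \<in> carrier X" using Suc by blast
      have "mnorm X (theta_sum xs (theta_sum ys ?w)) \<le> c * mnorm X (theta_sum ys ?w)"
        using c by (simp add: op_le_def theta_sum_closed ys w)
      also have "\<dots> \<le> c * (c * mnorm X ?w)" using cT c0 w by (intro mult_left_mono) (simp_all add: op_le_def)
      also have "\<dots> \<le> c * (c * (c ^ (2 * n) * mnorm X z))" using Suc c0 by (intro mult_left_mono) simp_all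
      finally show ?case using w by (simp add: N[of "(N ^^ n) z"] theta_sum_closed xs ys mult_ac)
    qed (simp add: z)
    note Nb = this
    have "op_le X (N ^^ n \<circ> theta_sum xs) (c ^ (2 * n + 1))"
      unfolding op_le_def
    proof (intro conjI ballI)
      fix z assume z: "z \<in> carrier X"
      have "mnorm X ((N ^^ n) (theta_sum xs z)) \<le> c ^ (2 * n) * mnorm X (theta_sum xs z)"
        using Nb theta_sum_closed[OF xs z] by blast
      also have "\<dots> \<le> c ^ (2 * n) * (c * mnorm X z)"
        using c c0 z by (intro mult_left_mono) (simp_all add: op_le_def)
      finally show "mnorm X ((N ^^ n \<circ> theta_sum xs) z) \<le> c ^ (2 * n + 1) * mnorm X z" by (simp add: mult_ac)
    qed (simp add: c0)
    then show ?thesis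
      unfolding Hrk M_def using Nb by (intro norm_image_sum_map_left_le ys) (simp_all add: theta_sum_closed xs)
  qed
  have nH: "norm (H (2 ^ k - 1)) = norm h ^ (2 ^ k)" for k
  proof (induction k)
    case (Suc k)
    obtain j where j: "(2::nat) ^ k = Suc j" by (metis gr0_implies_Suc zero_less_numeral zero_less_power)
    have "H (2 ^ Suc k - 1) = H j * H j" by (simp add: HH j mult_2)
    then have "norm (H (2 ^ Suc k - 1)) = (norm (H j))\<^sup>2" by (simp add: norm_square_selfadjoint sH)
    also have "norm (H j) = norm h ^ (2 ^ k)" using Suc j by simp
    finally show ?case by (simp add: power_mult[symmetric] mult.commute)
  qed (simp add: H0)
  have nh: "norm h = (norm (image_sum xs))\<^sup>2"
    using cstar_identity[of "image_sum ys"] by (simp add: h_def ys_def star_image_sum[symmetric] star_star norm_star)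
  \<comment> \<open>For \<open>k = Suc l\<close> this is the bound on \<open>H (2 ^ l - 1)\<close>,
    where \<open>2 * (2 ^ l - 1) + 1\<close> equals \<open>2 ^ k - 1\<close>; for
    \<open>k = 0\<close> it is the triangle inequality.\<close>
  have "norm (image_sum xs) ^ (2 ^ k) \<le> M * c ^ (2 ^ k - 1)" for k
  proof (cases k)
    case 0
    have "norm (image_sum (map_left (\<lambda>x. x) ys)) \<le> M * 1"
      unfolding M_def by (intro norm_image_sum_map_left_le ys) (simp_all add: op_le_def)
    then have "norm (star (image_sum xs)) \<le> M" by (simp add: map_left_def star_image_sum ys_def)
    then show ?thesis using 0 by (simp add: norm_star)
  next
    case (Suc l)
    obtain j where j: "(2::nat) ^ l = Suc j" by (metis gr0_implies_Suc zero_less_numeral zero_less_power)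
    have "norm (image_sum xs) ^ (2 ^ k) = norm h ^ (2 ^ l)" by (simp add: nh Suc power_mult)
    also have "\<dots> \<le> M * c ^ (2 * (2 ^ l - 1) + 1)" unfolding nH[symmetric] by (rule Hb)
    finally show ?thesis by (simp add: Suc j)
  qed
  then show ?thesis by (rule le_if_iterated_square_le[OF norm_ge_zero c0])
qed

text \<open>An operator and its image are linked by their action on vectors rather than by a formula
  on rank one operators. This needs no choice of approximations and makes sums, products and
  adjoints easy to compare.\<close>

definition is_image :: "('x \<Rightarrow> 'x) \<Rightarrow> 'b \<Rightarrow> bool" where
  "is_image S b \<longleftrightarrow> b \<in> image_alg \<and> (\<forall>z\<in>carrier X. b * f z = f (S z))"

lemma image_alg_mult_eq_0:
  assumes d: "\<And>z. z \<in> carrier X \<Longrightarrow> d * f z = 0" and k: "k \<in> image_alg"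
  shows "d * k = 0"
proof -
  \<comment> \<open>The closed span of the empty set is zero, and every generator is sent into
    it.\<close>
  have "d * k \<in> closure (cspan {})"
    by (rule closure_cspan_mult_left[OF _ k[unfolded image_alg_def]])
      (auto simp: mult.assoc[symmetric] d)
  then show ?thesis by simp
qed

text \<open>The difference of two images annihilates all \<open>f z\<close>, hence also its own
  adjoint, which lies in \<open>image_alg\<close>; the C*-identity then makes it zero.\<close>

lemma is_image_unique:
  assumes "is_image S b" "is_image S c"
  shows "b = c"
proof -
  have bc: "b - c \<in> image_alg"
    using assms by (intro complex_vector.subspace_diff[OF csubspace_image_alg]) (simp_all add: is_image_def)
  have "(b - c) * star (b - c) = 0"
  proof (rule image_alg_mult_eq_0[OF _ star_image_alg[OF bc]])
    show "(b - c) * f z = 0" if "z \<in> carrier X" for z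
      using assms that by (simp add: is_image_def left_diff_distrib)
  qed
  then have "star (b - c) = 0" using star_mult_self_eq_0[of "star (b - c)"] by (simp add: star_star)
  then have "star (star (b - c)) = 0" by simp
  then show ?thesis by (simp add: star_star)
qed

lemma norm_image_sum_diff_le:
  assumes xs: "pairs xs" and ys: "pairs ys"
    and c: "op_le X (\<lambda>z. theta_sum xs z - theta_sum ys z) c"
  shows "norm (image_sum xs - image_sum ys) \<le> c"
proof -
  have ys': "pairs (map_left ((*\<^sub>C) (-1)) ys)"
    by (rule map_left_closed[OF ys]) (rule scaleC_closed)
  have "image_sum (map_left ((*\<^sub>C) (-1)) ys) = - image_sum ys"
    using ys by (induction ys) (auto simp: f_minus mult_scaleC_left complex_vector.scale_minus_left scaleC_one)
  then have e: "image_sum xs - image_sum ys = image_sum (xs @ map_left ((*\<^sub>C) (-1)) ys)" by simp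
  have "op_le X (theta_sum (xs @ map_left ((*\<^sub>C) (-1)) ys)) c"
    using c by (simp add: theta_sum_map_left_scaleC ys complex_vector.scale_minus_left scaleC_one)
  then show ?thesis unfolding e using xs ys' by (intro norm_image_sum_le) simp_all
qed

text \<open>Finite rank approximations of \<open>S\<close> are Cauchy, and the norm estimate
  transfers this to their images. The bound on \<open>b\<close> yields the boundedness clause for
  the induced homomorphism.\<close>

lemma is_image_exists:
  assumes S: "S \<in> compacts X"
  shows "\<exists>b. is_image S b \<and> (\<forall>c. op_le X S c \<longrightarrow> norm b \<le> c)"
proof -
  have "\<exists>xs. pairs xs \<and> op_le X (\<lambda>z. S z - theta_sum xs z) (inverse (real (Suc n)))" for n
    by (rule compacts_approx[OF S, of "inverse (real (Suc n))"]) auto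
  then obtain xs where xs: "\<And>n. pairs (xs n)"
    and le: "\<And>n. op_le X (\<lambda>z. S z - theta_sum (xs n) z) (inverse (real (Suc n)))" by metis
  have Sc: "S z \<in> carrier X" if "z \<in> carrier X" for z by (rule compacts_closed[OF S that])
  note fc = theta_sum_closed[OF xs]
  have diff: "norm (image_sum (xs m) - image_sum (xs n)) \<le> inverse (real (Suc m)) + inverse (real (Suc n))" for m n
  proof (rule norm_image_sum_diff_le[OF xs xs])
    have "op_le X (\<lambda>z. (-1) *\<^sub>C (S z - theta_sum (xs m) z)) (cmod (-1) * inverse (real (Suc m)))"
      by (intro op_le_scaleC le diff_closed Sc fc)
    then have "op_le X (\<lambda>z. theta_sum (xs m) z - S z) (inverse (real (Suc m)))"
      by (simp add: complex_vector.scale_minus_left scaleC_one)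
    then have "op_le X (\<lambda>z. (theta_sum (xs m) z - S z) + (S z - theta_sum (xs n) z))
        (inverse (real (Suc m)) + inverse (real (Suc n)))"
      by (intro op_le_add le diff_closed Sc fc)
    then show "op_le X (\<lambda>z. theta_sum (xs m) z - theta_sum (xs n) z) (inverse (real (Suc m)) + inverse (real (Suc n)))"
      by simp
  qed
  have "Cauchy (\<lambda>n. image_sum (xs n))"
  proof (rule CauchyI)
    fix e :: real assume "0 < e"
    then obtain N where N: "inverse (real (Suc N)) < e / 2" using reals_Archimedean[of "e / 2"] by auto
    have "norm (image_sum (xs m) - image_sum (xs n)) < e" if "m \<ge> N" "n \<ge> N" for m n
    proof -
      have "inverse (real (Suc m)) \<le> inverse (real (Suc N))" "inverse (real (Suc n)) \<le> inverse (real (Suc N))"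
        using that by (simp_all add: field_simps)
      then show ?thesis using diff[of m n] N by linarith
    qed
    then show "\<exists>M. \<forall>m\<ge>M. \<forall>n\<ge>M. norm (image_sum (xs m) - image_sum (xs n)) < e" by blast
  qed
  then obtain b where b: "(\<lambda>n. image_sum (xs n)) \<longlonglongrightarrow> b" using Cauchy_convergent convergent_def by blast
  have "b \<in> image_alg"
    using closed_sequentially[of image_alg "\<lambda>n. image_sum (xs n)" b] b image_sum_image_alg[OF xs]
    by (simp add: image_alg_def)
  moreover have "b * f z = f (S z)" if z: "z \<in> carrier X" for z
  proof (rule LIMSEQ_unique)
    show "(\<lambda>n. image_sum (xs n) * f z) \<longlonglongrightarrow> b * f z" by (intro tendsto_intros b)
    have "(\<lambda>n. inverse (real (Suc n)) * mnorm X z) \<longlonglongrightarrow> 0 * mnorm X z"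
      by (intro tendsto_intros LIMSEQ_inverse_real_of_nat)
    then have lim: "(\<lambda>n. inverse (real (Suc n)) * mnorm X z) \<longlonglongrightarrow> 0" by simp
    have "(\<lambda>n. mnorm X (theta_sum (xs n) z - S z)) \<longlonglongrightarrow> 0"
    proof (rule Lim_null_comparison[OF always_eventually lim], rule allI)
      fix n
      show "norm (mnorm X (theta_sum (xs n) z - S z)) \<le> inverse (real (Suc n)) * mnorm X z"
        using le[of n] z mnorm_commute[of "theta_sum (xs n) z" "S z"]
        by (simp add: op_le_def mnorm_nonneg fc Sc)
    qed
    then have "(\<lambda>n. f (theta_sum (xs n) z)) \<longlonglongrightarrow> f (S z)" by (intro tendsto_f fc Sc z)
    then show "(\<lambda>n. image_sum (xs n) * f z) \<longlonglongrightarrow> f (S z)" by (simp add: image_sum_apply xs z)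
  qed
  moreover have "norm b \<le> c" if c: "op_le X S c" for c
  proof -
    have "norm (image_sum (xs n)) \<le> c + inverse (real (Suc n))" for n
    proof (rule norm_image_sum_le[OF xs])
      have "op_le X (\<lambda>z. (-1) *\<^sub>C (S z - theta_sum (xs n) z)) (cmod (-1) * inverse (real (Suc n)))"
        by (intro op_le_scaleC le diff_closed Sc fc)
      then have "op_le X (\<lambda>z. theta_sum (xs n) z - S z) (inverse (real (Suc n)))"
        by (simp add: complex_vector.scale_minus_left scaleC_one)
      then have "op_le X (\<lambda>z. S z + (theta_sum (xs n) z - S z)) (c + inverse (real (Suc n)))"
        by (intro op_le_add c diff_closed Sc fc)
      then show "op_le X (theta_sum (xs n)) (c + inverse (real (Suc n)))" by simp
    qed
    moreover have "(\<lambda>n. c + inverse (real (Suc n))) \<longlonglongrightarrow> c + 0"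
      by (intro tendsto_intros LIMSEQ_inverse_real_of_nat)
    ultimately have "norm b \<le> c + 0" by (intro LIMSEQ_le[OF tendsto_norm[OF b]]) auto
    then show ?thesis by simp
  qed
  ultimately show ?thesis unfolding is_image_def by blast
qed

lemma is_image_theta:
  "x \<in> carrier X \<Longrightarrow> y \<in> carrier X \<Longrightarrow> is_image (theta X x y) (f x * star (f y))"
  by (simp add: is_image_def image_alg_basis f_theta)

lemma is_image_theta_sum: "pairs xs \<Longrightarrow> is_image (theta_sum xs) (image_sum xs)"
  by (simp add: is_image_def image_sum_image_alg image_sum_apply)

lemma is_image_plus:
  assumes "S \<in> adjointable X" "T \<in> adjointable X" "is_image S b" "is_image T c"
  shows "is_image (\<lambda>z. S z + T z) (b + c)"
  using assms complex_vector.subspace_add[OF csubspace_image_alg]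
  by (simp add: is_image_def f_add adjointable_closed distrib_right)

lemma is_image_scaleC:
  assumes "S \<in> adjointable X" "is_image S b"
  shows "is_image (\<lambda>z. c *\<^sub>C S z) (c *\<^sub>C b)"
  using assms complex_vector.subspace_scale[OF csubspace_image_alg]
  by (simp add: is_image_def f_scaleC adjointable_closed mult_scaleC_left)

lemma is_image_comp:
  assumes S: "S \<in> adjointable X" "is_image S b" and T: "T \<in> adjointable X" "is_image T c"
  shows "is_image (S \<circ> T) (b * c)"
proof -
  have "b * c \<in> image_alg"
    unfolding image_alg_def
  proof (rule closure_cspan_mult_left)
    show "c \<in> closure (cspan {f u * star (f v) | u v. u \<in> carrier X \<and> v \<in> carrier X})"
      using T by (simp add: is_image_def image_alg_def)
    fix s assume "s \<in> {f u * star (f v) | u v. u \<in> carrier X \<and> v \<in> carrier X}"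
    then obtain u v where uv: "s = f u * star (f v)" "u \<in> carrier X" "v \<in> carrier X" by blast
    then have "b * s = f (S u) * star (f v)" using S by (simp add: is_image_def mult.assoc[symmetric])
    then show "b * s \<in> closure (cspan {f u * star (f v) | u v. u \<in> carrier X \<and> v \<in> carrier X})"
      using image_alg_basis[unfolded image_alg_def] uv adjointable_closed[OF S(1)] by simp
  qed
  then show ?thesis using S T adjointable_closed by (simp add: is_image_def mult.assoc)
qed

text \<open>The error \<open>d\<close> lies in the closed span of the vectors \<open>f x\<close>,
  and the adjoint relation makes it orthogonal to all of them, so
  \<open>star d * d = 0\<close>.\<close>

lemma is_image_adjoint:
  assumes S: "S \<in> adjointable X" and T: "T \<in> adjointable X" and ST: "adjoint_pair X S T" and b: "is_image S b"
  shows "is_image T (star b)"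
  unfolding is_image_def
proof (intro conjI ballI)
  show sb: "star b \<in> image_alg" using b by (simp add: star_image_alg is_image_def)
  fix z assume z: "z \<in> carrier X"
  define d where "d = star b * f z - f (T z)"
  let ?V = "closure (cspan (f ` carrier X))"
  have fV: "f x \<in> ?V" if "x \<in> carrier X" for x
    using that by (intro subsetD[OF closure_subset] complex_vector.span_base imageI)
  have "star b * f z \<in> ?V"
  proof (rule closure_cspan_mult_right[OF _ sb[unfolded image_alg_def]])
    fix s assume "s \<in> {f u * star (f v) | u v. u \<in> carrier X \<and> v \<in> carrier X}"
    then obtain u v where "s = f u * star (f v)" "u \<in> carrier X" "v \<in> carrier X" by blast
    then show "s * f z \<in> ?V" using f_theta[of u v z] z fV[OF theta_closed[of u v z]] by simp
  qed
  then have dV: "d \<in> ?V"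
    unfolding d_def by (intro complex_vector.subspace_diff[OF csubspace_closure_cspan] fV adjointable_closed[OF T] z)
  have "star d * f w = 0" if w: "w \<in> carrier X" for w
  proof -
    have "star (f w) * d = star (b * f w) * f z - star (f w) * f (T z)"
      by (simp add: d_def right_diff_distrib star_mult mult.assoc)
    also have "b * f w = f (S w)" using b w by (simp add: is_image_def)
    also have "star (f (S w)) * f z - star (f w) * f (T z) = 0"
      using ST by (simp add: f_inn adjointable_closed S T w z adjoint_pair_def)
    finally have "star (star (f w) * d) = 0" by simp
    then show ?thesis by (simp add: star_mult star_star)
  qed
  then have "star d * d \<in> closure (cspan {})"
    by (intro closure_cspan_mult_left[OF _ dV]) auto
  then have "d = 0" using star_mult_self_eq_0[of d] by simp
  then show "star b * f z = f (T z)" by (simp add: d_def)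
qed

section \<open>The induced homomorphism on the compact operators\<close>

lemma induced_on_compacts_exists: "induced_on_compacts X f (\<lambda>S. THE b. is_image S b)"
proof -
  define \<Phi> where "\<Phi> S = (THE b. is_image S b)" for S
  have \<Phi>I: "\<Phi> S = b" if "is_image S b" for S b
    unfolding \<Phi>_def using that is_image_unique by blast
  have ex: "is_image S (\<Phi> S)" if "S \<in> compacts X" for S
    using is_image_exists[OF that] \<Phi>I by blast
  note ca = compacts_adjointable
  have "\<Phi> (theta X x y) = f x * star (f y)" if "x \<in> carrier X" "y \<in> carrier X" for x y
    using that by (intro \<Phi>I is_image_theta)
  moreover have "\<Phi> (\<lambda>z. S z + T z) = \<Phi> S + \<Phi> T" if "S \<in> compacts X" "T \<in> compacts X" for S T
    using that by (intro \<Phi>I is_image_plus ca ex)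
  moreover have "\<Phi> (\<lambda>z. c *\<^sub>C S z) = c *\<^sub>C \<Phi> S" if "S \<in> compacts X" for S c
    using that by (intro \<Phi>I is_image_scaleC ca ex)
  moreover have "\<Phi> (S \<circ> T) = \<Phi> S * \<Phi> T" if "S \<in> compacts X" "T \<in> compacts X" for S T
    using that by (intro \<Phi>I is_image_comp ca ex)
  moreover have "\<Phi> T = star (\<Phi> S)" if "S \<in> compacts X" "T \<in> compacts X" "adjoint_pair X S T" for S T
    using that by (intro \<Phi>I is_image_adjoint[of S] ca ex)
  moreover have "norm (\<Phi> S) \<le> 1 * c" if "S \<in> compacts X" "op_le X S c" for S c
    using is_image_exists[OF that(1)] that(2) \<Phi>I by force
  ultimately have "induced_on_compacts X f \<Phi>"
    unfolding induced_on_compacts_def by (intro conjI ballI allI impI exI[of _ 1]) auto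
  then show ?thesis unfolding \<Phi>_def .
qed

text \<open>The values on rank one operators are prescribed, additivity extends them to finite rank
  operators, and the boundedness clause extends them to limits.\<close>

lemma induced_on_compacts_unique:
  assumes \<Phi>: "induced_on_compacts X f \<Phi>" and S: "S \<in> compacts X" and b: "is_image S b"
  shows "\<Phi> S = b"
proof -
  have th: "\<Phi> (theta X x y) = f x * star (f y)" if "x \<in> carrier X" "y \<in> carrier X" for x y
    using \<Phi> that by (simp add: induced_on_compacts_def)
  have add: "\<Phi> (\<lambda>z. S z + T z) = \<Phi> S + \<Phi> T" if "S \<in> compacts X" "T \<in> compacts X" for S T
    using \<Phi> that by (simp add: induced_on_compacts_def)
  have sc: "\<Phi> (\<lambda>z. c *\<^sub>C S z) = c *\<^sub>C \<Phi> S" if "S \<in> compacts X" for S c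
    using \<Phi> that by (simp add: induced_on_compacts_def)
  obtain C where C: "C \<ge> 0" "\<And>S c. S \<in> compacts X \<Longrightarrow> op_le X S c \<Longrightarrow> norm (\<Phi> S) \<le> C * c"
    using \<Phi> unfolding induced_on_compacts_def by blast
  have z0: "(\<lambda>z. 0) \<in> compacts X" using theta_sum_compact[of "[]"] by simp
  have fr: "\<Phi> (theta_sum xs) = image_sum xs" if "pairs xs" for xs
    using that
  proof (induction xs)
    case Nil
    then show ?case using add[OF z0 z0] by simp
  next
    case (Cons p xs)
    then have p: "fst p \<in> carrier X" "snd p \<in> carrier X" and xs: "pairs xs" by auto
    show ?case using add[OF theta_compact[OF p] theta_sum_compact[OF xs]] Cons.IH[OF xs] by (simp add: th p)
  qed
  have "norm (\<Phi> S - b) \<le> e" if e: "0 < e" for e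
  proof -
    \<comment> \<open>Chosen so that \<open>(C + 1) * d = e\<close>: the error on the side of
      \<open>\<Phi>\<close> costs \<open>C * d\<close>, that on the side of \<open>b\<close> costs
      \<open>d\<close>.\<close>
    define d where "d = e / (C + 1)"
    have d: "0 < d" using C e by (simp add: d_def)
    have "(C + 1) * d = e" using C by (simp add: d_def)
    then have Cd: "C * d + d = e" by (simp add: algebra_simps)
    obtain xs where xs: "pairs xs" "op_le X (\<lambda>z. S z - theta_sum xs z) d"
      by (rule compacts_approx[OF S d])
    let ?D = "\<lambda>z. S z + (-1) *\<^sub>C theta_sum xs z"
    have D: "?D \<in> compacts X" by (intro compacts_plus compacts_scaleC S theta_sum_compact xs)
    have leD: "op_le X ?D d" using xs(2) by (simp add: complex_vector.scale_minus_left scaleC_one)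
    have "\<Phi> ?D = \<Phi> S - image_sum xs"
      using add[OF S compacts_scaleC[OF theta_sum_compact[OF xs(1)], of "-1"]] sc[OF theta_sum_compact[OF xs(1)], of "-1"]
      by (simp add: fr xs complex_vector.scale_minus_left scaleC_one)
    then have 1: "norm (\<Phi> S - image_sum xs) \<le> C * d" using C(2)[OF D leD] by simp
    obtain c where c: "is_image ?D c" "norm c \<le> d" using is_image_exists[OF D] leD by blast
    have "is_image ?D (b + (-1) *\<^sub>C image_sum xs)"
      using is_image_plus[OF compacts_adjointable[OF S] adjointable_times_scaleC[OF theta_sum_adjointable[OF xs(1)], of "-1"] b
        is_image_scaleC[OF theta_sum_adjointable[OF xs(1)] is_image_theta_sum[OF xs(1)], of "-1"]] .
    then have "c = b - image_sum xs" using is_image_unique[OF c(1)] by (simp add: complex_vector.scale_minus_left scaleC_one)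
    then have 2: "norm (b - image_sum xs) \<le> d" using c by simp
    have "norm (\<Phi> S - b) \<le> norm (\<Phi> S - image_sum xs) + norm (b - image_sum xs)"
      using norm_triangle_ineq4[of "\<Phi> S - image_sum xs" "b - image_sum xs"] by simp
    then show ?thesis using 1 2 Cd by linarith
  qed
  then have "norm (\<Phi> S - b) \<le> 0" by (rule field_le_epsilon) simp
  then show ?thesis by simp
qed

text \<open>The definite description in \<open>induced\<close> is resolved here; from now on
  \<open>induced\<close> is used only through its action on vectors.\<close>

lemma is_image_induced:
  assumes S: "S \<in> compacts X"
  shows "is_image S (induced X f S)"
proof -
  obtain b where b: "is_image S b" using is_image_exists[OF S] by blast
  have "induced X f S = b"
    unfolding induced_def
    using induced_on_compacts_exists induced_on_compacts_unique[OF _ S b] by (intro the_equality) blast+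
  then show ?thesis using b by simp
qed

text \<open>For injective \<open>\<pi>\<close> the map \<open>f\<close> is isometric, so its range
  is complete and contains the limits \<open>b * f z\<close>. Hence \<open>b\<close> acts on the
  module itself, with \<open>star b\<close> acting as adjoint, and approximations of
  \<open>b\<close> by finite sums become approximations of this operator by finite rank
  operators.\<close>

lemma compact_if_image_alg:
  assumes inj: "inj \<pi>" and b: "b \<in> image_alg"
  shows "\<exists>k\<in>compacts X. is_image k b"
proof -
  have ex: "\<exists>l\<in>carrier X. f l = b * f z" if b: "b \<in> image_alg" and z: "z \<in> carrier X" for b z
  proof -
    have "\<exists>xs. pairs xs \<and> norm (b - image_sum xs) < inverse (real (Suc n))" for n
      by (rule image_alg_approx[OF b]) simp
    then obtain xs where xs: "\<And>n. pairs (xs n)"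
      and le: "\<And>n. norm (b - image_sum (xs n)) < inverse (real (Suc n))" by metis
    note fc = theta_sum_closed[OF xs]
    have "(\<lambda>n. b - image_sum (xs n)) \<longlonglongrightarrow> 0"
      by (rule Lim_null_comparison[OF always_eventually LIMSEQ_inverse_real_of_nat])
        (use le in \<open>auto intro: less_imp_le\<close>)
    then have "(\<lambda>n. b - (b - image_sum (xs n))) \<longlonglongrightarrow> b - 0" by (intro tendsto_intros)
    then have "(\<lambda>n. image_sum (xs n)) \<longlonglongrightarrow> b" by simp
    then have "(\<lambda>n. image_sum (xs n) * f z) \<longlonglongrightarrow> b * f z" by (intro tendsto_intros)
    then have lim: "(\<lambda>n. f (theta_sum (xs n) z)) \<longlonglongrightarrow> b * f z" by (simp add: image_sum_apply xs z)
    have mn: "mnorm X (theta_sum (xs m) z - theta_sum (xs n) z) = norm (f (theta_sum (xs m) z) - f (theta_sum (xs n) z))" for m n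
      by (simp add: norm_f_eq[OF inj, symmetric] f_diff diff_closed fc z)
    have "Cauchy (\<lambda>n. f (theta_sum (xs n) z))" using lim LIMSEQ_imp_Cauchy by blast
    then have "\<exists>N. \<forall>m\<ge>N. \<forall>n\<ge>N. mnorm X (theta_sum (xs m) z - theta_sum (xs n) z) < e" if "0 < e" for e
      unfolding mn using CauchyD that by blast
    then obtain l where l: "l \<in> carrier X" "(\<lambda>n. mnorm X (theta_sum (xs n) z - l)) \<longlonglongrightarrow> 0"
      using complete[of "\<lambda>n. theta_sum (xs n) z"] fc z by blast
    have "(\<lambda>n. f (theta_sum (xs n) z)) \<longlonglongrightarrow> f l" by (intro tendsto_f fc z l)
    then show ?thesis using l(1) lim LIMSEQ_unique by blast
  qed
  define op where "op b z = (if z \<in> carrier X then SOME l. l \<in> carrier X \<and> f l = b * f z else 0)" for b z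
  have op: "op b z \<in> carrier X \<and> f (op b z) = b * f z" if "b \<in> image_alg" "z \<in> carrier X" for b z
    using someI_ex[of "\<lambda>l. l \<in> carrier X \<and> f l = b * f z"] ex[OF that] that by (auto simp: op_def)
  note sb = star_image_alg[OF b]
  have "inn X (op b z) w = inn X z (op (star b) w)" if z: "z \<in> carrier X" and w: "w \<in> carrier X" for z w
  proof -
    have "\<pi> (inn X (op b z) w) = star (b * f z) * f w" using op b z w by (simp add: f_inn[symmetric])
    also have "\<dots> = star (f z) * f (op (star b) w)" using op sb w by (simp add: star_mult mult.assoc)
    also have "\<dots> = \<pi> (inn X z (op (star b) w))"
      using op[OF sb w] f_inn[OF z, of "op (star b) w"] by simp
    finally show ?thesis using inj by (simp add: inj_eq)
  qed
  then have adj: "op b \<in> adjointable X"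
    by (intro adjointableI[of _ "op (star b)"]) (use op b sb in \<open>auto simp: op_def[of _ "_ :: 'x"]\<close>)
  have "op b \<in> compacts X"
  proof (rule compactsI[OF adj])
    fix e :: real assume e: "0 < e"
    obtain xs where xs: "pairs xs" "norm (b - image_sum xs) < e"
      using image_alg_approx[OF b e] by blast
    have "op_le X (\<lambda>z. op b z - theta_sum xs z) e"
      unfolding op_le_def
    proof (intro conjI ballI)
      fix z assume z: "z \<in> carrier X"
      have "mnorm X (op b z - theta_sum xs z) = norm ((b - image_sum xs) * f z)"
        using op[OF b z] theta_sum_closed[OF xs(1) z]
        by (simp add: norm_f_eq[OF inj, symmetric] diff_closed f_diff left_diff_distrib image_sum_apply xs z)
      also have "\<dots> \<le> norm (b - image_sum xs) * norm (f z)" by (rule norm_mult_ineq)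
      also have "\<dots> \<le> e * mnorm X z" using xs(2) e norm_f_le[OF z] by (intro mult_mono) simp_all
      finally show "mnorm X (op b z - theta_sum xs z) \<le> e * mnorm X z" .
    qed (use e in simp)
    then show "\<exists>xs. pairs xs \<and> op_le X (\<lambda>z. op b z - theta_sum xs z) e"
      using xs by blast
  qed
  moreover have "is_image (op b) b" using op b by (simp add: is_image_def)
  ultimately show ?thesis by blast
qed

end

section \<open>Product systems\<close>

context product_system
begin

lemma interior_tensor_diff:
  assumes "0 \<le> p" "p \<le> r"
  shows "interior_tensor (fibre X p) (fibre X (r - p)) (fibre X r) (mult X p (r - p))"
  using interior_tensor_mult[of p "r - p"] assms by simp

text \<open>Existence and uniqueness of \<open>S \<otimes> I\<close> give meaning to the definite
  description. Compactness of \<open>S\<close> provides the operator bound that existence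
  requires.\<close>

lemma amplify:
  assumes p: "0 \<le> p" "p \<le> r" and S: "S \<in> compacts (fibre X p)"
  shows amplify_adjointable: "amplify X p r S \<in> adjointable (fibre X r)"
    and amplify_mult: "\<lbrakk>x \<in> carrier (fibre X p); y \<in> carrier (fibre X (r - p))\<rbrakk> \<Longrightarrow>
      amplify X p r S (mult X p (r - p) x y) = mult X p (r - p) (S x) y"
    and op_le_amplify: "\<exists>c. op_le (fibre X r) (amplify X p r S) c"
proof -
  interpret I: interior_tensor "fibre X p" "fibre X (r - p)" "fibre X r" "mult X p (r - p)"
    by (rule interior_tensor_diff[OF p])
  obtain c where c: "op_le (fibre X p) S c" using I.X.op_le_compact[OF S] by blast
  obtain R where R: "I.is_amplification S R" "op_le (fibre X r) R c"
    using I.amplification_exists[OF I.X.compacts_adjointable[OF S] c] by blast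
  have "amplify X p r S = (THE R. I.is_amplification S R)"
    by (simp add: amplify_def I.is_amplification_def)
  also have "\<dots> = R" using R(1) I.amplification_unique by blast
  finally have eq: "amplify X p r S = R" .
  show "amplify X p r S \<in> adjointable (fibre X r)" "\<exists>c. op_le (fibre X r) (amplify X p r S) c"
    "\<lbrakk>x \<in> carrier (fibre X p); y \<in> carrier (fibre X (r - p))\<rbrakk> \<Longrightarrow>
      amplify X p r S (mult X p (r - p) x y) = mult X p (r - p) (S x) y"
    using R unfolding eq I.is_amplification_def by blast+
qed

end

section \<open>Representations of product systems\<close>

locale product_system_rep = product_system X
  for X :: "('g::semilattice_sup_ab_group_add, 'a::cstar_algebra, 'x::complex_vector) psys" +
  fixes \<psi> :: "'g \<Rightarrow> 'x \<Rightarrow> 'b::cstar_algebra"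
  assumes isometric: "isometric_representation X \<psi>"
begin

lemma rep_mult:
  "\<lbrakk>0 \<le> p; 0 \<le> q; x \<in> carrier (fibre X p); y \<in> carrier (fibre X q)\<rbrakk> \<Longrightarrow>
    \<psi> p x * \<psi> q y = \<psi> (p + q) (mult X p q x y)"
  using isometric unfolding isometric_representation_def by blast

lemma coeff_closed: "coeff X a \<in> carrier (fibre X 0)"
  using coeff_bij by (auto simp: bij_betw_def)

sublocale coeff_hom: star_hom "\<lambda>a. \<psi> 0 (coeff X a)"
proof
  have add: "\<psi> 0 (x + y) = \<psi> 0 x + \<psi> 0 y" and sc: "\<psi> 0 (c *\<^sub>C x) = c *\<^sub>C \<psi> 0 x"
    if "x \<in> carrier (fibre X 0)" "y \<in> carrier (fibre X 0)" for x y c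
    using isometric that unfolding isometric_representation_def by blast+
  interpret c: Vector_Spaces.linear scaleC scaleC "coeff X" by (rule coeff_linear)
  fix a b :: 'a and c :: complex
  show "\<psi> 0 (coeff X (a + b)) = \<psi> 0 (coeff X a) + \<psi> 0 (coeff X b)"
    by (simp add: c.add add coeff_closed)
  show "\<psi> 0 (coeff X (c *\<^sub>C a)) = c *\<^sub>C \<psi> 0 (coeff X a)"
    using sc[OF coeff_closed coeff_closed] by (simp add: c.scale)
  show "\<psi> 0 (coeff X (a * b)) = \<psi> 0 (coeff X a) * \<psi> 0 (coeff X b)"
    "\<psi> 0 (coeff X (star a)) = star (\<psi> 0 (coeff X a))"
    using isometric by (simp_all add: isometric_representation_def)
qed

lemma module_rep_fibre: "0 \<le> p \<Longrightarrow> module_rep (fibre X p) (\<lambda>a. \<psi> 0 (coeff X a)) (\<psi> p)"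
proof -
  assume p: "0 \<le> p"
  interpret c: correspondence "fibre X p" by (rule correspondence_fibre[OF p])
  show ?thesis
  proof
    fix x y and c :: complex and a :: 'a
    assume x: "x \<in> carrier (fibre X p)"
    show "\<psi> p (c *\<^sub>C x) = c *\<^sub>C \<psi> p x"
      using isometric p x unfolding isometric_representation_def by blast
    show "\<psi> p (ract (fibre X p) x a) = \<psi> p x * \<psi> 0 (coeff X a)"
      by (simp add: rep_mult p x coeff_closed mult_coeff_right)
    assume y: "y \<in> carrier (fibre X p)"
    show "\<psi> p (x + y) = \<psi> p x + \<psi> p y" "star (\<psi> p x) * \<psi> p y = \<psi> 0 (coeff X (inn (fibre X p) x y))"
      using isometric p x y unfolding isometric_representation_def by blast+
  qed
qed

lemma rep_lact:
  "\<lbrakk>0 \<le> p; x \<in> carrier (fibre X p)\<rbrakk> \<Longrightarrow> \<psi> 0 (coeff X a) * \<psi> p x = \<psi> p (lact (fibre X p) a x)"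
  by (simp add: rep_mult coeff_closed mult_coeff_left)

abbreviation rep_image :: "'g \<Rightarrow> 'b set" where
  "rep_image p \<equiv> closure (cspan {\<psi> p u * star (\<psi> p v) | u v. u \<in> carrier (fibre X p) \<and> v \<in> carrier (fibre X p)})"

text \<open>On an elementary tensor \<open>b\<close> reaches only the left factor, as
  \<open>\<psi> r\<close> of a product is the product of the images; this is the defining property
  of \<open>S \<otimes> I\<close>. Limits of sums of elementary tensors give the rest of the
  fibre.\<close>

lemma amplify_image:
  assumes p: "0 \<le> p" "p \<le> r" and S: "S \<in> compacts (fibre X p)"
    and b: "module_rep.is_image (fibre X p) (\<psi> p) S b" and v: "v \<in> carrier (fibre X r)"
  shows "b * \<psi> r v = \<psi> r (amplify X p r S v)"
proof -
  have r: "0 \<le> r" and rp: "0 \<le> r - p" using p by (auto intro: order_trans)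
  interpret P: module_rep "fibre X p" "\<lambda>a. \<psi> 0 (coeff X a)" "\<psi> p" by (rule module_rep_fibre[OF p(1)])
  interpret R: module_rep "fibre X r" "\<lambda>a. \<psi> 0 (coeff X a)" "\<psi> r" by (rule module_rep_fibre[OF r])
  interpret I: interior_tensor "fibre X p" "fibre X (r - p)" "fibre X r" "mult X p (r - p)"
    by (rule interior_tensor_diff[OF p])
  let ?R = "amplify X p r S"
  have Rc: "?R v \<in> carrier (fibre X r)" if "v \<in> carrier (fibre X r)" for v
    by (rule R.adjointable_closed[OF amplify_adjointable[OF p S] that])
  obtain c where c: "op_le (fibre X r) ?R c" using op_le_amplify[OF p S] by blast
  obtain xs where xs: "\<And>n. I.factors (xs n)"
    "(\<lambda>n. mnorm (fibre X r) (I.tens (xs n) - v)) \<longlonglongrightarrow> 0"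
    using I.approx_tens[OF v] by blast
  have tens: "b * \<psi> r (I.tens ys) = \<psi> r (?R (I.tens ys))"
    if "I.factors ys" for ys
    using that
  proof (induction ys)
    case Nil
    have "?R 0 = 0"
      using R.adjointable_diff[OF amplify_adjointable[OF p S], of 0 0] R.zero_closed by simp
    then show ?case by (simp add: R.f_zero)
  next
    case (Cons q ys)
    then have q: "fst q \<in> carrier (fibre X p)" "snd q \<in> carrier (fibre X (r - p))"
      and ys: "I.factors ys" by auto
    have m: "mult X p (r - p) x y \<in> carrier (fibre X r)" "\<psi> r (mult X p (r - p) x y) = \<psi> p x * \<psi> (r - p) y"
      if "x \<in> carrier (fibre X p)" "y \<in> carrier (fibre X (r - p))" for x y
      using rep_mult[OF p(1) rp that] I.closed that by simp_all
    have Sq: "S (fst q) \<in> carrier (fibre X p)" by (rule P.compacts_closed[OF S q(1)])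
    have "b * \<psi> p (fst q) = \<psi> p (S (fst q))" using b q by (simp add: P.is_image_def)
    then have "b * \<psi> r (mult X p (r - p) (fst q) (snd q)) = \<psi> r (?R (mult X p (r - p) (fst q) (snd q)))"
      by (simp add: m q Sq amplify_mult[OF p S] mult.assoc[symmetric])
    then show ?case
      using Cons.IH[OF ys] m q I.tens_closed[OF ys]
      by (simp add: R.f_add distrib_left R.adjointable_add[OF amplify_adjointable[OF p S]] Rc)
  qed
  show ?thesis
  proof (rule LIMSEQ_unique)
    show "(\<lambda>n. b * \<psi> r (I.tens (xs n))) \<longlonglongrightarrow> b * \<psi> r v"
      by (intro tendsto_intros R.tendsto_f I.tens_closed xs v)
    have "(\<lambda>n. c * mnorm (fibre X r) (I.tens (xs n) - v)) \<longlonglongrightarrow> c * 0"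
      by (intro tendsto_intros xs)
    then have lim: "(\<lambda>n. c * mnorm (fibre X r) (I.tens (xs n) - v)) \<longlonglongrightarrow> 0" by simp
    have "(\<lambda>n. mnorm (fibre X r) (?R (I.tens (xs n)) - ?R v)) \<longlonglongrightarrow> 0"
    proof (rule Lim_null_comparison[OF always_eventually lim], rule allI)
      fix n
      have "?R (I.tens (xs n)) - ?R v = ?R (I.tens (xs n) - v)"
        by (simp add: R.adjointable_diff[OF amplify_adjointable[OF p S]] I.tens_closed xs v)
      then show "norm (mnorm (fibre X r) (?R (I.tens (xs n)) - ?R v)) \<le> c * mnorm (fibre X r) (I.tens (xs n) - v)"
        using c by (simp add: op_le_def R.mnorm_nonneg R.diff_closed I.tens_closed xs v)
    qed
    then show "(\<lambda>n. b * \<psi> r (I.tens (xs n))) \<longlonglongrightarrow> \<psi> r (?R v)"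
      unfolding tens[OF xs(1)] by (intro R.tendsto_f Rc I.tens_closed xs v)
  qed
qed

text \<open>Wick ordered products: adjoints stand on the right.\<close>

definition wick_span :: "'g \<Rightarrow> 'g \<Rightarrow> 'b set" where
  "wick_span p q = {\<psi> (sup p q - p) z * star (\<psi> (sup p q - q) w) | z w.
     z \<in> carrier (fibre X (sup p q - p)) \<and> w \<in> carrier (fibre X (sup p q - q))}"

lemma compactly_aligned_if_wick:
  assumes faithful: "faithful_representation X \<psi>"
    and wick: "\<And>p q x y. \<lbrakk>0 \<le> p; 0 \<le> q; x \<in> carrier (fibre X p); y \<in> carrier (fibre X q)\<rbrakk> \<Longrightarrow>
      star (\<psi> p x) * \<psi> q y \<in> closure (cspan (wick_span p q))"
  shows "compactly_aligned X"
  unfolding compactly_aligned_def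
proof (intro allI impI)
  fix p q :: 'g and S T
  assume p: "0 \<le> p" and q: "0 \<le> q" and S: "S \<in> compacts (fibre X p)" and T: "T \<in> compacts (fibre X q)"
  define r where "r = sup p q"
  have pr: "p \<le> r" and qr: "q \<le> r" by (simp_all add: r_def)
  have r: "0 \<le> r" using p pr by (rule order_trans)
  have inj: "inj (\<lambda>a. \<psi> 0 (coeff X a))"
    using faithful coeff_bij comp_inj_on[of "coeff X" UNIV "\<psi> 0"]
    by (auto simp: faithful_representation_def bij_betw_def comp_def)
  interpret P: module_rep "fibre X p" "\<lambda>a. \<psi> 0 (coeff X a)" "\<psi> p" by (rule module_rep_fibre[OF p])
  interpret Q: module_rep "fibre X q" "\<lambda>a. \<psi> 0 (coeff X a)" "\<psi> q" by (rule module_rep_fibre[OF q])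
  interpret R: module_rep "fibre X r" "\<lambda>a. \<psi> 0 (coeff X a)" "\<psi> r" by (rule module_rep_fibre[OF r])
  interpret IP: interior_tensor "fibre X p" "fibre X (r - p)" "fibre X r" "mult X p (r - p)"
    by (rule interior_tensor_diff[OF p pr])
  interpret IQ: interior_tensor "fibre X q" "fibre X (r - q)" "fibre X r" "mult X q (r - q)"
    by (rule interior_tensor_diff[OF q qr])
  define b c where "b = induced (fibre X p) (\<psi> p) S" and "c = induced (fibre X q) (\<psi> q) T"
  have b: "P.is_image S b" and c: "Q.is_image T c"
    by (simp_all add: b_def c_def P.is_image_induced S Q.is_image_induced T)
  \<comment> \<open>Replacing the inner pair by a Wick ordered product lets the outer factors absorb
    \<open>z\<close> and \<open>w\<close>; both products then lie in the fibre over
    \<open>r\<close>.\<close>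
  have gen: "\<psi> p x * star (\<psi> p x') * (\<psi> q y' * star (\<psi> q y)) \<in> rep_image r"
    if "x \<in> carrier (fibre X p)" "x' \<in> carrier (fibre X p)" "y' \<in> carrier (fibre X q)" "y \<in> carrier (fibre X q)"
    for x x' y y'
  proof -
    have "\<psi> p x * (star (\<psi> p x') * \<psi> q y') * star (\<psi> q y) \<in> rep_image r"
    proof (rule closure_cspan_mult[OF _ wick[OF p q that(2,3)]])
      fix s assume "s \<in> wick_span p q"
      then obtain z w where s: "s = \<psi> (r - p) z * star (\<psi> (r - q) w)"
        and zw: "z \<in> carrier (fibre X (r - p))" "w \<in> carrier (fibre X (r - q))"
        unfolding wick_span_def r_def by blast
      have "\<psi> p x * \<psi> (r - p) z = \<psi> r (mult X p (r - p) x z)"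
        "\<psi> q y * \<psi> (r - q) w = \<psi> r (mult X q (r - q) y w)"
        using that zw p q pr qr by (simp_all add: rep_mult)
      then have "\<psi> p x * s * star (\<psi> q y) = \<psi> r (mult X p (r - p) x z) * star (\<psi> r (mult X q (r - q) y w))"
        unfolding s by (metis mult.assoc star_mult)
      also have "\<dots> \<in> rep_image r"
        unfolding R.image_alg_def[symmetric]
        by (intro R.image_alg_basis IP.closed IQ.closed that zw)
      finally show "\<psi> p x * s * star (\<psi> q y) \<in> rep_image r" .
    qed
    then show ?thesis by (simp add: mult.assoc)
  qed
  have "b * c \<in> rep_image r"
  proof (rule closure_cspan_mult_right)
    show "b \<in> rep_image p" using b by (simp add: P.is_image_def P.image_alg_def)
    fix s assume "s \<in> {\<psi> p u * star (\<psi> p v) | u v. u \<in> carrier (fibre X p) \<and> v \<in> carrier (fibre X p)}"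
    then obtain u v where s: "s = \<psi> p u * star (\<psi> p v)"
      and uv: "u \<in> carrier (fibre X p)" "v \<in> carrier (fibre X p)" by blast
    show "s * c \<in> rep_image r"
      unfolding s
      by (rule closure_cspan_mult_left[of "{\<psi> q u * star (\<psi> q v) | u v. u \<in> carrier (fibre X q) \<and> v \<in> carrier (fibre X q)}"])
        (use c uv gen in \<open>auto simp: Q.is_image_def Q.image_alg_def\<close>)
  qed
  then have "b * c \<in> R.image_alg" by (simp add: R.image_alg_def)
  then obtain k where k: "k \<in> compacts (fibre X r)" "R.is_image k (b * c)"
    using R.compact_if_image_alg[OF inj] by blast
  define S' T' where "S' = amplify X p r S" and "T' = amplify X q r T"
  have S': "S' \<in> adjointable (fibre X r)" and T': "T' \<in> adjointable (fibre X r)"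
    by (simp_all add: S'_def T'_def amplify_adjointable p q pr qr S T)
  \<comment> \<open>Both sides have the same image under \<open>\<psi> r\<close>, which is isometric
    by faithfulness.\<close>
  have "S' \<circ> T' = k"
  proof
    fix v
    show "(S' \<circ> T') v = k v"
    proof (cases "v \<in> carrier (fibre X r)")
      case True
      have T'v: "T' v \<in> carrier (fibre X r)" by (rule R.adjointable_closed[OF T' True])
      have cl: "S' (T' v) \<in> carrier (fibre X r)" "k v \<in> carrier (fibre X r)"
        by (simp_all add: R.adjointable_closed S' T'v R.compacts_closed k True)
      have "\<psi> r (k v) = b * (c * \<psi> r v)" using k(2) True by (simp add: R.is_image_def mult.assoc)
      also have "c * \<psi> r v = \<psi> r (T' v)" unfolding T'_def by (rule amplify_image[OF q qr T c True])
      also have "b * \<psi> r (T' v) = \<psi> r (S' (T' v))" unfolding S'_def by (rule amplify_image[OF p pr S b T'v])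
      finally have "mnorm (fibre X r) (S' (T' v) - k v) = 0"
        by (simp add: R.norm_f_eq[OF inj, symmetric] R.f_diff R.diff_closed cl)
      then have "S' (T' v) - k v = 0" by (intro R.mnorm_eq_0 R.diff_closed cl)
      then show ?thesis by simp
    next
      case False
      have "S' 0 = 0" using R.adjointable_diff[OF S', of 0 0] R.zero_closed by simp
      then show ?thesis
        using False by (simp add: R.adjointable_outside[OF T'] R.adjointable_outside[OF R.compacts_adjointable[OF k(1)]])
    qed
  qed
  then show "amplify X p (sup p q) S \<circ> amplify X q (sup p q) T \<in> compacts (fibre X (sup p q))"
    using k(1) by (simp add: S'_def T'_def r_def)
qed

text \<open>If \<open>u\<close> is a product of \<open>x'\<close> and \<open>y\<close>, the element
  is the image of \<open>y\<close> under the left action of the inner product of \<open>x\<close>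
  and \<open>x'\<close>. For general \<open>u\<close> a limit of such images is enough, as it will
  be used inside a closed span.\<close>

lemma star_rep_mult_limit:
  assumes p: "0 \<le> p" "p \<le> r" and x: "x \<in> carrier (fibre X p)" and u: "u \<in> carrier (fibre X r)"
  shows "\<exists>z. (\<forall>n. z n \<in> carrier (fibre X (r - p))) \<and> (\<lambda>n. \<psi> (r - p) (z n)) \<longlonglongrightarrow> star (\<psi> p x) * \<psi> r u"
proof -
  have r: "0 \<le> r" and rp: "0 \<le> r - p" using p by (auto intro: order_trans)
  interpret P: module_rep "fibre X p" "\<lambda>a. \<psi> 0 (coeff X a)" "\<psi> p" by (rule module_rep_fibre[OF p(1)])
  interpret D: module_rep "fibre X (r - p)" "\<lambda>a. \<psi> 0 (coeff X a)" "\<psi> (r - p)" by (rule module_rep_fibre[OF rp])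
  interpret R: module_rep "fibre X r" "\<lambda>a. \<psi> 0 (coeff X a)" "\<psi> r" by (rule module_rep_fibre[OF r])
  interpret I: interior_tensor "fibre X p" "fibre X (r - p)" "fibre X r" "mult X p (r - p)"
    by (rule interior_tensor_diff[OF p])
  have ex: "\<exists>z\<in>carrier (fibre X (r - p)). \<psi> (r - p) z = star (\<psi> p x) * \<psi> r (I.tens ys)"
    if "I.factors ys" for ys
    using that
  proof (induction ys)
    case Nil
    then show ?case by (intro bexI[of _ 0]) (simp_all add: D.f_zero R.f_zero D.zero_closed)
  next
    case (Cons q ys)
    then have q: "fst q \<in> carrier (fibre X p)" "snd q \<in> carrier (fibre X (r - p))"
      and ys: "I.factors ys" by auto
    obtain z where z: "z \<in> carrier (fibre X (r - p))" "\<psi> (r - p) z = star (\<psi> p x) * \<psi> r (I.tens ys)"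
      using Cons.IH[OF ys] by blast
    define l where "l = lact (fibre X (r - p)) (inn (fibre X p) x (fst q)) (snd q)"
    have l: "l \<in> carrier (fibre X (r - p))" by (simp add: l_def I.Y.lact_closed q)
    have "\<psi> (r - p) l = star (\<psi> p x) * \<psi> p (fst q) * \<psi> (r - p) (snd q)"
      by (simp add: l_def rep_lact[OF rp q(2), symmetric] P.f_inn x q)
    also have "\<dots> = star (\<psi> p x) * \<psi> r (mult X p (r - p) (fst q) (snd q))"
      using rep_mult[OF p(1) rp q] by (simp add: mult.assoc)
    finally have "\<psi> (r - p) (l + z) = star (\<psi> p x) * \<psi> r (I.tens (q # ys))"
      by (simp add: D.f_add l z R.f_add I.closed q I.tens_closed ys distrib_left)
    then show ?case using D.add_closed[OF l z(1)] by blast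
  qed
  obtain xs where xs: "\<And>n. I.factors (xs n)"
    "(\<lambda>n. mnorm (fibre X r) (I.tens (xs n) - u)) \<longlonglongrightarrow> 0"
    using I.approx_tens[OF u] by blast
  from ex[OF xs(1)] obtain z where z: "\<And>n. z n \<in> carrier (fibre X (r - p))"
    "\<And>n. \<psi> (r - p) (z n) = star (\<psi> p x) * \<psi> r (I.tens (xs n))" by metis
  have "(\<lambda>n. star (\<psi> p x) * \<psi> r (I.tens (xs n))) \<longlonglongrightarrow> star (\<psi> p x) * \<psi> r u"
    by (intro tendsto_intros R.tendsto_f I.tens_closed xs u)
  then show ?thesis using z by (intro exI[of _ z]) simp
qed

lemma wick_if_compactly_aligned:
  assumes aligned: "compactly_aligned X" and nica: "nica_covariant X \<psi>"
    and p: "0 \<le> p" and q: "0 \<le> q" and x: "x \<in> carrier (fibre X p)" and y: "y \<in> carrier (fibre X q)"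
  shows "star (\<psi> p x) * \<psi> q y \<in> closure (cspan (wick_span p q))"
proof -
  define r where "r = sup p q"
  have pr: "p \<le> r" and qr: "q \<le> r" by (simp_all add: r_def)
  have r: "0 \<le> r" using p pr by (rule order_trans)
  let ?V = "closure (cspan (wick_span p q))"
  interpret P: module_rep "fibre X p" "\<lambda>a. \<psi> 0 (coeff X a)" "\<psi> p" by (rule module_rep_fibre[OF p])
  interpret Q: module_rep "fibre X q" "\<lambda>a. \<psi> 0 (coeff X a)" "\<psi> q" by (rule module_rep_fibre[OF q])
  interpret R: module_rep "fibre X r" "\<lambda>a. \<psi> 0 (coeff X a)" "\<psi> r" by (rule module_rep_fibre[OF r])
  \<comment> \<open>Both outer vectors are absorbed by \<open>star_rep_mult_limit\<close>:
    \<open>x\<close> lowers \<open>u\<close> to the fibre over \<open>r - p\<close>, and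
    \<open>y\<close> lowers \<open>v\<close> to the fibre over \<open>r - q\<close>.\<close>
  have rep_r: "star (\<psi> p x) * b * \<psi> q y \<in> ?V" if "b \<in> rep_image r" for b
  proof (rule closure_cspan_mult[OF _ that])
    fix s assume "s \<in> {\<psi> r u * star (\<psi> r v) | u v. u \<in> carrier (fibre X r) \<and> v \<in> carrier (fibre X r)}"
    then obtain u v where s: "s = \<psi> r u * star (\<psi> r v)"
      and uv: "u \<in> carrier (fibre X r)" "v \<in> carrier (fibre X r)" by blast
    obtain z where z: "\<And>n. z n \<in> carrier (fibre X (r - p))"
      "(\<lambda>n. \<psi> (r - p) (z n)) \<longlonglongrightarrow> star (\<psi> p x) * \<psi> r u"
      using star_rep_mult_limit[OF p pr x uv(1)] by blast
    obtain w where w: "\<And>n. w n \<in> carrier (fibre X (r - q))"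
      "(\<lambda>n. \<psi> (r - q) (w n)) \<longlonglongrightarrow> star (\<psi> q y) * \<psi> r v"
      using star_rep_mult_limit[OF q qr y uv(2)] by blast
    have lim: "(\<lambda>n. \<psi> (r - p) (z n) * star (\<psi> (r - q) (w n)))
        \<longlonglongrightarrow> star (\<psi> p x) * \<psi> r u * star (star (\<psi> q y) * \<psi> r v)"
      by (intro tendsto_intros z bounded_linear.tendsto[OF bounded_linear_star] w)
    have eq: "star (\<psi> p x) * \<psi> r u * star (star (\<psi> q y) * \<psi> r v) = star (\<psi> p x) * s * \<psi> q y"
      by (simp add: s star_mult star_star mult.assoc)
    have mem: "\<psi> (r - p) (z n) * star (\<psi> (r - q) (w n)) \<in> ?V" for n
      using z(1)[of n] w(1)[of n] unfolding r_def
      by (intro subsetD[OF closure_subset] complex_vector.span_base) (auto simp: wick_span_def)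
    show "star (\<psi> p x) * s * \<psi> q y \<in> ?V"
      using closed_sequentially[OF closed_closure mem lim] unfolding eq .
  qed
  \<comment> \<open>Nica covariance turns the product of the two images into the image of one
    operator over \<open>r\<close>, and compact alignment makes that operator compact.\<close>
  have ind: "star (\<psi> p x) * (P.image_sum xs * Q.image_sum ys) * \<psi> q y \<in> ?V"
    if xs: "P.pairs xs"
      and ys: "Q.pairs ys" for xs ys
  proof (rule rep_r)
    note cx = P.theta_sum_compact[OF xs] and cy = Q.theta_sum_compact[OF ys]
    define k where "k = amplify X p r (P.theta_sum xs) \<circ> amplify X q r (Q.theta_sum ys)"
    have k: "k \<in> compacts (fibre X r)"
      using aligned p q cx cy unfolding compactly_aligned_def k_def r_def by blast
    have "P.image_sum xs = induced (fibre X p) (\<psi> p) (P.theta_sum xs)"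
      using P.is_image_unique[OF P.is_image_theta_sum[OF xs] P.is_image_induced[OF cx]] .
    moreover have "Q.image_sum ys = induced (fibre X q) (\<psi> q) (Q.theta_sum ys)"
      using Q.is_image_unique[OF Q.is_image_theta_sum[OF ys] Q.is_image_induced[OF cy]] .
    ultimately have "P.image_sum xs * Q.image_sum ys = induced (fibre X r) (\<psi> r) k"
      using nica p q cx cy unfolding nica_covariant_def k_def r_def by metis
    then show "P.image_sum xs * Q.image_sum ys \<in> rep_image r"
      using R.is_image_induced[OF k] by (simp add: R.is_image_def R.image_alg_def)
  qed
  \<comment> \<open>Stated for an arbitrary fibre because it serves both \<open>x\<close> and
    \<open>y\<close>. It replaces an exact factorisation of a vector through a compact
    operator.\<close>
  have approx: "\<exists>s. (\<forall>n. set (s n) \<subseteq> carrier (fibre X p') \<times> carrier (fibre X p')) \<and>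
      (\<lambda>n. module_rep.image_sum (\<psi> p') (s n) * \<psi> p' x') \<longlonglongrightarrow> \<psi> p' x'"
    if p': "0 \<le> p'" and x': "x' \<in> carrier (fibre X p')" for p' x'
  proof -
    interpret M: module_rep "fibre X p'" "\<lambda>a. \<psi> 0 (coeff X a)" "\<psi> p'" by (rule module_rep_fibre[OF p'])
    have fr: "tensor_sum (\<lambda>u v. ract (fibre X p') u (inn (fibre X p') v x')) xs = M.theta_sum xs x'" for xs
      by (simp add: M.theta_sum_def M.theta_apply x')
    have "\<exists>xs. M.pairs xs \<and>
        mnorm (fibre X p') (x' - M.theta_sum xs x') < inverse (real (Suc n))" for n
      using M.approx_finite_rank[OF x', of "inverse (real (Suc n))"] by (simp add: fr)
    then obtain s where s: "\<And>n. M.pairs (s n)"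
      "\<And>n. mnorm (fibre X p') (x' - M.theta_sum (s n) x') < inverse (real (Suc n))" by metis
    have "(\<lambda>n. mnorm (fibre X p') (M.theta_sum (s n) x' - x')) \<longlonglongrightarrow> 0"
      by (rule Lim_null_comparison[OF always_eventually LIMSEQ_inverse_real_of_nat])
        (use s in \<open>simp add: M.mnorm_commute[of x'] x' M.theta_sum_closed M.mnorm_nonneg less_imp_le\<close>)
    then have "(\<lambda>n. \<psi> p' (M.theta_sum (s n) x')) \<longlonglongrightarrow> \<psi> p' x'"
      by (intro M.tendsto_f M.theta_sum_closed s x')
    then show ?thesis using s by (intro exI[of _ s]) (simp add: M.image_sum_apply x')
  qed
  obtain s where s: "\<And>n. P.pairs (s n)"
    "(\<lambda>n. P.image_sum (s n) * \<psi> p x) \<longlonglongrightarrow> \<psi> p x" using approx[OF p x] by blast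
  obtain t where t: "\<And>n. Q.pairs (t n)"
    "(\<lambda>n. Q.image_sum (t n) * \<psi> q y) \<longlonglongrightarrow> \<psi> q y" using approx[OF q y] by blast
  have lim: "(\<lambda>n. star (P.image_sum (s n) * \<psi> p x) * (Q.image_sum (t n) * \<psi> q y)) \<longlonglongrightarrow> star (\<psi> p x) * \<psi> q y"
    by (intro tendsto_intros bounded_linear.tendsto[OF bounded_linear_star] s t)
  have mem: "star (P.image_sum (s n) * \<psi> p x) * (Q.image_sum (t n) * \<psi> q y) \<in> ?V" for n
  proof -
    \<comment> \<open>The adjoint moves the finite rank factor of \<open>x\<close> to the right of
      \<open>star (\<psi> p x)\<close> and exchanges the two entries of each pair.\<close>
    have "P.pairs (map prod.swap (s n))" using s(1)[of n] by auto
    from ind[OF this t(1)[of n]] show ?thesis by (simp add: star_mult P.star_image_sum mult.assoc)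
  qed
  show ?thesis by (rule closed_sequentially[OF closed_closure mem lim])
qed

end

theorem proposition3p2:
  fixes X :: "('g::semilattice_sup_ab_group_add, 'a::cstar_algebra, 'x::complex_vector) psys"
  assumes "product_system X"
  shows "(\<forall>\<psi> :: 'g \<Rightarrow> 'x \<Rightarrow> 'h::complex_hilbert bop.
            isometric_representation X \<psi> \<longrightarrow> faithful_representation X \<psi> \<longrightarrow>
            nica_covariant_on_space X \<psi> \<longrightarrow>
            (\<forall>p q x y. 0 \<le> p \<longrightarrow> 0 \<le> q \<longrightarrow> x \<in> carrier (fibre X p) \<longrightarrow> y \<in> carrier (fibre X q) \<longrightarrow>
               star (\<psi> p x) * \<psi> q y \<in> closure (cspan
                 {\<psi> (sup p q - p) z * star (\<psi> (sup p q - q) w) | z w.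
                    z \<in> carrier (fibre X (sup p q - p)) \<and> w \<in> carrier (fibre X (sup p q - q))})) \<longrightarrow>
            compactly_aligned X)
       \<and> (compactly_aligned X \<longrightarrow>
          (\<forall>\<psi> :: 'g \<Rightarrow> 'x \<Rightarrow> 'b::cstar_algebra.
            isometric_representation X \<psi> \<longrightarrow> nica_covariant X \<psi> \<longrightarrow>
            (\<forall>p q x y. 0 \<le> p \<longrightarrow> 0 \<le> q \<longrightarrow> x \<in> carrier (fibre X p) \<longrightarrow> y \<in> carrier (fibre X q) \<longrightarrow>
               star (\<psi> p x) * \<psi> q y \<in> closure (cspan
                 {\<psi> (sup p q - p) z * star (\<psi> (sup p q - q) w) | z w.
                    z \<in> carrier (fibre X (sup p q - p)) \<and> w \<in> carrier (fibre X (sup p q - q))}))))"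
proof -
  \<comment> \<open>The target algebra is left generic because it is instantiated both with the
    operators on a Hilbert space and with an arbitrary C*-algebra.\<close>
  have rep: "product_system_rep X \<psi>" if "isometric_representation X \<psi>"
    for \<psi> :: "'g \<Rightarrow> 'x \<Rightarrow> 'c::cstar_algebra"
    using assms that by (simp add: product_system_rep_def product_system_rep_axioms_def)
  show ?thesis
  proof (intro conjI allI impI)
    fix \<psi> :: "'g \<Rightarrow> 'x \<Rightarrow> 'h bop"
    assume iso: "isometric_representation X \<psi>"
    interpret product_system_rep X \<psi> by (rule rep[OF iso])
    assume "faithful_representation X \<psi>"
      "\<forall>p q x y. 0 \<le> p \<longrightarrow> 0 \<le> q \<longrightarrow> x \<in> carrier (fibre X p) \<longrightarrow> y \<in> carrier (fibre X q) \<longrightarrow>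
        star (\<psi> p x) * \<psi> q y \<in> closure (cspan
          {\<psi> (sup p q - p) z * star (\<psi> (sup p q - q) w) | z w.
             z \<in> carrier (fibre X (sup p q - p)) \<and> w \<in> carrier (fibre X (sup p q - q))})"
    then show "compactly_aligned X"
      by (intro compactly_aligned_if_wick) (simp_all add: wick_span_def)
  next
    fix \<psi> :: "'g \<Rightarrow> 'x \<Rightarrow> 'b" and p q x y
    assume iso: "isometric_representation X \<psi>"
    interpret product_system_rep X \<psi> by (rule rep[OF iso])
    assume "compactly_aligned X" "nica_covariant X \<psi>" "0 \<le> p" "0 \<le> q"
      "x \<in> carrier (fibre X p)" "y \<in> carrier (fibre X q)"
    then show "star (\<psi> p x) * \<psi> q y \<in> closure (cspan
        {\<psi> (sup p q - p) z * star (\<psi> (sup p q - q) w) | z w.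
           z \<in> carrier (fibre X (sup p q - p)) \<and> w \<in> carrier (fibre X (sup p q - q))})"
      unfolding wick_span_def[symmetric] by (rule wick_if_compactly_aligned)
  qed
qed

end
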